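(* Let $\mathcal Y\subset\mathbb{C}^7$ be the hypersurface, in coordinates $(a,b,c,X,Y,Z,T)$, given by \[ F=X^2+(ac-b^2)T^2+aY^2-2bYZ+cZ^2=0 . \] Then the blow-up of $\mathcal Y$ in the ideal generated by the $2\times2$ minors of the $2\times4$ matrix \[ M=\begin{pmatrix} Z & -aT & X-bT & -aY\\ T & Z & Y & X-bT\end{pmatrix} \] defines a small resolution $\widehat{\mathcal X}\to\mathcal Y$.
   Context: A small resolution of $\mathcal Y$ is a proper birational morphism $\widehat{\mathcal X}\to\mathcal Y$ with $\widehat{\mathcal X}$ smooth whose exceptional set has codimension at least two in $\widehat{\mathcal X}$. *)

theory Defs
  imports "HOL-Analysis.Abstract_Topology" "HOL-Library.Extended_Nat"
    "Jordan_Normal_Form.Determinant"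
begin

text \<open>
  Classical varieties over the complex numbers: a space of closed points with its Zariski topology
  and, for each open set, the set of regular functions on it. Functions are total in HOL; the
  condition defining \<open>reg X U\<close> depends only on the values on \<open>U\<close>, and \<open>reg X U\<close> is meant to be used
  for open \<open>U\<close>.
\<close>

record 'p variety =
  zar :: "'p topology"
  reg :: "'p set \<Rightarrow> ('p \<Rightarrow> complex) set"

abbreviation points :: "('p, 'z) variety_scheme \<Rightarrow> 'p set" where
  "points X \<equiv> topspace (zar X)"

inductive_set algebra_generated :: "('p \<Rightarrow> complex) set \<Rightarrow> ('p \<Rightarrow> complex) set"
  for C :: "('p \<Rightarrow> complex) set" where
  const: "(\<lambda>_. c) \<in> algebra_generated C"
| gen: "f \<in> C \<Longrightarrow> f \<in> algebra_generated C"
| add: "f \<in> algebra_generated C \<Longrightarrow> g \<in> algebra_generated C \<Longrightarrow> (\<lambda>p. f p + g p) \<in> algebra_generated C"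
| mult: "f \<in> algebra_generated C \<Longrightarrow> g \<in> algebra_generated C \<Longrightarrow> (\<lambda>p. f p * g p) \<in> algebra_generated C"


section \<open>Affine space, affine space times projective space, subvarieties\<close>

definition polys :: "nat \<Rightarrow> (complex vec \<Rightarrow> complex) set" where
  "polys n = algebra_generated {\<lambda>x. x $ i | i. i < n}"

definition zariski_affine :: "nat \<Rightarrow> complex vec topology" where
  "zariski_affine n = topology_generated_by {{x \<in> carrier_vec n. f x \<noteq> 0} | f. f \<in> polys n}"

definition affine_space :: "nat \<Rightarrow> complex vec variety" where
  "affine_space n =
    \<lparr>zar = zariski_affine n,
     reg = (\<lambda>U. {f. \<forall>p\<in>U. \<exists>W g h. openin (zariski_affine n) W \<and> p \<in> W \<and> W \<subseteq> U \<and>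
        g \<in> polys n \<and> h \<in> polys n \<and> (\<forall>x\<in>W. h x \<noteq> 0 \<and> f x = g x / h x)})\<rparr>"

text \<open>
  \<open>proj_space r\<close> is the projective space with \<open>r\<close> homogeneous coordinates, so of dimension \<open>r - 1\<close>;
  its points are the lines through the origin.
\<close>

definition line :: "complex vec \<Rightarrow> complex vec set" where
  "line u = {c \<cdot>\<^sub>v u | c. True}"

definition proj_space :: "nat \<Rightarrow> complex vec set set" where
  "proj_space r = {line u | u. u \<in> carrier_vec r \<and> u \<noteq> 0\<^sub>v r}"

text \<open>Polynomials in \<open>(x, u)\<close> that are homogeneous of degree \<open>d\<close> in \<open>u\<close>.\<close>

definition homog_polys :: "nat \<Rightarrow> nat \<Rightarrow> nat \<Rightarrow> (complex vec \<times> complex vec \<Rightarrow> complex) set" where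
  "homog_polys n r d =
    {G \<in> algebra_generated ({\<lambda>(x, u). x $ i | i. i < n} \<union> {\<lambda>(x, u). u $ j | j. j < r}).
      \<forall>x\<in>carrier_vec n. \<forall>u\<in>carrier_vec r. \<forall>c. G (x, c \<cdot>\<^sub>v u) = c ^ d * G (x, u)}"

definition zariski_affine_proj :: "nat \<Rightarrow> nat \<Rightarrow> (complex vec \<times> complex vec set) topology" where
  "zariski_affine_proj n r = topology_generated_by
    {{(x, L). x \<in> carrier_vec n \<and> L \<in> proj_space r \<and> (\<exists>u\<in>L. G (x, u) \<noteq> 0)}
      | d G. G \<in> homog_polys n r d}"

definition affine_proj_space :: "nat \<Rightarrow> nat \<Rightarrow> (complex vec \<times> complex vec set) variety" where
  "affine_proj_space n r =
    \<lparr>zar = zariski_affine_proj n r,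
     reg = (\<lambda>U. {f. \<forall>p\<in>U. \<exists>W d G H. openin (zariski_affine_proj n r) W \<and> p \<in> W \<and> W \<subseteq> U \<and>
        G \<in> homog_polys n r d \<and> H \<in> homog_polys n r d \<and>
        (\<forall>(x, L)\<in>W. \<forall>u\<in>L - {0\<^sub>v r}. H (x, u) \<noteq> 0 \<and> f (x, L) = G (x, u) / H (x, u))})\<rparr>"

text \<open>The induced (reduced) structure on a locally closed subset.\<close>

definition subvariety :: "'p variety \<Rightarrow> 'p set \<Rightarrow> 'p variety" where
  "subvariety X S =
    \<lparr>zar = subtopology (zar X) S,
     reg = (\<lambda>U. {f. \<forall>p\<in>U. \<exists>W g. openin (zar X) W \<and> p \<in> W \<and> g \<in> reg X W \<and>
        (\<forall>q\<in>W \<inter> U. f q = g q)})\<rparr>"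


section \<open>Morphisms\<close>

definition morphism :: "'p variety \<Rightarrow> 'q variety \<Rightarrow> ('p \<Rightarrow> 'q) \<Rightarrow> bool" where
  "morphism X Y f \<longleftrightarrow> continuous_map (zar X) (zar Y) f \<and>
    (\<forall>U g. openin (zar Y) U \<and> g \<in> reg Y U \<longrightarrow> g \<circ> f \<in> reg X {x \<in> points X. f x \<in> U})"

definition isomorphism :: "'p variety \<Rightarrow> 'q variety \<Rightarrow> ('p \<Rightarrow> 'q) \<Rightarrow> bool" where
  "isomorphism X Y f \<longleftrightarrow> morphism X Y f \<and>
    (\<exists>g. morphism Y X g \<and> (\<forall>x\<in>points X. g (f x) = x) \<and> (\<forall>y\<in>points Y. f (g y) = y))"

definition birational_morphism :: "'p variety \<Rightarrow> 'q variety \<Rightarrow> ('p \<Rightarrow> 'q) \<Rightarrow> bool" where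
  "birational_morphism X Y f \<longleftrightarrow> morphism X Y f \<and>
    (\<exists>V U. openin (zar X) V \<and> zar X closure_of V = points X \<and>
      openin (zar Y) U \<and> zar Y closure_of U = points Y \<and>
      isomorphism (subvariety X V) (subvariety Y U) f)"

text \<open>
  The Zariski topology of the product variety (not the product of the topologies): on a product of
  open sets, basic open sets are the nonvanishing loci of finite sums of \<open>f(x) g(y)\<close> with \<open>f\<close>,
  \<open>g\<close> regular.
\<close>

definition zar_product :: "'p variety \<Rightarrow> 'q variety \<Rightarrow> ('p \<times> 'q) topology" where
  "zar_product X Y = topology_generated_by
    {{p \<in> U \<times> V. h p \<noteq> 0} | U V h. openin (zar X) U \<and> openin (zar Y) V \<and>
      h \<in> algebra_generated ({f \<circ> fst | f. f \<in> reg X U} \<union> {g \<circ> snd | g. g \<in> reg Y V})}"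

definition separated_morphism :: "'p variety \<Rightarrow> 'q variety \<Rightarrow> ('p \<Rightarrow> 'q) \<Rightarrow> bool" where
  "separated_morphism X Y f \<longleftrightarrow>
    closedin (subtopology (zar_product X X) {(x, x'). f x = f x'}) {(x, x) | x. x \<in> points X}"

text \<open>
  Closed after every base change \<open>h : Z \<rightarrow> Y\<close>. Being closed is local on the base, so affine
  varieties \<open>Z\<close> are enough.
\<close>

definition universally_closed :: "'p variety \<Rightarrow> 'q variety \<Rightarrow> ('p \<Rightarrow> 'q) \<Rightarrow> bool" where
  "universally_closed X Y f \<longleftrightarrow>
    (\<forall>k S h. closedin (zar (affine_space k)) S \<and> morphism (subvariety (affine_space k) S) Y h \<longrightarrow>
      (let Z = subvariety (affine_space k) S in
        closed_map (subtopology (zar_product X Z) {(x, z). f x = h z}) (zar Z) snd))"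

text \<open>
  Every morphism between locally closed subvarieties of the ambient spaces above is of finite type,
  so this condition is not part of the definition.
\<close>

definition proper_morphism :: "'p variety \<Rightarrow> 'q variety \<Rightarrow> ('p \<Rightarrow> 'q) \<Rightarrow> bool" where
  "proper_morphism X Y f \<longleftrightarrow>
    morphism X Y f \<and> separated_morphism X Y f \<and> universally_closed X Y f"


section \<open>Codimension and smoothness\<close>

definition irreducible_closed :: "'p topology \<Rightarrow> 'p set \<Rightarrow> bool" where
  "irreducible_closed T W \<longleftrightarrow> closedin T W \<and> W \<noteq> {} \<and>
    (\<forall>A B. closedin T A \<and> closedin T B \<and> W \<subseteq> A \<union> B \<longrightarrow> W \<subseteq> A \<or> W \<subseteq> B)"

text \<open>
  Krull codimension of a closed set \<open>E\<close>: the infimum over the irreducible closed \<open>W \<subseteq> E\<close> of the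
  supremal length of a chain of irreducible closed sets starting at \<open>W\<close> (\<open>\<infinity>\<close> for empty \<open>E\<close>).
  For a closed point \<open>p\<close>, \<open>codim X {p}\<close> is the Krull dimension of the local ring at \<open>p\<close>.
\<close>

definition codim :: "'p variety \<Rightarrow> 'p set \<Rightarrow> enat" where
  "codim X E = (INF W\<in>{W. irreducible_closed (zar X) W \<and> W \<subseteq> E}.
    SUP n\<in>{n. \<exists>c. c 0 = W \<and> (\<forall>i\<le>n. irreducible_closed (zar X) (c i)) \<and> (\<forall>i<n. c i \<subset> c (Suc i))}.
      enat n)"

text \<open>
  The local ring at \<open>p\<close> is regular: its maximal ideal, the germs of regular functions vanishing
  at \<open>p\<close>, is generated by as many elements as the Krull dimension of the ring.
\<close>

definition regular_point :: "'p variety \<Rightarrow> 'p \<Rightarrow> bool" where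
  "regular_point X p \<longleftrightarrow>
    (\<exists>n U g. enat n = codim X {p} \<and> openin (zar X) U \<and> p \<in> U \<and>
      (\<forall>i<n. g i \<in> reg X U \<and> g i p = 0) \<and>
      (\<forall>V f. openin (zar X) V \<and> p \<in> V \<and> f \<in> reg X V \<and> f p = 0 \<longrightarrow>
        (\<exists>W h. openin (zar X) W \<and> p \<in> W \<and> W \<subseteq> U \<inter> V \<and> (\<forall>i<n. h i \<in> reg X W) \<and>
          (\<forall>q\<in>W. f q = (\<Sum>i<n. h i q * g i q)))))"

definition smooth :: "'p variety \<Rightarrow> bool" where
  "smooth X \<longleftrightarrow> (\<forall>p\<in>points X. regular_point X p)"


section \<open>Small resolutions and blow-ups\<close>

text \<open>The complement of the preimage of the largest open set over which \<open>f\<close> is an isomorphism.\<close>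

definition exceptional_set :: "'p variety \<Rightarrow> 'q variety \<Rightarrow> ('p \<Rightarrow> 'q) \<Rightarrow> 'p set" where
  "exceptional_set X Y f = {x \<in> points X. \<not> (\<exists>U. openin (zar Y) U \<and> f x \<in> U \<and>
    isomorphism (subvariety X {x' \<in> points X. f x' \<in> U}) (subvariety Y U) f)}"

definition small_resolution :: "'p variety \<Rightarrow> 'q variety \<Rightarrow> ('p \<Rightarrow> 'q) \<Rightarrow> bool" where
  "small_resolution X Y f \<longleftrightarrow> proper_morphism X Y f \<and> birational_morphism X Y f \<and> smooth X \<and>
    codim X (exceptional_set X Y f) \<ge> 2"

text \<open>
  The blow-up of the (reduced) closed subvariety \<open>S\<close> of affine \<open>n\<close>-space in the ideal generated by
  the restrictions to \<open>S\<close> of the polynomials \<open>gs\<close>: the Zariski closure of the graph of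
  \<open>x \<mapsto> [g\<^sub>1(x) : \<dots> : g\<^sub>r(x)]\<close>, which is defined where some \<open>g\<^sub>i\<close> does not vanish. The blow-up
  morphism is the restriction of \<^const>\<open>fst\<close>.
\<close>

definition blow_up :: "nat \<Rightarrow> complex vec set \<Rightarrow> (complex vec \<Rightarrow> complex) list \<Rightarrow>
    (complex vec \<times> complex vec set) variety" where
  "blow_up n S gs = (let A = affine_proj_space n (length gs) in
    subvariety A (zar A closure_of
      {(x, line (vec_of_list (map (\<lambda>g. g x) gs))) | x. x \<in> S \<and> (\<exists>g\<in>set gs. g x \<noteq> 0)}))"


section \<open>The hypersurface and the centre of the blow-up\<close>

text \<open>
  The coordinates \<open>(a, b, c, X, Y, Z, T)\<close> are the entries \<open>0, \<dots>, 6\<close> of a vector. The polynomial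
  \<open>F\<close> is irreducible, so the hypersurface is reduced and is given by its set of points.
\<close>

definition F :: "complex vec \<Rightarrow> complex" where
  "F v = (let a = v $ 0; b = v $ 1; c = v $ 2; X = v $ 3; Y = v $ 4; Z = v $ 5; T = v $ 6 in
    X^2 + (a*c - b^2) * T^2 + a * Y^2 - 2*b*Y*Z + c * Z^2)"

definition hypersurface :: "complex vec set" where
  "hypersurface = {v \<in> carrier_vec 7. F v = 0}"

definition M :: "complex vec \<Rightarrow> complex mat" where
  "M v = (let a = v $ 0; b = v $ 1; X = v $ 3; Y = v $ 4; Z = v $ 5; T = v $ 6 in
    mat_of_rows_list 4
      [[Z, - a * T, X - b * T, - a * Y],
       [T, Z,       Y,         X - b * T]])"

definition minor2 :: "nat \<Rightarrow> nat \<Rightarrow> complex vec \<Rightarrow> complex" where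
  "minor2 i j v = det (mat_of_cols 2 [col (M v) i, col (M v) j])"

definition minors :: "(complex vec \<Rightarrow> complex) list" where
  "minors = [minor2 i j. i \<leftarrow> [0..<4], j \<leftarrow> [Suc i..<4]]"

end

(*
On the hypersurface the six minors are proportional to (s, t, w, -w, at, 2bt - cs), and the blow-up
is the locus of all (y, (s : t : w)) with (s, t) nonzero that satisfy four equations linear in
(s, t, w) and the conic w^2 + at^2 - 2bst + cs^2 = 0. Solving these equations for s = 1 and for
t = 1 gives two charts isomorphic to affine 6-space. Hence the blow-up is smooth, and it is
irreducible, so every chart is dense in it.

The triple (s : t : w) is recovered from y by the minors themselves and by a second triple of
polynomials, so the projection is an isomorphism outside the locus where both triples vanish; that
locus lies in {p1 = X = 0}, where p1 is the first minor. An irreducible closed subset of it which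
meets the chart s = 1 is properly contained in the closure of {p1 = 0} in that chart, and otherwise
in the divisor {s = 0}; this gives codimension at least two.

For universal closedness, a norm with respect to the double cover (s : t : w) -> (s : t) reduces the
elimination theory of the fibres to binary forms: if those vanishing on a closed set have no common
zero over z0, they contain over z0 all monomials of some degree, and the determinant of their
coefficients is a function which is nonzero at z0 and vanishes on the image of the closed set.
*)
theory Submission
  imports Defs "HOL-Computational_Algebra.Fundamental_Theorem_Algebra"
begin

section \<open>Polynomial functions\<close>

text \<open>The six homogeneous coordinates describe a plane in 4-space; the linear equations say
  that it contains the second row of \<open>M\<close>, and the conic is the Pluecker relation. Since
  \<open>s = t = 0\<close> forces \<open>w = 0\<close>, forgetting \<open>w\<close> is defined
  everywhere on the conics.

  The second triple is the mirror image of the minors under the symmetry a <-> c, Y <-> Z, X -> -X,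
  (s : t : w) -> (t : s : -w), which preserves \<open>F\<close> and the incidence locus and
  exchanges the charts s = 1 and t = 1.

  Affine space and its product with projective space are treated at once, as spaces whose open sets
  and regular functions come from functions graded by degree. Forms become functions of points by
  evaluation at a chosen vector of each line. This is not canonical, but zero sets and quotients of
  equal degree do not depend on the choice.

  Regularity of a point refers to its exact Krull codimension, so the length of chains of
  irreducible closed sets must be bounded above. The bound comes from counting: too long a chain
  would give more independent monomials than there are points in a grid that detects polynomials of
  their degree.\<close>

lemma algebra_generated_uminus:
  assumes "f \<in> algebra_generated C"
  shows "(\<lambda>p. - f p) \<in> algebra_generated C"
  using algebra_generated.mult[OF algebra_generated.const[of "-1"] assms] by simp

lemma algebra_generated_diff:
  assumes "f \<in> algebra_generated C" "g \<in> algebra_generated C"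
  shows "(\<lambda>p. f p - g p) \<in> algebra_generated C"
  using algebra_generated.add[OF assms(1) algebra_generated_uminus[OF assms(2)]] by simp

lemma algebra_generated_power:
  assumes "f \<in> algebra_generated C"
  shows "(\<lambda>p. f p ^ n) \<in> algebra_generated C"
  by (induction n) (auto intro: algebra_generated.intros assms)

lemma algebra_generated_sum:
  assumes "\<And>i. i \<in> I \<Longrightarrow> f i \<in> algebra_generated C"
  shows "(\<lambda>p. \<Sum>i\<in>I. f i p) \<in> algebra_generated C"
  using assms by (induction I rule: infinite_finite_induct) (auto intro: algebra_generated.intros)

lemma algebra_generated_comp:
  assumes "f \<in> algebra_generated C"
    and "\<And>g. g \<in> C \<Longrightarrow> (\<lambda>x. g (\<phi> x)) \<in> algebra_generated C'"
  shows "(\<lambda>x. f (\<phi> x)) \<in> algebra_generated C'"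
  using assms by (induction f) (auto intro: algebra_generated.intros)

lemma polys_coord: "i < n \<Longrightarrow> (\<lambda>x. x $ i) \<in> polys n"
  unfolding polys_def by (auto intro: algebra_generated.gen)

lemma polys_const: "(\<lambda>_. c) \<in> polys n"
  unfolding polys_def by (rule algebra_generated.const)

lemma polys_add: "f \<in> polys n \<Longrightarrow> g \<in> polys n \<Longrightarrow> (\<lambda>x. f x + g x) \<in> polys n"
  unfolding polys_def by (rule algebra_generated.add)

lemma polys_mult: "f \<in> polys n \<Longrightarrow> g \<in> polys n \<Longrightarrow> (\<lambda>x. f x * g x) \<in> polys n"
  unfolding polys_def by (rule algebra_generated.mult)

lemma polys_diff: "f \<in> polys n \<Longrightarrow> g \<in> polys n \<Longrightarrow> (\<lambda>x. f x - g x) \<in> polys n"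
  unfolding polys_def by (rule algebra_generated_diff)

lemma polys_uminus: "f \<in> polys n \<Longrightarrow> (\<lambda>x. - f x) \<in> polys n"
  unfolding polys_def by (rule algebra_generated_uminus)

lemma polys_power: "f \<in> polys n \<Longrightarrow> (\<lambda>x. f x ^ k) \<in> polys n"
  unfolding polys_def by (rule algebra_generated_power)

lemma polys_sum: "(\<And>i. i \<in> I \<Longrightarrow> f i \<in> polys n) \<Longrightarrow> (\<lambda>x. \<Sum>i\<in>I. f i x) \<in> polys n"
  unfolding polys_def by (rule algebra_generated_sum)

lemmas polys_intros = polys_coord polys_const polys_add polys_mult polys_diff polys_uminus
  polys_power

lemma polys_comp:
  assumes "f \<in> polys m" "\<And>i. i < m \<Longrightarrow> (\<lambda>x. \<phi> x $ i) \<in> polys n"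
  shows "(\<lambda>x. f (\<phi> x)) \<in> polys n"
  using assms unfolding polys_def by (auto intro: algebra_generated_comp)

lemma polys_on_line:
  assumes "f \<in> polys n" "x \<in> carrier_vec n" "y \<in> carrier_vec n"
  shows "\<exists>p. \<forall>\<tau>. f (x + \<tau> \<cdot>\<^sub>v (y - x)) = poly p \<tau>"
  using assms(1) unfolding polys_def
proof induction
  case (const c)
  show ?case by (rule exI[of _ "[:c:]"]) simp
next
  case (gen f)
  then obtain i where i: "i < n" and f: "f = (\<lambda>x. x $ i)" by auto
  show ?case
    by (rule exI[of _ "[:x $ i, y $ i - x $ i:]"]) (use i assms(2,3) in \<open>simp add: f algebra_simps\<close>)
next
  case (add f g)
  then obtain p q where "\<forall>\<tau>. f (x + \<tau> \<cdot>\<^sub>v (y - x)) = poly p \<tau>" "\<forall>\<tau>. g (x + \<tau> \<cdot>\<^sub>v (y - x)) = poly q \<tau>"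
    by auto
  then show ?case by (intro exI[of _ "p + q"]) simp
next
  case (mult f g)
  then obtain p q where "\<forall>\<tau>. f (x + \<tau> \<cdot>\<^sub>v (y - x)) = poly p \<tau>" "\<forall>\<tau>. g (x + \<tau> \<cdot>\<^sub>v (y - x)) = poly q \<tau>"
    by auto
  then show ?case by (intro exI[of _ "p * q"]) simp
qed

text \<open>Polynomials are functions here, with no normal form to compare. The absence of zero
  divisors is reduced to one variable by restricting to the line that joins a point where
  \<open>f\<close> is nonzero to one where \<open>g\<close> is.\<close>

lemma polys_mult_eq_0:
  assumes "f \<in> polys n" "g \<in> polys n" "\<And>x. x \<in> carrier_vec n \<Longrightarrow> f x * g x = 0"
  shows "(\<forall>x\<in>carrier_vec n. f x = 0) \<or> (\<forall>x\<in>carrier_vec n. g x = 0)"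
proof (rule ccontr)
  assume "\<not> ?thesis"
  then obtain x y where xy: "x \<in> carrier_vec n" "y \<in> carrier_vec n" "f x \<noteq> 0" "g y \<noteq> 0" by auto
  obtain p q where p: "\<And>\<tau>. f (x + \<tau> \<cdot>\<^sub>v (y - x)) = poly p \<tau>" and q: "\<And>\<tau>. g (x + \<tau> \<cdot>\<^sub>v (y - x)) = poly q \<tau>"
    using polys_on_line[OF assms(1) xy(1,2)] polys_on_line[OF assms(2) xy(1,2)] by auto
  have "x + 0 \<cdot>\<^sub>v (y - x) = x" "x + 1 \<cdot>\<^sub>v (y - x) = y"
    using xy by (auto intro!: eq_vecI)
  then have "poly p 0 \<noteq> 0" "poly q 1 \<noteq> 0" using xy p[of 0] q[of 1] by auto
  moreover have "poly (p * q) \<tau> = 0" for \<tau>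
    using assms(3)[of "x + \<tau> \<cdot>\<^sub>v (y - x)"] xy by (simp add: p q)
  then have "p * q = 0" using poly_all_0_iff_0 by blast
  ultimately show False by auto
qed


section \<open>Varieties whose topology and functions come from graded functions\<close>

text \<open>Products turn intersections of nonvanishing loci into nonvanishing loci, so the
  generating family is a basis and not merely a subbasis.\<close>

lemma openin_topology_generated_by_nonvanishing:
  fixes P :: "nat \<Rightarrow> ('p \<Rightarrow> complex) set"
  assumes one: "(\<lambda>_. 1) \<in> P 0"
    and mult: "\<And>d e f g. f \<in> P d \<Longrightarrow> g \<in> P e \<Longrightarrow> (\<lambda>p. f p * g p) \<in> P (d + e)"
  shows "openin (topology_generated_by {{p \<in> C. k p \<noteq> 0} | d k. k \<in> P d}) U \<longleftrightarrow>
    U \<subseteq> C \<and> (\<forall>p\<in>U. \<exists>d. \<exists>k\<in>P d. k p \<noteq> 0 \<and> (\<forall>q\<in>C. k q \<noteq> 0 \<longrightarrow> q \<in> U))" (is "?l \<longleftrightarrow> ?r")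
proof
  assume ?l
  then have "generate_topology_on {{p \<in> C. k p \<noteq> 0} | d k. k \<in> P d} U"
    by (simp add: openin_topology_generated_by_iff)
  then show ?r
  proof induction
    case Empty
    then show ?case by simp
  next
    case (Int A B)
    show ?case
    proof (intro conjI ballI)
      show "A \<inter> B \<subseteq> C" using Int by auto
      fix p assume "p \<in> A \<inter> B"
      then obtain d e k l where "k \<in> P d" "k p \<noteq> 0" "\<forall>q\<in>C. k q \<noteq> 0 \<longrightarrow> q \<in> A"
        "l \<in> P e" "l p \<noteq> 0" "\<forall>q\<in>C. l q \<noteq> 0 \<longrightarrow> q \<in> B" using Int by blast
      then show "\<exists>d. \<exists>k\<in>P d. k p \<noteq> 0 \<and> (\<forall>q\<in>C. k q \<noteq> 0 \<longrightarrow> q \<in> A \<inter> B)"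
        by (intro exI[of _ "d + e"] bexI[of _ "\<lambda>p. k p * l p"]) (auto intro: mult)
    qed
  next
    case (UN K)
    show ?case
    proof (intro conjI subsetI ballI)
      show "p \<in> C" if "p \<in> \<Union>K" for p using UN that by auto
      fix p assume "p \<in> \<Union>K"
      then obtain A where "A \<in> K" "p \<in> A" by blast
      with UN[of A] obtain d k where "k \<in> P d" "k p \<noteq> 0" "\<forall>q\<in>C. k q \<noteq> 0 \<longrightarrow> q \<in> A" by blast
      with \<open>A \<in> K\<close> show "\<exists>d. \<exists>k\<in>P d. k p \<noteq> 0 \<and> (\<forall>q\<in>C. k q \<noteq> 0 \<longrightarrow> q \<in> \<Union>K)" by blast
    qed
  next
    case (Basis A)
    then show ?case by blast
  qed
next
  assume r: ?r
  show ?l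
    unfolding openin_subopen[of _ U]
  proof
    fix p assume "p \<in> U"
    with r obtain d k where k: "k \<in> P d" "k p \<noteq> 0" "\<forall>q\<in>C. k q \<noteq> 0 \<longrightarrow> q \<in> U" by blast
    then show "\<exists>V. openin (topology_generated_by {{p \<in> C. k p \<noteq> 0} | d k. k \<in> P d}) V \<and> p \<in> V \<and> V \<subseteq> U"
      using r \<open>p \<in> U\<close>
      by (intro exI[of _ "{p \<in> C. k p \<noteq> 0}"] conjI topology_generated_by_Basis CollectI exI[of _ d] exI[of _ k])
        auto
  qed
qed

text \<open>In the affine case every degree carries the same functions; in the projective case
  \<open>P d\<close> consists of the forms of degree \<open>d\<close>. The denominator
  \<open>k\<close> of a regular function also cuts out the neighbourhood on which the quotient is
  valid.\<close>

locale graded_variety =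
  fixes X :: "'p variety" and C :: "'p set" and P :: "nat \<Rightarrow> ('p \<Rightarrow> complex) set"
  assumes const: "(\<lambda>_. c) \<in> P 0"
    and add: "f \<in> P d \<Longrightarrow> g \<in> P d \<Longrightarrow> (\<lambda>p. f p + g p) \<in> P d"
    and mult: "f \<in> P d \<Longrightarrow> g \<in> P e \<Longrightarrow> (\<lambda>p. f p * g p) \<in> P (d + e)"
    and open_iff: "openin (zar X) U \<longleftrightarrow>
      U \<subseteq> C \<and> (\<forall>p\<in>U. \<exists>d. \<exists>k\<in>P d. k p \<noteq> 0 \<and> (\<forall>q\<in>C. k q \<noteq> 0 \<longrightarrow> q \<in> U))"
    and reg_iff: "openin (zar X) U \<Longrightarrow> f \<in> reg X U \<longleftrightarrow>
      (\<forall>p\<in>U. \<exists>d. \<exists>g\<in>P d. \<exists>k\<in>P d. k p \<noteq> 0 \<and> (\<forall>q\<in>C. k q \<noteq> 0 \<longrightarrow> q \<in> U \<and> f q = g q / k q))"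

text \<open>A quotient given on some open neighbourhood is multiplied above and below by a function
  cutting out a smaller basic neighbourhood; then the denominator itself delimits where it
  holds.\<close>

lemma graded_varietyI:
  fixes X :: "'p variety" and P :: "nat \<Rightarrow> ('p \<Rightarrow> complex) set"
  assumes const: "\<And>c. (\<lambda>_. c) \<in> P 0"
    and add: "\<And>f g d. f \<in> P d \<Longrightarrow> g \<in> P d \<Longrightarrow> (\<lambda>p. f p + g p) \<in> P d"
    and mult: "\<And>f g d e. f \<in> P d \<Longrightarrow> g \<in> P e \<Longrightarrow> (\<lambda>p. f p * g p) \<in> P (d + e)"
    and zar: "zar X = topology_generated_by {{p \<in> C. k p \<noteq> 0} | d k. k \<in> P d}"
    and reg: "\<And>U f. f \<in> reg X U \<longleftrightarrow> (\<forall>p\<in>U. \<exists>W d. \<exists>g\<in>P d. \<exists>h\<in>P d. openin (zar X) W \<and> p \<in> W \<and>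
      W \<subseteq> U \<and> (\<forall>q\<in>W. h q \<noteq> 0 \<and> f q = g q / h q))"
  shows "graded_variety X C P"
proof
  show open_iff: "openin (zar X) U \<longleftrightarrow>
      U \<subseteq> C \<and> (\<forall>p\<in>U. \<exists>d. \<exists>k\<in>P d. k p \<noteq> 0 \<and> (\<forall>q\<in>C. k q \<noteq> 0 \<longrightarrow> q \<in> U))" for U
    unfolding zar by (rule openin_topology_generated_by_nonvanishing) (auto intro: const mult)
  show "f \<in> reg X U \<longleftrightarrow> (\<forall>p\<in>U. \<exists>d. \<exists>g\<in>P d. \<exists>k\<in>P d. k p \<noteq> 0 \<and>
      (\<forall>q\<in>C. k q \<noteq> 0 \<longrightarrow> q \<in> U \<and> f q = g q / k q))" (is "?l \<longleftrightarrow> ?r")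
    if U: "openin (zar X) U" for U f
  proof
    assume ?l
    show ?r
    proof
      fix p assume "p \<in> U"
      with \<open>?l\<close> obtain W d g h where W: "g \<in> P d" "h \<in> P d" "openin (zar X) W" "p \<in> W"
        "W \<subseteq> U" "\<forall>q\<in>W. h q \<noteq> 0 \<and> f q = g q / h q" unfolding reg by blast
      then obtain e k where k: "k \<in> P e" "k p \<noteq> 0" "\<forall>q\<in>C. k q \<noteq> 0 \<longrightarrow> q \<in> W"
        unfolding open_iff by blast
      show "\<exists>d. \<exists>g\<in>P d. \<exists>k\<in>P d. k p \<noteq> 0 \<and> (\<forall>q\<in>C. k q \<noteq> 0 \<longrightarrow> q \<in> U \<and> f q = g q / k q)"
      proof (rule exI[of _ "d + e"], rule bexI[of _ "\<lambda>p. g p * k p"], rule bexI[of _ "\<lambda>p. h p * k p"])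
        show "(\<lambda>p. g p * k p) \<in> P (d + e)" "(\<lambda>p. h p * k p) \<in> P (d + e)"
          using W k by (auto intro: mult)
        show "h p * k p \<noteq> 0 \<and> (\<forall>q\<in>C. h q * k q \<noteq> 0 \<longrightarrow> q \<in> U \<and> f q = (g q * k q) / (h q * k q))"
          using W k by auto
      qed
    qed
  next
    assume r: ?r
    show ?l
      unfolding reg
    proof
      fix p assume "p \<in> U"
      with r obtain d g k where k: "g \<in> P d" "k \<in> P d" "k p \<noteq> 0"
        "\<forall>q\<in>C. k q \<noteq> 0 \<longrightarrow> q \<in> U \<and> f q = g q / k q" by blast
      then have "openin (zar X) {q \<in> C. k q \<noteq> 0}" unfolding open_iff by blast
      moreover have "p \<in> C" using \<open>p \<in> U\<close> U unfolding open_iff by blast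
      ultimately show "\<exists>W d. \<exists>g\<in>P d. \<exists>h\<in>P d. openin (zar X) W \<and> p \<in> W \<and>
          W \<subseteq> U \<and> (\<forall>q\<in>W. h q \<noteq> 0 \<and> f q = g q / h q)"
        using k by (intro exI[of _ "{q \<in> C. k q \<noteq> 0}"] exI[of _ d] bexI[of _ g] bexI[of _ k]) auto
    qed
  qed
qed (fact const add mult)+

lemma graded_variety_affine: "graded_variety (affine_space n) (carrier_vec n) (\<lambda>_. polys n)"
proof (rule graded_varietyI)
  show "zar (affine_space n) = topology_generated_by {{p \<in> carrier_vec n. k p \<noteq> 0} |d k. k \<in> polys n}"
    by (auto simp: affine_space_def zariski_affine_def)
  show "f \<in> reg (affine_space n) U \<longleftrightarrow> (\<forall>p\<in>U. \<exists>W d. \<exists>g\<in>polys n. \<exists>h\<in>polys n. openin (zar (affine_space n)) W \<and>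
      p \<in> W \<and> W \<subseteq> U \<and> (\<forall>q\<in>W. h q \<noteq> 0 \<and> f q = g q / h q))" for U f
    unfolding affine_space_def variety.simps mem_Collect_eq by (rule ball_cong[OF refl]) blast
qed (fact polys_const polys_add polys_mult)+

section \<open>Homogeneous coordinates on the product of affine and projective space\<close>

definition rep :: "nat \<Rightarrow> complex vec set \<Rightarrow> complex vec" where
  "rep r L = (SOME u. u \<in> L \<and> u \<noteq> 0\<^sub>v r)"

lemma rep_line:
  assumes "u \<in> carrier_vec r" "u \<noteq> 0\<^sub>v r"
  shows "\<exists>c. c \<noteq> 0 \<and> rep r (line u) = c \<cdot>\<^sub>v u"
proof -
  have "u \<in> line u" unfolding line_def by (auto intro: exI[of _ 1])
  then have "u \<in> line u \<and> u \<noteq> 0\<^sub>v r" using assms by blast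
  then have "rep r (line u) \<in> line u \<and> rep r (line u) \<noteq> 0\<^sub>v r"
    unfolding rep_def by (rule someI)
  then obtain c where "rep r (line u) = c \<cdot>\<^sub>v u" "c \<cdot>\<^sub>v u \<noteq> 0\<^sub>v r" by (auto simp: line_def)
  moreover have "0 \<cdot>\<^sub>v u = 0\<^sub>v r" using assms by auto
  ultimately show ?thesis by metis
qed

lemma rep_proj_space:
  assumes "L \<in> proj_space r"
  shows "rep r L \<in> carrier_vec r" "rep r L \<noteq> 0\<^sub>v r" "rep r L \<in> L" "L = line (rep r L)"
proof -
  obtain u where u: "u \<in> carrier_vec r" "u \<noteq> 0\<^sub>v r" and L: "L = line u"
    using assms by (auto simp: proj_space_def)
  obtain c where c: "c \<noteq> 0" "rep r L = c \<cdot>\<^sub>v u" using rep_line[OF u] L by auto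
  show "rep r L \<in> carrier_vec r" using c u by auto
  have "(1 / c) \<cdot>\<^sub>v rep r L = u" using c u by (auto simp: smult_smult_assoc)
  then show "rep r L \<noteq> 0\<^sub>v r" using u by auto
  show "rep r L \<in> L" using c L by (auto simp: line_def)
  have 1: "d \<cdot>\<^sub>v u = (d / c) \<cdot>\<^sub>v rep r L" and 2: "d \<cdot>\<^sub>v rep r L = (d * c) \<cdot>\<^sub>v u" for d
    using c u by (auto simp: smult_smult_assoc)
  show "L = line (rep r L)"
  proof (intro equalityI subsetI)
    fix v assume "v \<in> L"
    then obtain d where "v = d \<cdot>\<^sub>v u" unfolding L line_def by blast
    then show "v \<in> line (rep r L)" unfolding 1 line_def by blast
  next
    fix v assume "v \<in> line (rep r L)"
    then obtain d where "v = d \<cdot>\<^sub>v rep r L" unfolding line_def by blast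
    then have "v \<in> line u" unfolding 2 line_def by blast
    then show "v \<in> L" unfolding L .
  qed
qed

lemma smult_rep_if_in_line:
  assumes "L \<in> proj_space r" "u \<in> L"
  shows "\<exists>c. u = c \<cdot>\<^sub>v rep r L"
  using rep_proj_space(4)[OF assms(1)] assms(2) unfolding line_def by blast

text \<open>The value of a form at \<open>rep r L\<close> depends on the choice of representative,
  but its vanishing does not, and neither does the quotient of two forms of equal degree.\<close>

definition proj_forms :: "nat \<Rightarrow> nat \<Rightarrow> nat \<Rightarrow> (complex vec \<times> complex vec set \<Rightarrow> complex) set" where
  "proj_forms n r d = {\<lambda>(x, L). G (x, rep r L) | G. G \<in> homog_polys n r d}"

lemma homog_polys_const: "(\<lambda>_. c) \<in> homog_polys n r 0"
  by (auto simp: homog_polys_def intro: algebra_generated.intros)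

lemma homog_polys_add: "f \<in> homog_polys n r d \<Longrightarrow> g \<in> homog_polys n r d \<Longrightarrow>
    (\<lambda>p. f p + g p) \<in> homog_polys n r d"
  by (auto simp: homog_polys_def algebra_simps intro: algebra_generated.add)

lemma homog_polys_mult: "f \<in> homog_polys n r d \<Longrightarrow> g \<in> homog_polys n r e \<Longrightarrow>
    (\<lambda>p. f p * g p) \<in> homog_polys n r (d + e)"
  by (auto simp: homog_polys_def algebra_simps power_add intro: algebra_generated.mult)

lemma homog_polys_smult:
  assumes "G \<in> homog_polys n r d" "x \<in> carrier_vec n" "u \<in> carrier_vec r"
  shows "G (x, c \<cdot>\<^sub>v u) = c ^ d * G (x, u)"
  using assms by (auto simp: homog_polys_def)

lemma graded_variety_proj:
  "graded_variety (affine_proj_space n r) (carrier_vec n \<times> proj_space r) (proj_forms n r)"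
proof (rule graded_varietyI)
  show "(\<lambda>_. c) \<in> proj_forms n r 0" for c
    unfolding proj_forms_def using homog_polys_const[of c] by (auto simp: fun_eq_iff)
  show "(\<lambda>p. f p + g p) \<in> proj_forms n r d" if fg: "f \<in> proj_forms n r d" "g \<in> proj_forms n r d" for f g d
  proof -
    obtain G H where "f = (\<lambda>(x, L). G (x, rep r L))" "g = (\<lambda>(x, L). H (x, rep r L))"
      "G \<in> homog_polys n r d" "H \<in> homog_polys n r d" using fg by (auto simp: proj_forms_def)
    then show ?thesis unfolding proj_forms_def
      by (intro CollectI exI[of _ "\<lambda>p. G p + H p"]) (auto simp: fun_eq_iff intro: homog_polys_add)
  qed
  show "(\<lambda>p. f p * g p) \<in> proj_forms n r (d + e)" if fg: "f \<in> proj_forms n r d" "g \<in> proj_forms n r e" for f g d e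
  proof -
    obtain G H where "f = (\<lambda>(x, L). G (x, rep r L))" "g = (\<lambda>(x, L). H (x, rep r L))"
      "G \<in> homog_polys n r d" "H \<in> homog_polys n r e" using fg by (auto simp: proj_forms_def)
    then show ?thesis unfolding proj_forms_def
      by (intro CollectI exI[of _ "\<lambda>p. G p * H p"]) (auto simp: fun_eq_iff intro: homog_polys_mult)
  qed
  have eq: "{(x, L). x \<in> carrier_vec n \<and> L \<in> proj_space r \<and> (\<exists>u\<in>L. G (x, u) \<noteq> 0)}
      = {p \<in> carrier_vec n \<times> proj_space r. (case p of (x, L) \<Rightarrow> G (x, rep r L)) \<noteq> 0}"
    if G: "G \<in> homog_polys n r d" for G d
  proof -
    have "(\<exists>u\<in>L. G (x, u) \<noteq> 0) \<longleftrightarrow> G (x, rep r L) \<noteq> 0"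
      if x: "x \<in> carrier_vec n" and L: "L \<in> proj_space r" for x L
    proof
      assume "\<exists>u\<in>L. G (x, u) \<noteq> 0"
      then obtain u where "u \<in> L" "G (x, u) \<noteq> 0" by blast
      with smult_rep_if_in_line[OF L, of u] show "G (x, rep r L) \<noteq> 0"
        using homog_polys_smult[OF G x rep_proj_space(1)[OF L]] by auto
    qed (use rep_proj_space(3)[OF L] in blast)
    then show ?thesis by auto
  qed
  show zar: "zar (affine_proj_space n r) =
      topology_generated_by {{p \<in> carrier_vec n \<times> proj_space r. k p \<noteq> 0} |d k. k \<in> proj_forms n r d}"
    unfolding affine_proj_space_def zariski_affine_proj_def variety.simps
  proof (rule arg_cong[of _ _ topology_generated_by], intro equalityI subsetI)
    fix A assume "A \<in> {{(x, L). x \<in> carrier_vec n \<and> L \<in> proj_space r \<and> (\<exists>u\<in>L. G (x, u) \<noteq> 0)} |d G. G \<in> homog_polys n r d}"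
    then obtain d G where G: "G \<in> homog_polys n r d" "A = {(x, L). x \<in> carrier_vec n \<and> L \<in> proj_space r \<and> (\<exists>u\<in>L. G (x, u) \<noteq> 0)}"
      by blast
    then show "A \<in> {{p \<in> carrier_vec n \<times> proj_space r. k p \<noteq> 0} |d k. k \<in> proj_forms n r d}"
      unfolding G(2) eq[OF G(1)] proj_forms_def by blast
  next
    fix A assume "A \<in> {{p \<in> carrier_vec n \<times> proj_space r. k p \<noteq> 0} |d k. k \<in> proj_forms n r d}"
    then obtain d G where G: "G \<in> homog_polys n r d"
      "A = {p \<in> carrier_vec n \<times> proj_space r. (case p of (x, L) \<Rightarrow> G (x, rep r L)) \<noteq> 0}"
      unfolding proj_forms_def by blast
    then show "A \<in> {{(x, L). x \<in> carrier_vec n \<and> L \<in> proj_space r \<and> (\<exists>u\<in>L. G (x, u) \<noteq> 0)} |d G. G \<in> homog_polys n r d}"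
      unfolding G(2) eq[OF G(1), symmetric] using G(1) by blast
  qed
  have top: "W \<subseteq> carrier_vec n \<times> proj_space r" if "openin (zar (affine_proj_space n r)) W" for W
    using openin_subset[OF that] unfolding zar by auto
  \<comment> \<open>Passing from \<open>rep r L\<close> to another nonzero vector of
    \<open>L\<close> multiplies both forms by the same \<open>c ^ d\<close>.\<close>
  have quot: "(\<forall>u\<in>L - {0\<^sub>v r}. H (x, u) \<noteq> 0 \<and> a = G (x, u) / H (x, u)) \<longleftrightarrow>
      H (x, rep r L) \<noteq> 0 \<and> a = G (x, rep r L) / H (x, rep r L)"
    if GH: "G \<in> homog_polys n r d" "H \<in> homog_polys n r d" and x: "x \<in> carrier_vec n" and L: "L \<in> proj_space r"
    for G H d x L a
  proof
    assume "\<forall>u\<in>L - {0\<^sub>v r}. H (x, u) \<noteq> 0 \<and> a = G (x, u) / H (x, u)"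
    then show "H (x, rep r L) \<noteq> 0 \<and> a = G (x, rep r L) / H (x, rep r L)"
      using rep_proj_space(2,3)[OF L] by auto
  next
    assume a: "H (x, rep r L) \<noteq> 0 \<and> a = G (x, rep r L) / H (x, rep r L)"
    show "\<forall>u\<in>L - {0\<^sub>v r}. H (x, u) \<noteq> 0 \<and> a = G (x, u) / H (x, u)"
    proof
      fix u assume "u \<in> L - {0\<^sub>v r}"
      then obtain c where c: "u = c \<cdot>\<^sub>v rep r L" using smult_rep_if_in_line[OF L, of u] by auto
      then have "c \<noteq> 0" using \<open>u \<in> L - {0\<^sub>v r}\<close> rep_proj_space(1)[OF L] by auto
      then show "H (x, u) \<noteq> 0 \<and> a = G (x, u) / H (x, u)"
        using a homog_polys_smult[OF GH(1) x rep_proj_space(1)[OF L], of c]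
          homog_polys_smult[OF GH(2) x rep_proj_space(1)[OF L], of c] by (auto simp: c)
    qed
  qed
  show "f \<in> reg (affine_proj_space n r) U \<longleftrightarrow> (\<forall>p\<in>U. \<exists>W d. \<exists>g\<in>proj_forms n r d. \<exists>h\<in>proj_forms n r d.
      openin (zar (affine_proj_space n r)) W \<and> p \<in> W \<and> W \<subseteq> U \<and> (\<forall>q\<in>W. h q \<noteq> 0 \<and> f q = g q / h q))" for U f
  proof -
    have "(\<exists>W d G H. openin (zariski_affine_proj n r) W \<and> p \<in> W \<and> W \<subseteq> U \<and>
        G \<in> homog_polys n r d \<and> H \<in> homog_polys n r d \<and>
        (\<forall>(x, L)\<in>W. \<forall>u\<in>L - {0\<^sub>v r}. H (x, u) \<noteq> 0 \<and> f (x, L) = G (x, u) / H (x, u))) \<longleftrightarrow>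
      (\<exists>W d. \<exists>g\<in>proj_forms n r d. \<exists>h\<in>proj_forms n r d.
      openin (zar (affine_proj_space n r)) W \<and> p \<in> W \<and> W \<subseteq> U \<and> (\<forall>q\<in>W. h q \<noteq> 0 \<and> f q = g q / h q))"
      (is "?l \<longleftrightarrow> ?r") for p
    proof -
      have z: "zar (affine_proj_space n r) = zariski_affine_proj n r" by (simp add: affine_proj_space_def)
      have eq: "(\<forall>(x, L)\<in>W. \<forall>u\<in>L - {0\<^sub>v r}. H (x, u) \<noteq> 0 \<and> f (x, L) = G (x, u) / H (x, u)) \<longleftrightarrow>
          (\<forall>q\<in>W. (case q of (x, L) \<Rightarrow> H (x, rep r L)) \<noteq> 0 \<and>
            f q = (case q of (x, L) \<Rightarrow> G (x, rep r L)) / (case q of (x, L) \<Rightarrow> H (x, rep r L)))"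
        if "G \<in> homog_polys n r d" "H \<in> homog_polys n r d" "openin (zariski_affine_proj n r) W" for W d G H
        using quot[OF that(1,2)] top[of W] that(3) unfolding z by (fastforce simp: split_beta)
      show ?thesis
      proof
        assume ?l
        then obtain W d G H where W: "openin (zariski_affine_proj n r) W" "p \<in> W" "W \<subseteq> U"
          and GH: "G \<in> homog_polys n r d" "H \<in> homog_polys n r d"
          and "\<forall>(x, L)\<in>W. \<forall>u\<in>L - {0\<^sub>v r}. H (x, u) \<noteq> 0 \<and> f (x, L) = G (x, u) / H (x, u)" by blast
        then show ?r
          unfolding z eq[OF GH W(1)]
          by (intro exI[of _ W] exI[of _ d] bexI[of _ "\<lambda>(x, L). G (x, rep r L)"]
            bexI[of _ "\<lambda>(x, L). H (x, rep r L)"] conjI) (auto simp: proj_forms_def)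
      next
        assume ?r
        then obtain W d g h where W: "openin (zariski_affine_proj n r) W" "p \<in> W" "W \<subseteq> U"
          and gh: "g \<in> proj_forms n r d" "h \<in> proj_forms n r d" "\<forall>q\<in>W. h q \<noteq> 0 \<and> f q = g q / h q"
          unfolding z by blast
        obtain G H where GH: "G \<in> homog_polys n r d" "H \<in> homog_polys n r d"
          and *: "g = (\<lambda>(x, L). G (x, rep r L))" "h = (\<lambda>(x, L). H (x, rep r L))"
          using gh(1,2) unfolding proj_forms_def by blast
        show ?l
          using gh(3) W GH unfolding * eq[OF GH W(1), symmetric] by blast
      qed
    qed
    then show ?thesis by (simp add: affine_proj_space_def)
  qed
qed


text \<open>No new functions are needed on \<open>S\<close>: a regular function is locally the
  restriction of an ambient one, hence a quotient of the same graded functions.\<close>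

lemma graded_variety_subvariety:
  assumes "graded_variety X C P" "S \<subseteq> C"
  shows "graded_variety (subvariety X S) S P"
proof -
  interpret graded_variety X C P by fact
  have basic: "openin (zar X) {q \<in> C. k q \<noteq> 0}" if "k \<in> P d" for k d
    unfolding open_iff using that by blast
  have open_sub: "openin (zar (subvariety X S)) U \<longleftrightarrow>
      U \<subseteq> S \<and> (\<forall>p\<in>U. \<exists>d. \<exists>k\<in>P d. k p \<noteq> 0 \<and> (\<forall>q\<in>S. k q \<noteq> 0 \<longrightarrow> q \<in> U))" (is "?l \<longleftrightarrow> ?r") for U
  proof
    assume ?l
    then obtain T where T: "openin (zar X) T" "U = T \<inter> S"
      by (auto simp: subvariety_def openin_subtopology)
    show ?r
    proof (intro conjI ballI)
      show "U \<subseteq> S" using T by blast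
      fix p assume "p \<in> U"
      then obtain d k where "k \<in> P d" "k p \<noteq> 0" "\<forall>q\<in>C. k q \<noteq> 0 \<longrightarrow> q \<in> T"
        using T unfolding open_iff by blast
      then show "\<exists>d. \<exists>k\<in>P d. k p \<noteq> 0 \<and> (\<forall>q\<in>S. k q \<noteq> 0 \<longrightarrow> q \<in> U)" using T assms(2) by blast
    qed
  next
    assume r: ?r
    \<comment> \<open>The largest union of ambient basic open sets whose trace on \<open>S\<close>
      stays inside \<open>U\<close>.\<close>
    define T where "T = \<Union>{{q \<in> C. k q \<noteq> 0} | d k. k \<in> P d \<and> (\<forall>q\<in>S. k q \<noteq> 0 \<longrightarrow> q \<in> U)}"
    have "openin (zar X) T" unfolding T_def using basic by (intro openin_Union) blast
    moreover have "U = T \<inter> S"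
    proof (intro equalityI subsetI)
      fix p assume p: "p \<in> U"
      then obtain d k where "k \<in> P d" "k p \<noteq> 0" "\<forall>q\<in>S. k q \<noteq> 0 \<longrightarrow> q \<in> U" using r by blast
      then show "p \<in> T \<inter> S" unfolding T_def using p r assms(2) by blast
    qed (auto simp: T_def)
    ultimately show ?l by (auto simp: subvariety_def openin_subtopology)
  qed
  show ?thesis
  proof
    show "openin (zar (subvariety X S)) U \<longleftrightarrow>
      U \<subseteq> S \<and> (\<forall>p\<in>U. \<exists>d. \<exists>k\<in>P d. k p \<noteq> 0 \<and> (\<forall>q\<in>S. k q \<noteq> 0 \<longrightarrow> q \<in> U))" for U by (rule open_sub)
    show "f \<in> reg (subvariety X S) U \<longleftrightarrow> (\<forall>p\<in>U. \<exists>d. \<exists>g\<in>P d. \<exists>k\<in>P d. k p \<noteq> 0 \<and>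
        (\<forall>q\<in>S. k q \<noteq> 0 \<longrightarrow> q \<in> U \<and> f q = g q / k q))" (is "?l \<longleftrightarrow> ?r")
      if U: "openin (zar (subvariety X S)) U" for U f
    proof
      assume l: ?l
      show ?r
      proof
        fix p assume p: "p \<in> U"
        with l obtain W g where W: "openin (zar X) W" "p \<in> W" "g \<in> reg X W" "\<forall>q\<in>W \<inter> U. f q = g q"
          unfolding subvariety_def by auto
        obtain d a k where a: "a \<in> P d" "k \<in> P d" "k p \<noteq> 0"
          "\<forall>q\<in>C. k q \<noteq> 0 \<longrightarrow> q \<in> W \<and> g q = a q / k q"
          using W reg_iff[OF W(1), of g] by blast
        obtain e l where l: "l \<in> P e" "l p \<noteq> 0" "\<forall>q\<in>S. l q \<noteq> 0 \<longrightarrow> q \<in> U"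
          using U p unfolding open_sub by blast
        show "\<exists>d. \<exists>g\<in>P d. \<exists>k\<in>P d. k p \<noteq> 0 \<and> (\<forall>q\<in>S. k q \<noteq> 0 \<longrightarrow> q \<in> U \<and> f q = g q / k q)"
        proof (rule exI[of _ "d + e"], rule bexI[of _ "\<lambda>p. a p * l p"], rule bexI[of _ "\<lambda>p. k p * l p"])
          show "k p * l p \<noteq> 0 \<and> (\<forall>q\<in>S. k q * l q \<noteq> 0 \<longrightarrow> q \<in> U \<and> f q = a q * l q / (k q * l q))"
            using a l W assms(2) by auto
        qed (use a l in \<open>auto intro: mult\<close>)
      qed
    next
      assume r: ?r
      have "\<exists>W g. openin (zar X) W \<and> p \<in> W \<and> g \<in> reg X W \<and> (\<forall>q\<in>W \<inter> U. f q = g q)" if p: "p \<in> U" for p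
      proof -
        obtain d g k where k: "g \<in> P d" "k \<in> P d" "k p \<noteq> 0" "\<forall>q\<in>S. k q \<noteq> 0 \<longrightarrow> q \<in> U \<and> f q = g q / k q"
          using r p by blast
        have "(\<lambda>q. g q / k q) \<in> reg X {q \<in> C. k q \<noteq> 0}"
          unfolding reg_iff[OF basic[OF k(2)]]
          by (rule ballI, rule exI[of _ d], rule bexI[of _ g], rule bexI[of _ k]) (use k in auto)
        moreover have "U \<subseteq> S" using U unfolding open_sub by blast
        ultimately show ?thesis
          using basic[OF k(2)] k p assms(2)
          by (intro exI[of _ "{q \<in> C. k q \<noteq> 0}"] exI[of _ "\<lambda>q. g q / k q"]) auto
      qed
      then show ?l unfolding subvariety_def by auto
    qed
  qed (fact const add mult)+
qed

section \<open>Closed sets, irreducibility and polynomial parametrizations\<close>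

context graded_variety
begin

lemma points: "points X = C"
proof
  show "points X \<subseteq> C" using openin_topspace[of "zar X"] unfolding open_iff by blast
  have "\<exists>d. \<exists>k\<in>P d. k p \<noteq> 0 \<and> (\<forall>q\<in>C. k q \<noteq> 0 \<longrightarrow> q \<in> C)" for p
    by (rule exI[of _ 0], rule bexI[OF _ const[of 1]]) simp
  then have "openin (zar X) C" unfolding open_iff by simp
  then show "C \<subseteq> points X" by (rule openin_subset)
qed

lemma smult: "f \<in> P d \<Longrightarrow> (\<lambda>p. c * f p) \<in> P d"
  using mult[OF const[of c], of f d] by simp

lemma diff: "f \<in> P d \<Longrightarrow> g \<in> P d \<Longrightarrow> (\<lambda>p. f p - g p) \<in> P d"
  using add[of f d "\<lambda>p. (-1) * g p"] smult[of g d "-1"] by simp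

lemma power: "f \<in> P d \<Longrightarrow> (\<lambda>p. f p ^ n) \<in> P (n * d)"
proof (induction n)
  case 0
  then show ?case using const[of 1] by simp
next
  case (Suc n)
  then show ?case using mult[of f d "\<lambda>p. f p ^ n" "n * d"] by simp
qed

lemma openin_nonvanishing: "k \<in> P d \<Longrightarrow> openin (zar X) {q \<in> C. k q \<noteq> 0}"
  unfolding open_iff by blast

lemma quotient_reg:
  assumes "openin (zar X) U" "g \<in> P d" "k \<in> P d" "\<And>q. q \<in> U \<Longrightarrow> k q \<noteq> 0 \<and> f q = g q / k q"
  shows "f \<in> reg X U"
  unfolding reg_iff[OF assms(1)]
proof
  fix p assume p: "p \<in> U"
  with assms(1) obtain e l where l: "l \<in> P e" "l p \<noteq> 0" "\<forall>q\<in>C. l q \<noteq> 0 \<longrightarrow> q \<in> U"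
    unfolding open_iff by blast
  show "\<exists>d. \<exists>g\<in>P d. \<exists>k\<in>P d. k p \<noteq> 0 \<and> (\<forall>q\<in>C. k q \<noteq> 0 \<longrightarrow> q \<in> U \<and> f q = g q / k q)"
  proof (rule exI[of _ "d + e"], rule bexI[of _ "\<lambda>p. g p * l p"], rule bexI[of _ "\<lambda>p. k p * l p"])
    show "k p * l p \<noteq> 0 \<and> (\<forall>q\<in>C. k q * l q \<noteq> 0 \<longrightarrow> q \<in> U \<and> f q = g q * l q / (k q * l q))"
      using l assms(4) p by auto
  qed (use l assms(2,3) in \<open>auto intro: mult\<close>)
qed

lemma closedin_iff:
  "closedin (zar X) W \<longleftrightarrow> W \<subseteq> C \<and> (\<forall>p\<in>C - W. \<exists>d. \<exists>k\<in>P d. k p \<noteq> 0 \<and> (\<forall>q\<in>W. k q = 0))"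
proof (cases "W \<subseteq> C")
  case True
  then have "(\<forall>q\<in>C. k q \<noteq> 0 \<longrightarrow> q \<in> C - W) \<longleftrightarrow> (\<forall>q\<in>W. k q = 0)" for k :: "'p \<Rightarrow> complex" by blast
  then show ?thesis using True by (simp only: closedin_def points open_iff) auto
qed (simp add: closedin_def points)

lemma closedin_zeros:
  assumes "k \<in> P d"
  shows "closedin (zar X) {p \<in> C. k p = 0}"
  unfolding closedin_iff using assms by blast

lemma closure_of_iff:
  assumes "S \<subseteq> C"
  shows "p \<in> zar X closure_of S \<longleftrightarrow> p \<in> C \<and> (\<forall>d. \<forall>k\<in>P d. (\<forall>q\<in>S. k q = 0) \<longrightarrow> k p = 0)"
proof
  assume p: "p \<in> zar X closure_of S"
  have "k p = 0" if "k \<in> P d" "\<forall>q\<in>S. k q = 0" for d k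
    using closure_of_minimal[OF _ closedin_zeros[OF that(1)], of S] that(2) assms p by blast
  moreover have "p \<in> C" using p closure_of_subset_topspace[of "zar X" S] points by blast
  ultimately show "p \<in> C \<and> (\<forall>d. \<forall>k\<in>P d. (\<forall>q\<in>S. k q = 0) \<longrightarrow> k p = 0)" by blast
next
  assume r: "p \<in> C \<and> (\<forall>d. \<forall>k\<in>P d. (\<forall>q\<in>S. k q = 0) \<longrightarrow> k p = 0)"
  show "p \<in> zar X closure_of S"
  proof (rule ccontr)
    assume "p \<notin> zar X closure_of S"
    then obtain d k where "k \<in> P d" "k p \<noteq> 0" "\<forall>q\<in>zar X closure_of S. k q = 0"
      using closedin_closure_of[of "zar X" S] r unfolding closedin_iff by blast
    then show False using r closure_of_subset[of S "zar X"] assms points by blast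
  qed
qed

text \<open>Primeness of the homogeneous ideal of \<open>S\<close>. Unlike
  \<open>irreducible_closed\<close> it makes sense for sets that are not closed, such as the image
  of a chart, and it passes to the closure.\<close>

definition irreducible_set :: "'p set \<Rightarrow> bool" where
  "irreducible_set S \<longleftrightarrow> S \<noteq> {} \<and> S \<subseteq> C \<and> (\<forall>d e. \<forall>f\<in>P d. \<forall>g\<in>P e.
    (\<forall>q\<in>S. f q * g q = 0) \<longrightarrow> (\<forall>q\<in>S. f q = 0) \<or> (\<forall>q\<in>S. g q = 0))"

lemma irreducible_closed_closure:
  assumes "irreducible_set S"
  shows "irreducible_closed (zar X) (zar X closure_of S)"
  unfolding irreducible_closed_def
proof (intro conjI allI impI)
  have S: "S \<subseteq> C" "S \<noteq> {}" using assms by (auto simp: irreducible_set_def)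
  have sub: "S \<subseteq> zar X closure_of S" using S by (intro closure_of_subset) (auto simp: points)
  then show "zar X closure_of S \<noteq> {}" using S by blast
  fix A B assume AB: "closedin (zar X) A \<and> closedin (zar X) B \<and> zar X closure_of S \<subseteq> A \<union> B"
  show "zar X closure_of S \<subseteq> A \<or> zar X closure_of S \<subseteq> B"
  proof (rule ccontr)
    assume "\<not> ?thesis"
    then have "\<not> S \<subseteq> A" "\<not> S \<subseteq> B" using AB closure_of_minimal by blast+
    then obtain p q where p: "p \<in> S" "p \<notin> A" and q: "q \<in> S" "q \<notin> B" by blast
    obtain d f where f: "f \<in> P d" "f p \<noteq> 0" "\<forall>q\<in>A. f q = 0" using AB p S unfolding closedin_iff by blast
    obtain e g where g: "g \<in> P e" "g q \<noteq> 0" "\<forall>q\<in>B. g q = 0" using AB q S unfolding closedin_iff by blast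
    have "\<forall>q\<in>S. f q * g q = 0" using AB sub f g by (metis Un_iff mult_eq_0_iff subsetD)
    then have "(\<forall>q\<in>S. f q = 0) \<or> (\<forall>q\<in>S. g q = 0)"
      using assms f(1) g(1) unfolding irreducible_set_def by blast
    then show False using f(2) g(2) p q by blast
  qed
qed simp

lemma irreducible_closed_imp_irreducible_set:
  assumes "irreducible_closed (zar X) W"
  shows "irreducible_set W"
  unfolding irreducible_set_def
proof (intro conjI allI ballI impI)
  show "W \<noteq> {}" "W \<subseteq> C" using assms by (auto simp: irreducible_closed_def closedin_iff)
  fix d e f g assume fg: "f \<in> P d" "g \<in> P e" and 0: "\<forall>q\<in>W. f q * g q = 0"
  have "W \<subseteq> {q \<in> C. f q = 0} \<union> {q \<in> C. g q = 0}" using 0 \<open>W \<subseteq> C\<close> by auto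
  then show "(\<forall>q\<in>W. f q = 0) \<or> (\<forall>q\<in>W. g q = 0)"
    using assms closedin_zeros[OF fg(1)] closedin_zeros[OF fg(2)] unfolding irreducible_closed_def by blast
qed

text \<open>The factor \<open>c x\<close> accounts for the choice of homogeneous coordinates of \<open>\<phi> x\<close>.\<close>

definition parametrization :: "nat \<Rightarrow> (complex vec \<Rightarrow> 'p) \<Rightarrow> bool" where
  "parametrization m \<phi> \<longleftrightarrow> (\<forall>x\<in>carrier_vec m. \<phi> x \<in> C) \<and> (\<exists>c. (\<forall>x. c x \<noteq> 0) \<and>
    (\<forall>d. \<forall>g\<in>P d. \<exists>f\<in>polys m. \<forall>x\<in>carrier_vec m. c x ^ d * g (\<phi> x) = f x))"

lemma parametrization_comp:
  assumes "parametrization m \<phi>" "\<And>x. x \<in> carrier_vec n \<Longrightarrow> \<psi> x \<in> carrier_vec m"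
    and "\<And>i. i < m \<Longrightarrow> (\<lambda>x. \<psi> x $ i) \<in> polys n"
  shows "parametrization n (\<lambda>x. \<phi> (\<psi> x))"
proof -
  obtain c where c: "\<forall>x. c x \<noteq> 0"
    "\<forall>d. \<forall>g\<in>P d. \<exists>f\<in>polys m. \<forall>x\<in>carrier_vec m. c x ^ d * g (\<phi> x) = f x"
    using assms(1) unfolding parametrization_def by blast
  show ?thesis
    unfolding parametrization_def
  proof (intro conjI ballI exI[of _ "\<lambda>x. c (\<psi> x)"] allI)
    show "\<phi> (\<psi> x) \<in> C" if "x \<in> carrier_vec n" for x
      using assms(1) assms(2)[OF that] unfolding parametrization_def by blast
    fix d g assume "g \<in> P d"
    with c obtain f where f: "f \<in> polys m" "\<forall>x\<in>carrier_vec m. c x ^ d * g (\<phi> x) = f x" by blast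
    then show "\<exists>f\<in>polys n. \<forall>x\<in>carrier_vec n. c (\<psi> x) ^ d * g (\<phi> (\<psi> x)) = f x"
      using polys_comp[OF f(1), of \<psi> n] assms(2,3) by (intro bexI[of _ "\<lambda>x. f (\<psi> x)"]) auto
  qed (use c in blast)
qed

text \<open>Forms pull back to polynomials up to a nonvanishing factor, and polynomials have no zero
  divisors.\<close>

lemma irreducible_set_image:
  assumes "parametrization m \<phi>"
  shows "irreducible_set (\<phi> ` carrier_vec m)"
  unfolding irreducible_set_def
proof (intro conjI allI ballI impI)
  show "\<phi> ` carrier_vec m \<noteq> {}" using zero_carrier_vec[of m] by blast
  show "\<phi> ` carrier_vec m \<subseteq> C" using assms unfolding parametrization_def by blast
  obtain c where c: "\<forall>x. c x \<noteq> 0"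
    "\<forall>d. \<forall>g\<in>P d. \<exists>f\<in>polys m. \<forall>x\<in>carrier_vec m. c x ^ d * g (\<phi> x) = f x"
    using assms(1) unfolding parametrization_def by blast
  fix d e f g assume fg: "f \<in> P d" "g \<in> P e" and 0: "\<forall>q\<in>\<phi> ` carrier_vec m. f q * g q = 0"
  obtain f' g' where f': "f' \<in> polys m" "\<forall>x\<in>carrier_vec m. c x ^ d * f (\<phi> x) = f' x"
    and g': "g' \<in> polys m" "\<forall>x\<in>carrier_vec m. c x ^ e * g (\<phi> x) = g' x" using c fg by meson
  have "f' x * g' x = 0" if "x \<in> carrier_vec m" for x
    using 0 that f'(2) g'(2) by (metis (no_types, lifting) image_eqI mult_eq_0_iff)
  from polys_mult_eq_0[OF f'(1) g'(1) this]
  show "(\<forall>q\<in>\<phi> ` carrier_vec m. f q = 0) \<or> (\<forall>q\<in>\<phi> ` carrier_vec m. g q = 0)"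
    using f'(2) g'(2) c(1) by (metis (no_types, lifting) imageE mult_eq_0_iff power_not_zero)
qed

end

text \<open>The factor \<open>c d\<close> may be as irregular as a choice of representatives: it
  does not change zero sets and cancels in quotients. \<open>D\<close> records the degree of the
  pullback, which is 0 for functions coming from the affine base.\<close>

lemma morphism_gradedI:
  assumes "graded_variety X C P" "graded_variety Y C' P'"
    and f: "\<And>q. q \<in> C \<Longrightarrow> f q \<in> C'"
    and c: "\<And>d q. q \<in> C \<Longrightarrow> c d q \<noteq> 0"
    and pullback: "\<And>d g. g \<in> P' d \<Longrightarrow> \<exists>h\<in>P (D d). \<forall>q\<in>C. c d q * g (f q) = h q"
  shows "morphism X Y f"
proof -
  interpret X: graded_variety X C P by fact
  interpret Y: graded_variety Y C' P' by fact
  have op: "openin (zar X) {q \<in> C. f q \<in> U}" if U: "openin (zar Y) U" for U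
    unfolding X.open_iff
  proof (intro conjI ballI)
    fix p assume p: "p \<in> {q \<in> C. f q \<in> U}"
    then obtain d k where k: "k \<in> P' d" "k (f p) \<noteq> 0" "\<forall>q\<in>C'. k q \<noteq> 0 \<longrightarrow> q \<in> U"
      using U unfolding Y.open_iff by blast
    from pullback[OF k(1)] obtain h where h: "h \<in> P (D d)" "\<forall>q\<in>C. c d q * k (f q) = h q" by blast
    have "h p \<noteq> 0" using h(2) k(2) p c[of p d] by (metis (no_types, lifting) mem_Collect_eq mult_eq_0_iff)
    moreover have "q \<in> {q \<in> C. f q \<in> U}" if "q \<in> C" "h q \<noteq> 0" for q
      using that h(2) k(3) f[OF that(1)] by (metis (no_types, lifting) mem_Collect_eq mult_eq_0_iff)
    ultimately show "\<exists>d. \<exists>k\<in>P d. k p \<noteq> 0 \<and> (\<forall>q\<in>C. k q \<noteq> 0 \<longrightarrow> q \<in> {q \<in> C. f q \<in> U})"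
      using h(1) by blast
  qed auto
  show ?thesis
    unfolding morphism_def X.points
  proof (intro conjI allI impI)
    show "continuous_map (zar X) (zar Y) f"
      unfolding continuous_map X.points Y.points using f op by blast
    fix U g assume "openin (zar Y) U \<and> g \<in> reg Y U"
    then have U: "openin (zar Y) U" "g \<in> reg Y U" by auto
    show "g \<circ> f \<in> reg X {x \<in> C. f x \<in> U}"
      unfolding X.reg_iff[OF op[OF U(1)]]
    proof
      fix p assume p: "p \<in> {x \<in> C. f x \<in> U}"
      then obtain d a k where k: "a \<in> P' d" "k \<in> P' d" "k (f p) \<noteq> 0"
        "\<forall>q\<in>C'. k q \<noteq> 0 \<longrightarrow> q \<in> U \<and> g q = a q / k q"
        using U(2) unfolding Y.reg_iff[OF U(1)] by blast
      obtain h where h: "h \<in> P (D d)" "\<forall>q\<in>C. c d q * k (f q) = h q" using pullback[OF k(2)] by blast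
      obtain b where b: "b \<in> P (D d)" "\<forall>q\<in>C. c d q * a (f q) = b q" using pullback[OF k(1)] by blast
      have "h p \<noteq> 0" using h(2) k(3) p c[of p d] by (metis (no_types, lifting) mem_Collect_eq mult_eq_0_iff)
      moreover have "q \<in> {x \<in> C. f x \<in> U} \<and> (g \<circ> f) q = b q / h q" if q: "q \<in> C" "h q \<noteq> 0" for q
      proof -
        have "h q = c d q * k (f q)" "b q = c d q * a (f q)" using h b q by auto
        then show ?thesis using k(4) f[OF q(1)] c[OF q(1), of d] q by auto
      qed
      ultimately show "\<exists>d. \<exists>ga\<in>P d. \<exists>k\<in>P d. k p \<noteq> 0 \<and>
          (\<forall>q\<in>C. k q \<noteq> 0 \<longrightarrow> q \<in> {x \<in> C. f x \<in> U} \<and> (g \<circ> f) q = ga q / k q)"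
        using h(1) b(1) by (intro exI[of _ "D d"] bexI[of _ b] bexI[of _ h]) auto
    qed
  qed
qed


section \<open>Chains of irreducible sets in affine space\<close>

text \<open>One equation is solved for the unknown at a nonzero pivot \<open>i0\<close> and
  substituted into the others, which still have more unknowns than equations.\<close>

lemma homogeneous_system:
  fixes A :: "'i \<Rightarrow> 'j \<Rightarrow> complex"
  assumes "finite J" "finite I" "card J < card I"
  shows "\<exists>c. (\<exists>i\<in>I. c i \<noteq> 0) \<and> (\<forall>j\<in>J. (\<Sum>i\<in>I. c i * A i j) = 0)"
  using assms
proof (induction J arbitrary: I A rule: finite_induct)
  case empty
  then have "I \<noteq> {}" by auto
  then show ?case by (intro exI[of _ "\<lambda>_. 1"]) auto
next
  case (insert j J)
  show ?case
  proof (cases "\<forall>i\<in>I. A i j = 0")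
    case True
    then show ?thesis using insert.IH[of I A] insert by auto
  next
    case False
    then obtain i0 where i0: "i0 \<in> I" "A i0 j \<noteq> 0" by blast
    define I' where "I' = I - {i0}"
    have I': "finite I'" "i0 \<notin> I'" "I = insert i0 I'" "card J < card I'"
      using insert i0 by (auto simp: I'_def)
    obtain c where c: "\<exists>i\<in>I'. c i \<noteq> 0"
      "\<forall>j'\<in>J. (\<Sum>i\<in>I'. c i * (A i j' - A i j / A i0 j * A i0 j')) = 0"
      using insert.IH[OF I'(1,4), of "\<lambda>i j'. A i j' - A i j / A i0 j * A i0 j'"] by blast
    define c' where "c' = c(i0 := - (\<Sum>i\<in>I'. c i * (A i j / A i0 j)))"
    have c': "(\<Sum>i\<in>I. c' i * A i j') = (\<Sum>i\<in>I'. c i * (A i j' - A i j / A i0 j * A i0 j'))" for j'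
    proof -
      have "(\<Sum>i\<in>I. c' i * A i j') = c' i0 * A i0 j' + (\<Sum>i\<in>I'. c i * A i j')"
        unfolding I'(3) sum.insert[OF I'(1,2)] c'_def using I'(2)
        by (intro arg_cong2[where f = plus] sum.cong) auto
      also have "\<dots> = (\<Sum>i\<in>I'. c i * (A i j' - A i j / A i0 j * A i0 j'))"
        by (simp add: c'_def algebra_simps sum_subtractf sum_distrib_left)
      finally show ?thesis .
    qed
    have "\<exists>i\<in>I. c' i \<noteq> 0" using c(1) I' by (auto simp: c'_def)
    moreover have "(\<Sum>i\<in>I. c' i * A i j') = 0" if "j' \<in> insert j J" for j'
      using that c(2) i0(2) unfolding c' by auto
    ultimately show ?thesis by blast
  qed
qed

text \<open>Degree in each variable separately, read off from a univariate polynomial after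
  substituting for one entry; this form suits vanishing on a grid.\<close>

definition coord_degree_le :: "nat \<Rightarrow> nat \<Rightarrow> (complex vec \<Rightarrow> complex) \<Rightarrow> bool" where
  "coord_degree_le m D f \<longleftrightarrow> (\<forall>x\<in>carrier_vec m. \<forall>i<m. \<exists>p. degree p \<le> D \<and>
    (\<forall>\<tau>. f (vec m (\<lambda>j. if j = i then \<tau> else x $ j)) = poly p \<tau>))"

lemma coord_degree_le_mono: "coord_degree_le m D f \<Longrightarrow> D \<le> E \<Longrightarrow> coord_degree_le m E f"
  unfolding coord_degree_le_def by (meson le_trans)

lemma coord_degree_le_const: "coord_degree_le m D (\<lambda>_. c)"
  unfolding coord_degree_le_def by (auto intro!: exI[of _ "[:c:]"])

lemma coord_degree_le_add:
  assumes "coord_degree_le m D f" "coord_degree_le m D g"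
  shows "coord_degree_le m D (\<lambda>x. f x + g x)"
  unfolding coord_degree_le_def
proof (intro ballI allI impI)
  fix x :: "complex vec" and i assume "x \<in> carrier_vec m" "i < m"
  then obtain p q where "degree p \<le> D" "\<forall>\<tau>. f (vec m (\<lambda>j. if j = i then \<tau> else x $ j)) = poly p \<tau>"
    "degree q \<le> D" "\<forall>\<tau>. g (vec m (\<lambda>j. if j = i then \<tau> else x $ j)) = poly q \<tau>"
    using assms unfolding coord_degree_le_def by meson
  then show "\<exists>p. degree p \<le> D \<and> (\<forall>\<tau>. f (vec m (\<lambda>j. if j = i then \<tau> else x $ j)) +
      g (vec m (\<lambda>j. if j = i then \<tau> else x $ j)) = poly p \<tau>)"
    by (intro exI[of _ "p + q"]) (auto intro: degree_add_le)
qed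

lemma coord_degree_le_mult:
  assumes "coord_degree_le m D f" "coord_degree_le m E g"
  shows "coord_degree_le m (D + E) (\<lambda>x. f x * g x)"
  unfolding coord_degree_le_def
proof (intro ballI allI impI)
  fix x :: "complex vec" and i assume "x \<in> carrier_vec m" "i < m"
  then obtain p q where "degree p \<le> D" "\<forall>\<tau>. f (vec m (\<lambda>j. if j = i then \<tau> else x $ j)) = poly p \<tau>"
    "degree q \<le> E" "\<forall>\<tau>. g (vec m (\<lambda>j. if j = i then \<tau> else x $ j)) = poly q \<tau>"
    using assms unfolding coord_degree_le_def by meson
  then show "\<exists>p. degree p \<le> D + E \<and> (\<forall>\<tau>. f (vec m (\<lambda>j. if j = i then \<tau> else x $ j)) *
      g (vec m (\<lambda>j. if j = i then \<tau> else x $ j)) = poly p \<tau>)"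
    by (intro exI[of _ "p * q"]) (auto intro: order_trans[OF degree_mult_le])
qed

lemma coord_degree_le_sum:
  assumes "\<And>i. i \<in> I \<Longrightarrow> coord_degree_le m D (f i)"
  shows "coord_degree_le m D (\<lambda>x. \<Sum>i\<in>I. f i x)"
  using assms by (induction I rule: infinite_finite_induct)
    (auto intro: coord_degree_le_const coord_degree_le_add)

lemma coord_degree_le_power:
  assumes "coord_degree_le m D f"
  shows "coord_degree_le m (n * D) (\<lambda>x. f x ^ n)"
  by (induction n) (auto intro: coord_degree_le_const coord_degree_le_mult assms)

lemma polys_coord_degree_le:
  assumes "f \<in> polys m"
  shows "\<exists>D. coord_degree_le m D f"
  using assms unfolding polys_def
proof induction
  case (const c)
  then show ?case using coord_degree_le_const by blast
next
  case (gen f)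
  then obtain l where l: "l < m" "f = (\<lambda>x. x $ l)" by auto
  have "coord_degree_le m 1 f"
    unfolding coord_degree_le_def
  proof (intro ballI allI impI)
    fix x :: "complex vec" and i assume "x \<in> carrier_vec m" "i < m"
    then show "\<exists>p. degree p \<le> 1 \<and> (\<forall>\<tau>. f (vec m (\<lambda>j. if j = i then \<tau> else x $ j)) = poly p \<tau>)"
      using l by (intro exI[of _ "if l = i then [:0, 1:] else [:x $ l:]"]) auto
  qed
  then show ?case by blast
next
  case (add f g)
  then obtain D E where "coord_degree_le m D f" "coord_degree_le m E g" by blast
  then show ?case
    using coord_degree_le_add[of m "max D E" f g] coord_degree_le_mono[of m _ _ "max D E"] by auto
next
  case (mult f g)
  then show ?case using coord_degree_le_mult by blast
qed

text \<open>Coordinates are released from the grid one at a time, since a univariate polynomial of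
  degree at most \<open>D\<close> with \<open>D + 1\<close> zeros is zero.\<close>

lemma coord_degree_le_eq_0_on_grid:
  assumes f: "coord_degree_le m D f"
    and 0: "\<And>x. x \<in> carrier_vec m \<Longrightarrow> (\<And>i. i < m \<Longrightarrow> x $ i \<in> of_nat ` {..D}) \<Longrightarrow> f x = 0"
    and x: "x \<in> carrier_vec m"
  shows "f x = 0"
proof -
  have "\<forall>x\<in>carrier_vec m. (\<forall>i. j \<le> i \<and> i < m \<longrightarrow> x $ i \<in> of_nat ` {..D}) \<longrightarrow> f x = 0" if "j \<le> m" for j
    using that
  proof (induction j)
    case 0
    then show ?case using assms(2) by auto
  next
    case (Suc j)
    show ?case
    proof (intro ballI impI)
      fix x :: "complex vec" assume x: "x \<in> carrier_vec m"
        and g: "\<forall>i. Suc j \<le> i \<and> i < m \<longrightarrow> x $ i \<in> of_nat ` {..D}"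
      obtain p where p: "degree p \<le> D" "\<And>\<tau>. f (vec m (\<lambda>i. if i = j then \<tau> else x $ i)) = poly p \<tau>"
        using f x Suc.prems unfolding coord_degree_le_def by (meson Suc_le_lessD)
      have "poly p (of_nat l) = 0" if "l \<le> D" for l
      proof -
        have "f (vec m (\<lambda>i. if i = j then of_nat l else x $ i)) = 0"
          using Suc g that by (auto simp: not_less_eq_eq)
        then show ?thesis by (simp add: p)
      qed
      then have sub: "(of_nat :: nat \<Rightarrow> complex) ` {..D} \<subseteq> {z. poly p z = 0}" by auto
      have "p = 0"
      proof (rule ccontr)
        assume "p \<noteq> 0"
        then have "card ((of_nat :: nat \<Rightarrow> complex) ` {..D}) \<le> degree p"
          using card_mono[OF poly_roots_finite sub] card_poly_roots_bound[of p] by linarith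
        then show False using p(1) by (simp add: card_image inj_on_def)
      qed
      moreover have "vec m (\<lambda>i. if i = j then x $ j else x $ i) = x" using x by (intro eq_vecI) auto
      ultimately show "f x = 0" using p(2)[of "x $ j"] by simp
    qed
  qed
  from this[of m] show ?thesis using x by auto
qed

text \<open>The exponent list runs from the highest index down: its head belongs to
  \<open>f (length as)\<close>. Splitting off the head thus isolates the power of the last function,
  by which the induction along the chain divides.\<close>

primrec mon :: "(nat \<Rightarrow> complex vec \<Rightarrow> complex) \<Rightarrow> nat list \<Rightarrow> complex vec \<Rightarrow> complex" where
  "mon f [] x = 1"
| "mon f (a # as) x = f (length as) x ^ a * mon f as x"

lemma mon_polys:
  assumes "\<And>i. i < length as \<Longrightarrow> f i \<in> polys m"
  shows "mon f as \<in> polys m"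
  using assms
proof (induction as)
  case Nil
  have "mon f [] = (\<lambda>_. 1)" by auto
  then show ?case by (simp add: polys_const)
next
  case (Cons a as)
  have "mon f (a # as) = (\<lambda>x. f (length as) x ^ a * mon f as x)" by auto
  then show ?case
    using Cons by (simp only:) (intro polys_mult polys_power; simp)
qed

lemma mon_coord_degree_le:
  assumes "\<And>i. i < length as \<Longrightarrow> coord_degree_le m D (f i)" "set as \<subseteq> {..<N}"
  shows "coord_degree_le m (length as * (N * D)) (mon f as)"
  using assms
proof (induction as)
  case Nil
  have "mon f [] = (\<lambda>_. 1)" by auto
  then show ?case by (simp add: coord_degree_le_const)
next
  case (Cons a as)
  have 1: "mon f (a # as) = (\<lambda>x. f (length as) x ^ a * mon f as x)" by auto
  have "coord_degree_le m (a * D) (\<lambda>x. f (length as) x ^ a)"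
    using Cons.prems by (intro coord_degree_le_power) auto
  then have "coord_degree_le m (N * D) (\<lambda>x. f (length as) x ^ a)"
    by (rule coord_degree_le_mono) (use Cons.prems in auto)
  then show ?case
    unfolding 1 using coord_degree_le_mult[of m "N * D" _ "length as * (N * D)"] Cons by auto
qed

text \<open>The trace in affine space of a strict chain of irreducible closed sets:
  \<open>prime\<close> stands for irreducibility, and \<open>f i\<close> witnesses that the step
  after \<open>Z i\<close> is strict.\<close>

locale prime_chain =
  fixes m n :: nat and Z :: "nat \<Rightarrow> complex vec set" and f :: "nat \<Rightarrow> complex vec \<Rightarrow> complex"
  assumes Z: "\<And>i. i \<le> n \<Longrightarrow> Z i \<subseteq> carrier_vec m" "Z 0 \<noteq> {}" "\<And>i. i < n \<Longrightarrow> Z i \<subseteq> Z (Suc i)"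
    and prime: "\<And>i g h. i \<le> n \<Longrightarrow> g \<in> polys m \<Longrightarrow> h \<in> polys m \<Longrightarrow> (\<And>x. x \<in> Z i \<Longrightarrow> g x * h x = 0) \<Longrightarrow>
      (\<forall>x\<in>Z i. g x = 0) \<or> (\<forall>x\<in>Z i. h x = 0)"
    and f: "\<And>i. i < n \<Longrightarrow> f i \<in> polys m" "\<And>i x. i < n \<Longrightarrow> x \<in> Z i \<Longrightarrow> f i x = 0"
      "\<And>i. i < n \<Longrightarrow> \<exists>x\<in>Z (Suc i). f i x \<noteq> 0"
begin

text \<open>The functions \<open>f 0, \<dots>, f (l - 1)\<close> are algebraically independent on \<open>Z l\<close>: a relation of
  minimal order in \<open>f (l - 1)\<close> can be divided by a power of it and restricted to \<open>Z (l - 1)\<close>.\<close>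

lemma algebraically_independent:
  assumes "l \<le> n" "\<And>x. x \<in> Z l \<Longrightarrow> (\<Sum>as | set as \<subseteq> {..<N} \<and> length as = l. c as * mon f as x) = 0"
    and "set as \<subseteq> {..<N}" "length as = l"
  shows "c as = 0"
  using assms
proof (induction l arbitrary: c as)
  case 0
  have "{as. set as \<subseteq> {..<N} \<and> length as = 0} = {[]}" by auto
  then show ?case using 0 Z(2) by auto
next
  case (Suc l)
  let ?L = "\<lambda>l. {as. set as \<subseteq> {..<N} \<and> length as = l}"
  define g where "g a x = (\<Sum>as\<in>?L l. c (a # as) * mon f as x)" for a x
  have L: "?L (Suc l) = (\<lambda>(a, as). a # as) ` ({..<N} \<times> ?L l)"
    by (auto simp: length_Suc_conv image_iff)
  have sum: "(\<Sum>as\<in>?L (Suc l). c as * mon f as x) = (\<Sum>a<N. f l x ^ a * g a x)" for x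
  proof -
    have "(\<Sum>as\<in>?L (Suc l). c as * mon f as x) =
        (\<Sum>(a, as)\<in>{..<N} \<times> ?L l. c (a # as) * mon f (a # as) x)"
      unfolding L by (subst sum.reindex) (auto simp: inj_on_def split_beta simp del: mon.simps intro!: sum.cong)
    also have "\<dots> = (\<Sum>a<N. \<Sum>as\<in>?L l. c (a # as) * mon f (a # as) x)"
      by (rule sum.cartesian_product[symmetric])
    also have "\<dots> = (\<Sum>a<N. f l x ^ a * g a x)"
      unfolding g_def sum_distrib_left by (intro sum.cong) auto
    finally show ?thesis .
  qed
  have g_polys: "g a \<in> polys m" for a
    unfolding g_def using Suc.prems(1) f(1)
    by (auto intro!: polys_sum polys_mult polys_const mon_polys)
  have "\<forall>as\<in>?L l. c (a # as) = 0" if "a < N" for a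
  proof (rule ccontr)
    assume ne: "\<not> ?thesis"
    define a0 where "a0 = (LEAST a. a < N \<and> \<not> (\<forall>as\<in>?L l. c (a # as) = 0))"
    have a0: "a0 < N" "\<not> (\<forall>as\<in>?L l. c (a0 # as) = 0)"
      using LeastI[of "\<lambda>a. a < N \<and> \<not> (\<forall>as\<in>?L l. c (a # as) = 0)" a] that ne unfolding a0_def by blast+
    have less: "g b x = 0" if "b < a0" for b x
    proof -
      have "\<forall>as\<in>?L l. c (b # as) = 0"
        using not_less_Least[of b "\<lambda>a. a < N \<and> \<not> (\<forall>as\<in>?L l. c (a # as) = 0)"] that a0(1)
        unfolding a0_def by (metis (no_types, lifting) order_less_trans)
      then show ?thesis unfolding g_def by (auto intro!: sum.neutral)
    qed
    \<comment> \<open>The relation divided by \<open>f l ^ a0\<close>. It vanishes on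
      \<open>Z (Suc l)\<close> by primeness, because \<open>f l\<close> is not identically zero
      there; on \<open>Z l\<close>, where \<open>f l\<close> is zero, only the term with
      \<open>b = a0\<close> survives.\<close>
    define h where "h x = (\<Sum>b\<in>{a0..<N}. f l x ^ (b - a0) * g b x)" for x
    have h_polys: "h \<in> polys m"
      unfolding h_def using Suc.prems(1) f(1) by (auto intro!: polys_sum polys_mult polys_power g_polys)
    have "f l x ^ a0 * h x = 0" if x: "x \<in> Z (Suc l)" for x
    proof -
      have "f l x ^ a0 * h x = (\<Sum>b\<in>{a0..<N}. f l x ^ b * g b x)"
        unfolding h_def sum_distrib_left
        by (intro sum.cong) (auto simp: mult.assoc[symmetric] power_add[symmetric])
      also have "\<dots> = (\<Sum>b<N. f l x ^ b * g b x)"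
        using less by (intro sum.mono_neutral_left) auto
      also have "\<dots> = 0" using Suc.prems(2)[OF x] sum by simp
      finally show ?thesis .
    qed
    then have "(\<forall>x\<in>Z (Suc l). f l x ^ a0 = 0) \<or> (\<forall>x\<in>Z (Suc l). h x = 0)"
      using Suc.prems(1) f(1) h_polys by (intro prime) (auto intro: polys_power)
    moreover have "\<not> (\<forall>x\<in>Z (Suc l). f l x ^ a0 = 0)" using f(3)[of l] Suc.prems(1) by auto
    ultimately have h0: "h x = 0" if "x \<in> Z l" for x using Z(3)[of l] Suc.prems(1) that by auto
    have "g a0 x = 0" if x: "x \<in> Z l" for x
    proof -
      have "h x = (\<Sum>b\<in>{a0..<N}. if b = a0 then g a0 x else 0)"
        unfolding h_def using f(2)[of l x] x Suc.prems(1) by (intro sum.cong) auto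
      then show ?thesis using h0[OF x] a0(1) by (simp add: sum.delta)
    qed
    then have "c (a0 # as) = 0" if "as \<in> ?L l" for as
      using Suc.IH[of "\<lambda>as. c (a0 # as)" as] Suc.prems(1) that unfolding g_def by auto
    then show False using a0(2) by blast
  qed
  then show ?case using Suc.prems(3,4) by (cases as) auto
qed

text \<open>If \<open>n > m\<close>, the monomials in the \<open>f i\<close> with exponents below a
  large \<open>N\<close> outnumber the points of a grid that detects polynomials of their degree. A
  nontrivial combination vanishes on the grid, hence everywhere, contradicting algebraic
  independence.\<close>

lemma length_le: "n \<le> m"
proof (rule ccontr)
  assume "\<not> n \<le> m"
  have "\<exists>D. \<forall>i<n. coord_degree_le m D (f i)"
  proof -
    obtain D where D: "\<And>i. i < n \<Longrightarrow> coord_degree_le m (D i) (f i)" using polys_coord_degree_le[OF f(1)] by metis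
    have "coord_degree_le m (\<Sum>i<n. D i) (f i)" if "i < n" for i
      by (rule coord_degree_le_mono[OF D[OF that]]) (use that in \<open>auto intro: member_le_sum\<close>)
    then show ?thesis by blast
  qed
  then obtain D where D: "\<And>i. i < n \<Longrightarrow> coord_degree_le m D (f i)" by blast
  \<comment> \<open>\<open>E\<close> bounds the coordinate degree of the monomials, and
    \<open>E + 1 \<le> N * (n * D + 1)\<close>. Once \<open>N\<close> exceeds
    \<open>(n * D + 1) ^ m\<close>, the number of grid points is below
    \<open>N ^ Suc m\<close>.\<close>
  define N where "N = (n * D + 1) ^ m + 1"
  define E where "E = n * (N * D)"
  have "(E + 1) ^ m \<le> (N * (n * D + 1)) ^ m"
    by (rule power_mono) (auto simp: E_def N_def algebra_simps)
  also have "\<dots> = (n * D + 1) ^ m * N ^ m" by (simp only: power_mult_distrib mult.commute)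
  also have "\<dots> < N * N ^ m" by (rule mult_strict_right_mono) (auto simp: N_def)
  also have "\<dots> = N ^ Suc m" by simp
  also have "\<dots> \<le> N ^ n" using \<open>\<not> n \<le> m\<close> by (intro power_increasing) (auto simp: N_def)
  finally have less: "(E + 1) ^ m < N ^ n" .
  let ?I = "{as. set as \<subseteq> {..<N} \<and> length as = n}" and ?J = "{as. set as \<subseteq> {..E} \<and> length as = m}"
  have "finite ?J" "finite ?I" by (auto intro: finite_lists_length_eq)
  moreover have "card ?J < card ?I" using less by (simp add: card_lists_length_eq)
  ultimately obtain c where c: "\<exists>as\<in>?I. c as \<noteq> 0"
    "\<forall>bs\<in>?J. (\<Sum>as\<in>?I. c as * mon f as (vec_of_list (map of_nat bs))) = 0"
    using homogeneous_system[of ?J ?I "\<lambda>as bs. mon f as (vec_of_list (map of_nat bs))"] by blast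
  define g where "g x = (\<Sum>as\<in>?I. c as * mon f as x)" for x
  have "coord_degree_le m E (\<lambda>x. c as * mon f as x)" if "as \<in> ?I" for as
    using coord_degree_le_mult[OF coord_degree_le_const[of m 0 "c as"] mon_coord_degree_le[of as m D f N]] that D
    by (auto simp: E_def)
  then have deg: "coord_degree_le m E g" unfolding g_def by (intro coord_degree_le_sum)
  have "g x = 0" if "x \<in> carrier_vec m" for x
  proof (rule coord_degree_le_eq_0_on_grid[OF deg _ that])
    fix x :: "complex vec" assume x: "x \<in> carrier_vec m" "\<And>i. i < m \<Longrightarrow> x $ i \<in> of_nat ` {..E}"
    then have "\<forall>i. \<exists>b. i < m \<longrightarrow> b \<le> E \<and> x $ i = of_nat b" by auto
    then obtain b where b: "\<And>i. i < m \<Longrightarrow> b i \<le> E \<and> x $ i = of_nat (b i)" by metis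
    have "x = vec_of_list (map of_nat (map b [0..<m]))"
      by (intro eq_vecI) (use x b in \<open>auto simp: vec_of_list_index\<close>)
    moreover have "map b [0..<m] \<in> ?J" using b by auto
    ultimately show "g x = 0" using c(2) unfolding g_def by blast
  qed
  then have "c as = 0" if "as \<in> ?I" for as
    using algebraically_independent[where l = n and N = N and c = c and as = as] that Z(1)[of n] unfolding g_def by auto
  then show False using c(1) by blast
qed

end


text \<open>The ideal of a point is generated by the translated coordinates. For a product, the
  increment splits as \<open>(f x - f a) * g x + f a * (g x - g a)\<close>.\<close>

lemma polys_taylor:
  assumes "f \<in> polys m"
  shows "\<exists>h. (\<forall>i. h i \<in> polys m) \<and> (\<forall>x. f x = f a + (\<Sum>i<m. (x $ i - a $ i) * h i x))"
  using assms unfolding polys_def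
proof induction
  case (const c)
  show ?case
    by (rule exI[of _ "\<lambda>_ _. 0"]) (auto intro: algebra_generated.const)
next
  case (gen f)
  then obtain l where l: "l < m" "f = (\<lambda>x. x $ l)" by auto
  show ?case
    by (rule exI[of _ "\<lambda>i _. if i = l then 1 else 0"])
      (use l in \<open>auto intro: algebra_generated.const simp: if_distrib cong: if_cong\<close>)
next
  case (add f g)
  then obtain h k where h: "\<forall>i. h i \<in> polys m" "\<forall>x. f x = f a + (\<Sum>i<m. (x $ i - a $ i) * h i x)"
    and k: "\<forall>i. k i \<in> polys m" "\<forall>x. g x = g a + (\<Sum>i<m. (x $ i - a $ i) * k i x)"
    unfolding polys_def by blast
  show ?case
  proof (intro exI[of _ "\<lambda>i x. h i x + k i x"] conjI allI)
    show "f x + g x = f a + g a + (\<Sum>i<m. (x $ i - a $ i) * (h i x + k i x))" for x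
      using h(2)[rule_format, of x] k(2)[rule_format, of x] by (simp add: distrib_left sum.distrib)
  qed (use h k in \<open>auto simp: polys_def intro: algebra_generated.add\<close>)
next
  case (mult f g)
  then obtain h k where h: "\<forall>i. h i \<in> polys m" "\<forall>x. f x = f a + (\<Sum>i<m. (x $ i - a $ i) * h i x)"
    and k: "\<forall>i. k i \<in> polys m" "\<forall>x. g x = g a + (\<Sum>i<m. (x $ i - a $ i) * k i x)"
    unfolding polys_def by blast
  have poly: "(\<lambda>x. h i x * g x + f a * k i x) \<in> polys m" for i
    using h(1) k(1) mult.hyps(2)[folded polys_def] by (intro polys_add polys_mult polys_const) auto
  show ?case
  proof (intro exI[of _ "\<lambda>i x. h i x * g x + f a * k i x"] conjI allI)
    fix x
    have "(\<Sum>i<m. (x $ i - a $ i) * (h i x * g x + f a * k i x)) =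
        (\<Sum>i<m. (x $ i - a $ i) * h i x) * g x + f a * (\<Sum>i<m. (x $ i - a $ i) * k i x)"
      unfolding sum_distrib_left sum_distrib_right sum.distrib[symmetric]
      by (intro sum.cong) (auto simp: algebra_simps)
    also have "\<dots> = (f x - f a) * g x + f a * (g x - g a)"
      using h(2)[rule_format, of x] k(2)[rule_format, of x] by simp
    finally show "f x * g x = f a * g a + (\<Sum>i<m. (x $ i - a $ i) * (h i x * g x + f a * k i x))"
      by (simp add: algebra_simps)
  qed (use poly in \<open>simp add: polys_def\<close>)
qed


lemma (in graded_variety) irreducible_setD:
  assumes "irreducible_set S" "f \<in> P d" "g \<in> P e" "\<And>q. q \<in> S \<Longrightarrow> f q * g q = 0"
  shows "(\<forall>q\<in>S. f q = 0) \<or> (\<forall>q\<in>S. g q = 0)"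
  using assms unfolding irreducible_set_def by blast


section \<open>Affine charts and smoothness\<close>

text \<open>\<open>\<phi>\<close> identifies affine \<open>m\<close>-space with the open set where
  \<open>k\<close> is nonzero; the inverse is given by quotients of forms of equal degree, so its
  components are regular.\<close>

locale affine_chart = graded_variety +
  fixes m :: nat and \<phi> :: "complex vec \<Rightarrow> 'a" and e :: nat and k :: "'a \<Rightarrow> complex"
    and \<xi> :: "nat \<Rightarrow> 'a \<Rightarrow> complex"
  assumes param: "parametrization m \<phi>"
    and k: "k \<in> P e" "\<And>x. x \<in> carrier_vec m \<Longrightarrow> k (\<phi> x) \<noteq> 0"
    and coords: "\<And>i. i < m \<Longrightarrow> \<xi> i \<in> P e"
      "\<And>x i. x \<in> carrier_vec m \<Longrightarrow> i < m \<Longrightarrow> x $ i = \<xi> i (\<phi> x) / k (\<phi> x)"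
    and surj: "\<And>p. p \<in> C \<Longrightarrow> k p \<noteq> 0 \<Longrightarrow> \<exists>x\<in>carrier_vec m. \<phi> x = p"
begin

lemma in_C: "x \<in> carrier_vec m \<Longrightarrow> \<phi> x \<in> C"
  using param unfolding parametrization_def by blast

text \<open>The converse of \<open>parametrization\<close>: a polynomial in the chart coordinates
  becomes a form once multiplied by a power of the denominator \<open>k\<close>.\<close>

lemma homogenize:
  assumes "f \<in> polys m"
  shows "\<exists>n. \<exists>g\<in>P (n * e). \<forall>x\<in>carrier_vec m. f x * k (\<phi> x) ^ n = g (\<phi> x)"
  using assms unfolding polys_def
proof induction
  case (const c)
  show ?case by (rule exI[of _ 0], rule bexI[of _ "\<lambda>_. c"]) (auto intro: graded_variety.const[OF graded_variety_axioms])
next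
  case (gen f)
  then obtain l where l: "l < m" "f = (\<lambda>x. x $ l)" by auto
  show ?case
    by (rule exI[of _ 1], rule bexI[of _ "\<xi> l"]) (use l coords k in auto)
next
  case (add f g)
  then obtain n n' f' g' where f': "f' \<in> P (n * e)" "\<forall>x\<in>carrier_vec m. f x * k (\<phi> x) ^ n = f' (\<phi> x)"
    and g': "g' \<in> P (n' * e)" "\<forall>x\<in>carrier_vec m. g x * k (\<phi> x) ^ n' = g' (\<phi> x)" by blast
  show ?case
  proof (rule exI[of _ "n + n'"], rule bexI[of _ "\<lambda>p. f' p * k p ^ n' + g' p * k p ^ n"], rule ballI)
    fix x :: "complex vec" assume x: "x \<in> carrier_vec m"
    have "f' (\<phi> x) = f x * k (\<phi> x) ^ n" "g' (\<phi> x) = g x * k (\<phi> x) ^ n'" using f' g' x by auto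
    then show "(f x + g x) * k (\<phi> x) ^ (n + n') = f' (\<phi> x) * k (\<phi> x) ^ n' + g' (\<phi> x) * k (\<phi> x) ^ n"
      by (simp add: power_add algebra_simps)
  next
    have "(\<lambda>p. f' p * k p ^ n') \<in> P (n * e + n' * e)" "(\<lambda>p. g' p * k p ^ n) \<in> P (n' * e + n * e)"
      using f' g' k by (auto intro: mult power)
    then show "(\<lambda>p. f' p * k p ^ n' + g' p * k p ^ n) \<in> P ((n + n') * e)"
      by (intro graded_variety.add[OF graded_variety_axioms]) (auto simp: algebra_simps)
  qed
next
  case (mult f g)
  then obtain n n' f' g' where f': "f' \<in> P (n * e)" "\<forall>x\<in>carrier_vec m. f x * k (\<phi> x) ^ n = f' (\<phi> x)"
    and g': "g' \<in> P (n' * e)" "\<forall>x\<in>carrier_vec m. g x * k (\<phi> x) ^ n' = g' (\<phi> x)" by blast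
  show ?case
  proof (rule exI[of _ "n + n'"], rule bexI[of _ "\<lambda>p. f' p * g' p"], rule ballI)
    fix x :: "complex vec" assume x: "x \<in> carrier_vec m"
    have "f' (\<phi> x) = f x * k (\<phi> x) ^ n" "g' (\<phi> x) = g x * k (\<phi> x) ^ n'" using f' g' x by auto
    then show "(f x * g x) * k (\<phi> x) ^ (n + n') = f' (\<phi> x) * g' (\<phi> x)"
      by (simp add: power_add algebra_simps)
  qed (use graded_variety.mult[OF graded_variety_axioms f'(1) g'(1)] in \<open>simp add: algebra_simps\<close>)
qed

text \<open>All members of the chain contain \<open>p\<close>, so none lies in the zero set of
  \<open>k\<close>. Their traces in the chart therefore remain prime and strictly increasing, and
  \<open>length_le\<close> applies.\<close>

lemma chain_le:
  assumes p: "p \<in> C" "k p \<noteq> 0" and c: "p \<in> c 0" "\<And>i. i \<le> n \<Longrightarrow> irreducible_closed (zar X) (c i)"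
    and strict: "\<And>i. i < n \<Longrightarrow> c i \<subset> c (Suc i)"
  shows "n \<le> m"
proof -
  define Z where "Z i = {x \<in> carrier_vec m. \<phi> x \<in> c i}" for i
  have p_in: "p \<in> c i" if "i \<le> n" for i
    using that by (induction i) (use c(1) strict in \<open>auto simp: Suc_le_eq\<close>)
  have irr: "irreducible_set (c i)" if "i \<le> n" for i
    using irreducible_closed_imp_irreducible_set c(2) that by blast
  obtain u where u: "\<forall>x. u x \<noteq> 0"
    "\<forall>d. \<forall>g\<in>P d. \<exists>f\<in>polys m. \<forall>x\<in>carrier_vec m. u x ^ d * g (\<phi> x) = f x"
    using param unfolding parametrization_def by blast
  have "\<exists>f\<in>polys m. (\<forall>x\<in>Z i. f x = 0) \<and> (\<exists>x\<in>Z (Suc i). f x \<noteq> 0)" if i: "i < n" for i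
  proof -
    obtain r where r: "r \<in> c (Suc i)" "r \<notin> c i" using strict[OF i] by blast
    have sub: "c (Suc i) \<subseteq> C" using irr[of "Suc i"] i by (auto simp: irreducible_set_def)
    have "closedin (zar X) (c i)" using c(2)[of i] i by (auto simp: irreducible_closed_def)
    then obtain d h where h: "h \<in> P d" "h r \<noteq> 0" "\<forall>q\<in>c i. h q = 0"
      using r sub unfolding closedin_iff by blast
    obtain f where f: "f \<in> polys m" "\<forall>x\<in>carrier_vec m. u x ^ d * h (\<phi> x) = f x" using u(2) h(1) by blast
    \<comment> \<open>A form separating \<open>c i\<close> from \<open>c (Suc i)\<close> might do so
      only outside the chart; primeness provides a point where \<open>k\<close> is nonzero as
      well.\<close>
    have "\<not> (\<forall>q\<in>c (Suc i). h q * k q = 0)"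
    proof
      assume "\<forall>q\<in>c (Suc i). h q * k q = 0"
      then have "(\<forall>q\<in>c (Suc i). h q = 0) \<or> (\<forall>q\<in>c (Suc i). k q = 0)"
        using irreducible_setD[OF irr[of "Suc i"] h(1) k(1)] i by auto
      then show False using h(2) r(1) p(2) p_in[of "Suc i"] i by auto
    qed
    then obtain q where q: "q \<in> c (Suc i)" "h q \<noteq> 0" "k q \<noteq> 0" by auto
    then obtain x where x: "x \<in> carrier_vec m" "\<phi> x = q" using surj sub by blast
    have "f x \<noteq> 0" using f(2) x q u(1) by (metis mult_eq_0_iff power_not_zero)
    moreover have "x \<in> Z (Suc i)" using x q by (simp add: Z_def)
    moreover have "f x = 0" if "x \<in> Z i" for x using that f(2) h(3) by (auto simp: Z_def)
    ultimately show ?thesis using f(1) by blast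
  qed
  then obtain f where f: "\<And>i. i < n \<Longrightarrow> f i \<in> polys m \<and> (\<forall>x\<in>Z i. f i x = 0) \<and> (\<exists>x\<in>Z (Suc i). f i x \<noteq> 0)"
    by metis
  interpret prime_chain m n Z f
  proof
    show "Z 0 \<noteq> {}" using surj[OF p] p_in[of 0] by (auto simp: Z_def)
    show "Z i \<subseteq> Z (Suc i)" if "i < n" for i using strict[OF that] by (auto simp: Z_def)
    fix i g h assume i: "i \<le> n" and gh: "g \<in> polys m" "h \<in> polys m" and 0: "\<And>x. x \<in> Z i \<Longrightarrow> g x * h x = 0"
    obtain a g' where g': "g' \<in> P (a * e)" "\<forall>x\<in>carrier_vec m. g x * k (\<phi> x) ^ a = g' (\<phi> x)"
      using homogenize[OF gh(1)] by blast
    obtain b h' where h': "h' \<in> P (b * e)" "\<forall>x\<in>carrier_vec m. h x * k (\<phi> x) ^ b = h' (\<phi> x)"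
      using homogenize[OF gh(2)] by blast
    \<comment> \<open>The extra factor \<open>k\<close> makes the product vanish at points outside
      the chart too, where the hypothesis on \<open>g\<close> and \<open>h\<close> says
      nothing.\<close>
    have g'k: "(\<lambda>q. g' q * k q) \<in> P (a * e + e)" using g' k by (auto intro: mult)
    have sub: "c i \<subseteq> C" using irr[of i] i by (auto simp: irreducible_set_def)
    have "g' q * k q * h' q = 0" if q: "q \<in> c i" for q
    proof (cases "k q = 0")
      case False
      then obtain x where x: "x \<in> carrier_vec m" "\<phi> x = q" using surj sub q by blast
      then have "g x * h x = 0" using 0 q by (auto simp: Z_def)
      then show ?thesis using g'(2) h'(2) x by auto
    qed simp
    then have "(\<forall>q\<in>c i. g' q * k q = 0) \<or> (\<forall>q\<in>c i. h' q = 0)"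
      by (rule irreducible_setD[OF irr[OF i] g'k h'(1)])
    then show "(\<forall>x\<in>Z i. g x = 0) \<or> (\<forall>x\<in>Z i. h x = 0)"
    proof
      assume *: "\<forall>q\<in>c i. g' q * k q = 0"
      have "g x = 0" if "x \<in> Z i" for x
      proof -
        have "x \<in> carrier_vec m" "\<phi> x \<in> c i" using that by (auto simp: Z_def)
        then have "g x * k (\<phi> x) ^ a * k (\<phi> x) = 0" using * g'(2) by auto
        then show ?thesis using k(2)[OF \<open>x \<in> carrier_vec m\<close>] by auto
      qed
      then show ?thesis by blast
    next
      assume *: "\<forall>q\<in>c i. h' q = 0"
      have "h x = 0" if "x \<in> Z i" for x
      proof -
        have "x \<in> carrier_vec m" "\<phi> x \<in> c i" using that by (auto simp: Z_def)
        then have "h x * k (\<phi> x) ^ b = 0" using * h'(2) by auto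
        then show ?thesis using k(2)[OF \<open>x \<in> carrier_vec m\<close>] by auto
      qed
      then show ?thesis by blast
    qed
  qed (use f in \<open>auto simp: Z_def\<close>)
  show ?thesis by (rule length_le)
qed

text \<open>The members are closures of the coordinate subspaces through \<open>a\<close>: in
  \<open>S j\<close> the entries from \<open>j\<close> on are fixed.\<close>

lemma exists_chain:
  assumes a: "a \<in> carrier_vec m" and closed: "closedin (zar X) {\<phi> a}"
  shows "\<exists>c. c 0 = {\<phi> a} \<and> (\<forall>i\<le>m. irreducible_closed (zar X) (c i)) \<and> (\<forall>i<m. c i \<subset> c (Suc i))"
proof -
  define S where "S j = \<phi> ` {x \<in> carrier_vec m. \<forall>i. j \<le> i \<and> i < m \<longrightarrow> x $ i = a $ i}" for j
  define c where "c j = zar X closure_of (S j)" for j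
  have S_C: "S j \<subseteq> C" for j using in_C by (auto simp: S_def)
  have "irreducible_set (S j)" for j
  proof -
    define \<psi> where "\<psi> x = vec m (\<lambda>i. if i < j then x $ i else a $ i)" for x :: "complex vec"
    have "parametrization m (\<lambda>x. \<phi> (\<psi> x))"
    proof (rule parametrization_comp[OF param])
      show "(\<lambda>x. \<psi> x $ i) \<in> polys m" if "i < m" for i
        using that by (cases "i < j") (auto simp: \<psi>_def intro: polys_intros)
    qed (simp add: \<psi>_def)
    then have "irreducible_set ((\<lambda>x. \<phi> (\<psi> x)) ` carrier_vec m)" by (rule irreducible_set_image)
    moreover have "S j = (\<lambda>x. \<phi> (\<psi> x)) ` carrier_vec m"
    proof (intro equalityI subsetI)
      fix q assume "q \<in> S j"
      then obtain x where x: "x \<in> carrier_vec m" "\<forall>i. j \<le> i \<and> i < m \<longrightarrow> x $ i = a $ i" "q = \<phi> x"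
        by (auto simp: S_def)
      then have "\<psi> x = x" by (intro eq_vecI) (auto simp: \<psi>_def)
      then show "q \<in> (\<lambda>x. \<phi> (\<psi> x)) ` carrier_vec m" using x by force
    qed (auto simp: S_def \<psi>_def)
    ultimately show ?thesis by simp
  qed
  then have "irreducible_closed (zar X) (c i)" for i unfolding c_def by (rule irreducible_closed_closure)
  moreover have "c 0 = {\<phi> a}"
  proof -
    have "{x \<in> carrier_vec m. \<forall>i. 0 \<le> i \<and> i < m \<longrightarrow> x $ i = a $ i} = {a}" using a by auto
    then have "S 0 = {\<phi> a}" unfolding S_def by simp
    then show ?thesis unfolding c_def using closure_of_closedin[OF closed] by simp
  qed
  moreover have "c i \<subset> c (Suc i)" if i: "i < m" for i
  proof
    show "c i \<subseteq> c (Suc i)" unfolding c_def by (rule closure_of_mono) (auto simp: S_def)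
    \<comment> \<open>The function \<open>x $ i - a $ i\<close> made homogeneous. It vanishes on
      \<open>S i\<close>, hence on the closure, but not on \<open>S (Suc i)\<close>.\<close>
    define l where "l q = \<xi> i q - a $ i * k q" for q
    have l: "l \<in> P e" unfolding l_def using coords(1)[OF i] k(1) by (intro diff smult)
    have l_eq: "l (\<phi> x) = (x $ i - a $ i) * k (\<phi> x)" if "x \<in> carrier_vec m" for x
      using coords(2)[OF that i] k(2)[OF that] by (simp add: l_def field_simps)
    have "l q = 0" if "q \<in> c i" for q
    proof -
      have "\<forall>q\<in>S i. l q = 0" using l_eq i by (auto simp: S_def)
      then show ?thesis using that l closure_of_iff[OF S_C, of q i] unfolding c_def by blast
    qed
    define b where "b = vec m (\<lambda>j. if j = i then a $ i + 1 else a $ j)"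
    have b: "b \<in> carrier_vec m" "b $ i = a $ i + 1" using i by (auto simp: b_def)
    then have "l (\<phi> b) \<noteq> 0" using l_eq[OF b(1)] k(2)[OF b(1)] by simp
    moreover have "\<phi> b \<in> c (Suc i)"
    proof -
      have "\<phi> b \<in> S (Suc i)" unfolding S_def using b(1) by (intro imageI) (auto simp: b_def)
      then show ?thesis unfolding c_def using closure_of_subset[of "S (Suc i)" "zar X"] S_C points by blast
    qed
    ultimately show "c i \<noteq> c (Suc i)" using \<open>\<And>q. q \<in> c i \<Longrightarrow> l q = 0\<close> by blast
  qed
  ultimately show ?thesis by blast
qed

lemma codim_point:
  assumes "p \<in> C" "k p \<noteq> 0" and closed: "closedin (zar X) {p}"
  shows "codim X {p} = enat m"
proof -
  obtain a where a: "a \<in> carrier_vec m" "\<phi> a = p" using surj assms by blast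
  have "irreducible_closed (zar X) {p}" using closed by (auto simp: irreducible_closed_def)
  then have eq: "{W. irreducible_closed (zar X) W \<and> W \<subseteq> {p}} = {{p}}"
    by (auto simp: irreducible_closed_def subset_singleton_iff)
  have "(SUP n\<in>{n. \<exists>c. c 0 = {p} \<and> (\<forall>i\<le>n. irreducible_closed (zar X) (c i)) \<and>
      (\<forall>i<n. c i \<subset> c (Suc i))}. enat n) = enat m"
  proof (rule antisym)
    show "(SUP n\<in>{n. \<exists>c. c 0 = {p} \<and> (\<forall>i\<le>n. irreducible_closed (zar X) (c i)) \<and>
      (\<forall>i<n. c i \<subset> c (Suc i))}. enat n) \<le> enat m"
    proof (rule SUP_least)
      fix n assume "n \<in> {n. \<exists>c. c 0 = {p} \<and> (\<forall>i\<le>n. irreducible_closed (zar X) (c i)) \<and> (\<forall>i<n. c i \<subset> c (Suc i))}"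
      then obtain c where c: "c 0 = {p}" "\<forall>i\<le>n. irreducible_closed (zar X) (c i)" "\<forall>i<n. c i \<subset> c (Suc i)" by blast
      then have "n \<le> m" using assms(1,2) by (intro chain_le[of p c n]) auto
      then show "enat n \<le> enat m" by simp
    qed
    show "enat m \<le> (SUP n\<in>{n. \<exists>c. c 0 = {p} \<and> (\<forall>i\<le>n. irreducible_closed (zar X) (c i)) \<and>
      (\<forall>i<n. c i \<subset> c (Suc i))}. enat n)"
      using exists_chain[OF a(1)] closed a(2) by (intro SUP_upper) auto
  qed
  then show ?thesis unfolding codim_def eq by simp
qed

text \<open>The local parameters are the translated chart coordinates. The numerator of a germ
  vanishing at \<open>p\<close> is, in the chart, a polynomial vanishing at \<open>a\<close>, and
  \<open>polys_taylor\<close> supplies the coefficients.\<close>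

lemma regular_point:
  assumes p: "p \<in> C" "k p \<noteq> 0" and closed: "closedin (zar X) {p}"
  shows "regular_point X p"
proof -
  obtain a where a: "a \<in> carrier_vec m" "\<phi> a = p" using surj p by blast
  define U where "U = {q \<in> C. k q \<noteq> 0}"
  have U: "openin (zar X) U" unfolding U_def using k(1) by (rule openin_nonvanishing)
  define g where "g i q = \<xi> i q / k q - a $ i" for i q
  have g_coord: "g i (\<phi> x) = x $ i - a $ i" if "x \<in> carrier_vec m" "i < m" for i x
    using coords(2)[OF that] by (simp add: g_def)
  show ?thesis
    unfolding regular_point_def
  proof (rule exI[of _ m], rule exI[of _ U], rule exI[of _ g], intro conjI allI impI)
    show "enat m = codim X {p}" using codim_point[OF p closed] by simp
    show "openin (zar X) U" "p \<in> U" using U p by (auto simp: U_def)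
    show "g i \<in> reg X U" if i: "i < m" for i
    proof (rule quotient_reg[OF U])
      show "(\<lambda>q. \<xi> i q - a $ i * k q) \<in> P e" using coords(1)[OF i] k(1) by (intro diff smult)
      show "k \<in> P e" by (fact k(1))
      show "k q \<noteq> 0 \<and> g i q = (\<xi> i q - a $ i * k q) / k q" if "q \<in> U" for q
        using that by (auto simp: U_def g_def field_simps)
    qed
    show "g i p = 0" if "i < m" for i using g_coord[OF a(1) that] a by simp
    fix V f assume Vf: "openin (zar X) V \<and> p \<in> V \<and> f \<in> reg X V \<and> f p = 0"
    then have V: "openin (zar X) V" by blast
    obtain d G H where GH: "G \<in> P d" "H \<in> P d" "H p \<noteq> 0"
      "\<And>q. q \<in> C \<Longrightarrow> H q \<noteq> 0 \<Longrightarrow> q \<in> V \<and> f q = G q / H q" using Vf unfolding reg_iff[OF V] by blast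
    obtain u where u: "\<forall>x. u x \<noteq> 0"
      "\<forall>d. \<forall>g\<in>P d. \<exists>f\<in>polys m. \<forall>x\<in>carrier_vec m. u x ^ d * g (\<phi> x) = f x"
      using param unfolding parametrization_def by blast
    obtain G1 where G1: "G1 \<in> polys m" "\<forall>x\<in>carrier_vec m. u x ^ d * G (\<phi> x) = G1 x" using u(2) GH(1) by blast
    obtain H1 where H1: "H1 \<in> polys m" "\<forall>x\<in>carrier_vec m. u x ^ d * H (\<phi> x) = H1 x" using u(2) GH(2) by blast
    have "G p = 0" using GH(4)[OF p(1) GH(3)] Vf GH(3) by auto
    then have G1a: "G1 a = 0" using G1(2) a by auto
    obtain h where h: "\<And>i. h i \<in> polys m" "\<And>x. G1 x = G1 a + (\<Sum>i<m. (x $ i - a $ i) * h i x)"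
      using polys_taylor[OF G1(1)] by metis
    have "\<forall>i. \<exists>n. \<exists>g\<in>P (n * e). \<forall>x\<in>carrier_vec m. h i x * k (\<phi> x) ^ n = g (\<phi> x)"
      using homogenize h(1) by blast
    then obtain N h' where h': "\<And>i. h' i \<in> P (N i * e)"
      "\<And>i x. x \<in> carrier_vec m \<Longrightarrow> h i x * k (\<phi> x) ^ N i = h' i (\<phi> x)" by metis
    obtain n H' where H': "H' \<in> P (n * e)" "\<forall>x\<in>carrier_vec m. H1 x * k (\<phi> x) ^ n = H' (\<phi> x)"
      using homogenize[OF H1(1)] by blast
    define W where "W = {q \<in> C. k q * H q \<noteq> 0}"
    \<comment> \<open>This is \<open>h i / H1\<close> in chart coordinates, written as a quotient of
      forms of equal degree.\<close>
    define r where "r i q = (h' i q * k q ^ n) / (H' q * k q ^ N i)" for i q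
    have W: "openin (zar X) W" unfolding W_def using mult[OF k(1) GH(2)] by (rule openin_nonvanishing)
    have in_W: "\<exists>x\<in>carrier_vec m. \<phi> x = q \<and> H1 x \<noteq> 0 \<and> k q \<noteq> 0 \<and> H' q = H1 x * k q ^ n" if q: "q \<in> W" for q
    proof -
      obtain x where x: "x \<in> carrier_vec m" "\<phi> x = q" using q surj by (auto simp: W_def)
      moreover have "H1 x \<noteq> 0" using H1(2) x q u(1) by (auto simp: W_def)
      ultimately show ?thesis using q H'(2) by (auto simp: W_def)
    qed
    show "\<exists>W h. openin (zar X) W \<and> p \<in> W \<and> W \<subseteq> U \<inter> V \<and> (\<forall>i<m. h i \<in> reg X W) \<and>
        (\<forall>q\<in>W. f q = (\<Sum>i<m. h i q * g i q))"
    proof (rule exI[of _ W], rule exI[of _ r], intro conjI allI impI ballI)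
      show "openin (zar X) W" by (fact W)
      show "p \<in> W" using p GH(3) by (simp add: W_def)
      show "W \<subseteq> U \<inter> V" using GH(4) by (auto simp: W_def U_def)
      show "r i \<in> reg X W" for i
      proof (rule quotient_reg[OF W])
        show "(\<lambda>q. h' i q * k q ^ n) \<in> P (N i * e + n * e)" using h'(1) k(1) by (intro mult power)
        have "(\<lambda>q. H' q * k q ^ N i) \<in> P (n * e + N i * e)" using H'(1) k(1) by (intro mult power)
        then show "(\<lambda>q. H' q * k q ^ N i) \<in> P (N i * e + n * e)" by (simp only: add.commute)
        show "H' q * k q ^ N i \<noteq> 0 \<and> r i q = h' i q * k q ^ n / (H' q * k q ^ N i)" if "q \<in> W" for q
          using in_W[OF that] by (auto simp: r_def)
      qed
      fix q assume q: "q \<in> W"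
      then obtain x where x: "x \<in> carrier_vec m" "\<phi> x = q" "H1 x \<noteq> 0" "k q \<noteq> 0" "H' q = H1 x * k q ^ n"
        using in_W by blast
      have r: "r i q = h i x / H1 x" for i
        using x h'(2)[OF x(1), of i, symmetric] by (simp add: r_def)
      have "f q = G q / H q" using GH(4) q by (auto simp: W_def)
      also have "\<dots> = G1 x / H1 x"
      proof -
        have "u x ^ d * G q = G1 x" "u x ^ d * H q = H1 x" using G1(2) H1(2) x by auto
        then show ?thesis using u(1)[rule_format, of x] by (metis mult_divide_mult_cancel_left power_not_zero)
      qed
      also have "\<dots> = (\<Sum>i<m. r i q * g i q)"
        unfolding h(2)[of x] G1a r using g_coord[OF x(1)] x(2)
        by (simp add: sum_divide_distrib mult.commute)
      finally show "f q = (\<Sum>i<m. r i q * g i q)" .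
    qed
  qed
qed

end


section \<open>Subvarieties of affine space times projective space\<close>

lemma homog_polys_comp:
  assumes "G \<in> homog_polys n r d"
    and "\<And>i. i < n \<Longrightarrow> (\<lambda>x. y x $ i) \<in> polys m" "\<And>j. j < r \<Longrightarrow> (\<lambda>x. u x $ j) \<in> polys m"
  shows "(\<lambda>x. G (y x, u x)) \<in> polys m"
proof -
  have "G \<in> algebra_generated ({\<lambda>(x, u). x $ i | i. i < n} \<union> {\<lambda>(x, u). u $ j | j. j < r})"
    using assms(1) by (simp add: homog_polys_def)
  then show ?thesis
    unfolding polys_def by (rule algebra_generated_comp) (use assms(2,3) in \<open>auto simp: polys_def\<close>)
qed

text \<open>\<open>c\<close> compares the chosen representative of each line with the given vector
  \<open>u x\<close>. It is an arbitrary nonvanishing function, but its powers serve forms of all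
  degrees.\<close>

lemma proj_forms_rescale:
  assumes y: "\<And>x. x \<in> D \<Longrightarrow> y x \<in> carrier_vec n"
    and u: "\<And>x. x \<in> D \<Longrightarrow> u x \<in> carrier_vec r \<and> u x \<noteq> 0\<^sub>v r"
  shows "\<exists>c. (\<forall>x. c x \<noteq> 0) \<and> (\<forall>d. \<forall>g\<in>proj_forms n r d. \<exists>G\<in>homog_polys n r d.
    \<forall>x\<in>D. c x ^ d * g (y x, line (u x)) = G (y x, u x))"
proof -
  have "\<forall>x. \<exists>c. c \<noteq> 0 \<and> (x \<in> D \<longrightarrow> rep r (line (u x)) = c \<cdot>\<^sub>v u x)"
    using rep_line u by (metis one_neq_zero)
  then obtain c where c: "\<And>x. c x \<noteq> 0" "\<And>x. x \<in> D \<Longrightarrow> rep r (line (u x)) = c x \<cdot>\<^sub>v u x" by metis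
  show ?thesis
  proof (rule exI[of _ "\<lambda>x. 1 / c x"], intro conjI allI ballI)
    show "1 / c x \<noteq> 0" for x using c(1) by simp
    fix d g assume "g \<in> proj_forms n r d"
    then obtain G where G: "G \<in> homog_polys n r d" "g = (\<lambda>(x, L). G (x, rep r L))"
      by (auto simp: proj_forms_def)
    have "(1 / c x) ^ d * g (y x, line (u x)) = G (y x, u x)" if "x \<in> D" for x
      using homog_polys_smult[OF G(1) y[OF that], of "u x" "c x"] u[OF that] c that
      by (simp add: G(2) power_one_over)
    then show "\<exists>G\<in>homog_polys n r d. \<forall>x\<in>D. (1 / c x) ^ d * g (y x, line (u x)) = G (y x, u x)"
      using G(1) by blast
  qed
qed

lemma proj_forms_base:
  assumes "g \<in> polys n"
  shows "(\<lambda>(x, L). g x) \<in> proj_forms n r 0"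
proof -
  have "(\<lambda>p. g (fst p)) \<in> algebra_generated ({\<lambda>(x, u). x $ i | i. i < n} \<union> {\<lambda>(x, u). u $ j | j. j < r})"
    using assms unfolding polys_def
    by (rule algebra_generated_comp) (auto intro!: algebra_generated.gen simp: split_def)
  then have "(\<lambda>(x, u). g x) \<in> homog_polys n r 0" by (auto simp: homog_polys_def split_def)
  then show ?thesis unfolding proj_forms_def by force
qed

lemma homog_polys_coord:
  assumes "j < r"
  shows "(\<lambda>(x, u). u $ j) \<in> homog_polys n r 1"
  using assms by (auto simp: homog_polys_def intro: algebra_generated.gen)

lemma proj_forms_coord:
  assumes "j < r"
  shows "(\<lambda>(x, L). rep r L $ j) \<in> proj_forms n r 1"
  using homog_polys_coord[OF assms, of n] unfolding proj_forms_def
  by (intro CollectI exI[of _ "\<lambda>(x, u). u $ j"]) auto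

lemma line_smult:
  assumes "c \<noteq> 0"
  shows "line (c \<cdot>\<^sub>v u) = line u"
proof (intro equalityI subsetI)
  fix v assume "v \<in> line (c \<cdot>\<^sub>v u)"
  then obtain a where "v = (a * c) \<cdot>\<^sub>v u" by (auto simp: line_def smult_smult_assoc)
  then show "v \<in> line u" unfolding line_def by blast
next
  fix v assume "v \<in> line u"
  then obtain a where "v = a \<cdot>\<^sub>v u" by (auto simp: line_def)
  then have "v = (a / c) \<cdot>\<^sub>v (c \<cdot>\<^sub>v u)" using assms by (simp add: smult_smult_assoc)
  then show "v \<in> line (c \<cdot>\<^sub>v u)" unfolding line_def by blast
qed

lemma exists_minor_neq_if_line_neq:
  assumes u: "u \<in> carrier_vec r" "u \<noteq> 0\<^sub>v r" and v: "v \<in> carrier_vec r" "v \<noteq> 0\<^sub>v r"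
    and "line u \<noteq> line v"
  shows "\<exists>i<r. \<exists>j<r. u $ i * v $ j \<noteq> u $ j * v $ i"
proof (rule ccontr)
  assume "\<not> ?thesis"
  then have eq: "u $ i * v $ j = u $ j * v $ i" if "i < r" "j < r" for i j using that by blast
  obtain i where i: "i < r" "u $ i \<noteq> 0" using u by (metis carrier_vecD dim_vec eq_vecI index_zero_vec(1,2))
  have vi: "v $ i \<noteq> 0"
  proof
    assume "v $ i = 0"
    then have "v $ j = 0" if "j < r" for j using eq[OF i(1) that] i(2) by simp
    then have "v = 0\<^sub>v r" using v by (intro eq_vecI) auto
    then show False using v by simp
  qed
  define c where "c = v $ i / u $ i"
  have c: "c \<noteq> 0" "v = c \<cdot>\<^sub>v u"
    using i vi eq[OF i(1)] u v by (auto intro!: eq_vecI simp: c_def field_simps)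
  then have "line u = line v" using line_smult[of c u] by simp
  then show False using assms(5) by simp
qed

locale proj_subvariety =
  fixes n r :: nat and S :: "(complex vec \<times> complex vec set) set"
  assumes S: "S \<subseteq> carrier_vec n \<times> proj_space r"
begin

abbreviation V where "V \<equiv> subvariety (affine_proj_space n r) S"

sublocale graded_variety V S "proj_forms n r"
  by (rule graded_variety_subvariety[OF graded_variety_proj S])

text \<open>Points with different base are separated by a base coordinate, points of one fibre by a
  2 by 2 minor of their homogeneous coordinates.\<close>

lemma closedin_point:
  assumes "p \<in> S"
  shows "closedin (zar V) {p}"
  unfolding closedin_iff
proof (intro conjI ballI)
  fix q assume q: "q \<in> S - {p}"
  obtain x L where p: "p = (x, L)" by (cases p)
  obtain x' L' where q': "q = (x', L')" by (cases q)
  have L: "L \<in> proj_space r" "L' \<in> proj_space r" and x: "x \<in> carrier_vec n" "x' \<in> carrier_vec n"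
    using S assms q p q' by auto
  show "\<exists>d. \<exists>k\<in>proj_forms n r d. k q \<noteq> 0 \<and> (\<forall>q\<in>{p}. k q = 0)"
  proof (cases "x = x'")
    case False
    then obtain i where i: "i < n" "x $ i \<noteq> x' $ i" using x by (metis carrier_vecD eq_vecI)
    have "(\<lambda>z. z $ i - x $ i) \<in> polys n" using i by (intro polys_intros)
    from proj_forms_base[OF this] show ?thesis
      by (intro exI[of _ 0] bexI[of _ "\<lambda>(z, L). z $ i - x $ i"]) (use i in \<open>auto simp: p q'\<close>)
  next
    case True
    then have "line (rep r L) \<noteq> line (rep r L')" using q p q' rep_proj_space(4) L by auto
    then obtain i j where ij: "i < r" "j < r" "rep r L $ i * rep r L' $ j \<noteq> rep r L $ j * rep r L' $ i"
      using exists_minor_neq_if_line_neq rep_proj_space L by metis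
    define k where "k q = rep r L $ i * (case q of (x, L') \<Rightarrow> rep r L' $ j) -
        rep r L $ j * (case q of (x, L') \<Rightarrow> rep r L' $ i)" for q :: "complex vec \<times> complex vec set"
    have "k \<in> proj_forms n r 1" unfolding k_def using ij by (intro diff smult proj_forms_coord)
    then show ?thesis by (intro exI[of _ 1] bexI[of _ k]) (use ij in \<open>auto simp: p q' k_def\<close>)
  qed
qed (use assms in auto)

lemma parametrizationI:
  assumes "\<And>x. x \<in> carrier_vec m \<Longrightarrow> (y x, line (u x)) \<in> S"
    and "\<And>x. x \<in> carrier_vec m \<Longrightarrow> y x \<in> carrier_vec n \<and> u x \<in> carrier_vec r \<and> u x \<noteq> 0\<^sub>v r"
    and "\<And>i. i < n \<Longrightarrow> (\<lambda>x. y x $ i) \<in> polys m" "\<And>j. j < r \<Longrightarrow> (\<lambda>x. u x $ j) \<in> polys m"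
  shows "parametrization m (\<lambda>x. (y x, line (u x)))"
proof -
  have "\<exists>c. (\<forall>x. c x \<noteq> 0) \<and> (\<forall>d. \<forall>g\<in>proj_forms n r d. \<exists>G\<in>homog_polys n r d.
      \<forall>x\<in>carrier_vec m. c x ^ d * g (y x, line (u x)) = G (y x, u x))"
    by (rule proj_forms_rescale) (use assms(2) in auto)
  then obtain c where c: "(\<forall>x. c x \<noteq> 0) \<and> (\<forall>d. \<forall>g\<in>proj_forms n r d. \<exists>G\<in>homog_polys n r d.
      \<forall>x\<in>carrier_vec m. c x ^ d * g (y x, line (u x)) = G (y x, u x))" by (rule exE)
  show ?thesis
    unfolding parametrization_def
  proof (intro conjI ballI exI[of _ c] allI)
    fix d g assume "g \<in> proj_forms n r d"
    with c[THEN conjunct2] obtain G where G: "G \<in> homog_polys n r d"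
      "\<forall>x\<in>carrier_vec m. c x ^ d * g (y x, line (u x)) = G (y x, u x)" by blast
    then show "\<exists>f\<in>polys m. \<forall>x\<in>carrier_vec m. c x ^ d * g (y x, line (u x)) = f x"
      by (intro bexI[of _ "\<lambda>x. G (y x, u x)"] homog_polys_comp[OF G(1)]) (use assms(3,4) in auto)
  qed (use assms(1) c[THEN conjunct1] in auto)
qed

end

lemma topspace_zar_product: "topspace (zar_product X Y) = points X \<times> points Y"
proof
  show "topspace (zar_product X Y) \<subseteq> points X \<times> points Y"
    unfolding zar_product_def by (auto dest: openin_subset)
  have "points X \<times> points Y \<in> {{p \<in> U \<times> V. h p \<noteq> 0} | U V h. openin (zar X) U \<and> openin (zar Y) V \<and>
      h \<in> algebra_generated ({f \<circ> fst | f. f \<in> reg X U} \<union> {g \<circ> snd | g. g \<in> reg Y V})}"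
    by (intro CollectI exI[of _ "points X"] exI[of _ "points Y"] exI[of _ "\<lambda>_. 1"])
      (auto intro: algebra_generated.const)
  then show "points X \<times> points Y \<subseteq> topspace (zar_product X Y)"
    unfolding zar_product_def topology_generated_by_topspace by (rule Union_upper)
qed

lemma (in proj_subvariety) separated_fst: "separated_morphism V Y fst"
  unfolding separated_morphism_def closedin_def
proof
  let ?T = "zar_product V V" and ?R = "{(x, x'). fst x = fst x'} :: ((complex vec \<times> complex vec set) \<times> _) set"
  let ?D = "{(x, x) | x. x \<in> points V}"
  have top: "topspace (subtopology ?T ?R) = (S \<times> S) \<inter> ?R"
    by (simp add: topspace_zar_product points)
  show "?D \<subseteq> topspace (subtopology ?T ?R)" unfolding top points by auto
  show "openin (subtopology ?T ?R) (topspace (subtopology ?T ?R) - ?D)"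
    unfolding openin_subopen[of _ "topspace (subtopology ?T ?R) - ?D"]
  proof
    fix p assume p: "p \<in> topspace (subtopology ?T ?R) - ?D"
    then obtain x L L' where p_eq: "p = ((x, L), (x, L'))" and in_S: "(x, L) \<in> S" "(x, L') \<in> S" and "L \<noteq> L'"
      unfolding top points by force
    then have L: "L \<in> proj_space r" "L' \<in> proj_space r" using S by auto
    define co where "co j q = (case q of (x :: complex vec, L) \<Rightarrow> rep r L $ j)" for j q
    have co: "co j \<in> proj_forms n r 1" if "j < r" for j
      unfolding co_def using that by (rule proj_forms_coord)
    have "line (rep r L) \<noteq> line (rep r L')" using \<open>L \<noteq> L'\<close> rep_proj_space(4) L by auto
    then obtain i j where ij: "i < r" "j < r" "rep r L $ i * rep r L' $ j \<noteq> rep r L $ j * rep r L' $ i"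
      using exists_minor_neq_if_line_neq rep_proj_space L by metis
    have "\<exists>k<r. rep r L $ k \<noteq> 0" if "L \<in> proj_space r" for L
      using rep_proj_space(1,2)[OF that] by (metis carrier_vecD eq_vecI index_zero_vec(1,2))
    then obtain k l where kl: "k < r" "rep r L $ k \<noteq> 0" "l < r" "rep r L' $ l \<noteq> 0" using L by meson
    define U where "U = {q \<in> S. co k q \<noteq> 0}"
    define W where "W = {q \<in> S. co l q \<noteq> 0}"
    have U: "openin (zar V) U" and W: "openin (zar V) W"
      unfolding U_def W_def using co kl by (auto intro: openin_nonvanishing)
    have regU: "(\<lambda>q. co i q / co k q) \<in> reg V U" if "i < r" for i
      by (rule quotient_reg[OF U co[OF that] co[OF kl(1)]]) (auto simp: U_def)
    have regW: "(\<lambda>q. co i q / co l q) \<in> reg V W" if "i < r" for i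
      by (rule quotient_reg[OF W co[OF that] co[OF kl(3)]]) (auto simp: W_def)
    \<comment> \<open>The minor with indices \<open>i\<close> and \<open>j\<close> of the two fibre
      vectors, divided by the nonzero coordinates \<open>k\<close> and \<open>l\<close>, since only
      such quotients are regular on the factors. It vanishes on the diagonal and not at
      \<open>p\<close>.\<close>
    define h where "h q = ((\<lambda>q. co i q / co k q) \<circ> fst) q * ((\<lambda>q. co j q / co l q) \<circ> snd) q -
        ((\<lambda>q. co j q / co k q) \<circ> fst) q * ((\<lambda>q. co i q / co l q) \<circ> snd) q"
      for q :: "(complex vec \<times> complex vec set) \<times> (complex vec \<times> complex vec set)"
    define O' where "O' = {q \<in> U \<times> W. h q \<noteq> 0}"
    have h: "h \<in> algebra_generated ({f \<circ> fst | f. f \<in> reg V U} \<union> {g \<circ> snd | g. g \<in> reg V W})"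
      unfolding h_def
      by (intro algebra_generated_diff algebra_generated.mult algebra_generated.gen)
        (use regU[OF ij(1)] regU[OF ij(2)] regW[OF ij(1)] regW[OF ij(2)] in blast)+
    have "openin ?T O'"
      unfolding zar_product_def O'_def by (rule topology_generated_by_Basis) (use U W h in blast)
    then have "openin (subtopology ?T ?R) (O' \<inter> ?R)" by (auto simp: openin_subtopology)
    moreover have "p \<in> O' \<inter> ?R"
      using in_S kl ij(3) unfolding O'_def U_def W_def h_def p_eq co_def by (auto simp: field_simps)
    moreover have "O' \<inter> ?R \<subseteq> topspace (subtopology ?T ?R) - ?D"
      unfolding top points by (auto simp: O'_def U_def W_def h_def)
    ultimately show "\<exists>A. openin (subtopology ?T ?R) A \<and> p \<in> A \<and> A \<subseteq> topspace (subtopology ?T ?R) - ?D"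
      by blast
  qed
qed


section \<open>Equations of the blow-up\<close>

text \<open>On the blow-up the six minors are proportional to \<open>(s, t, w, -w, a t, 2 b t - c s)\<close>, in the order
  of the pairs of columns used by \<^const>\<open>minors\<close>, so it embeds into a bundle of conics
  \<open>w\<^sup>2 + a t\<^sup>2 - 2 b s t + c s\<^sup>2 = 0\<close>.\<close>

definition plucker :: "complex vec \<Rightarrow> complex \<Rightarrow> complex \<Rightarrow> complex \<Rightarrow> complex vec" where
  "plucker y s t w = vec_of_list [s, t, w, - w, y $ 0 * t, 2 * y $ 1 * t - y $ 2 * s]"

text \<open>Reading \<open>plucker y s t w\<close> as the six minors of a plane in 4-space, the
  linear equations say that this plane contains the second row \<open>(T, Z, Y, X - b T)\<close> of
  \<open>M\<close>: they expand the 3 by 3 minors of the plane with this row added. The quadratic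
  equation is the Pluecker relation up to sign.\<close>

definition incidence :: "complex vec \<Rightarrow> complex \<Rightarrow> complex \<Rightarrow> complex \<Rightarrow> bool" where
  "incidence y s t w \<longleftrightarrow> (let a = y $ 0; b = y $ 1; c = y $ 2; X = y $ 3; Y = y $ 4; Z = y $ 5; T = y $ 6 in
    Y * s - Z * t - T * w = 0 \<and>
    (X - b * T) * s - Z * w + a * T * t = 0 \<and>
    T * (2 * b * t - c * s) - Y * w + (X - b * T) * t = 0 \<and>
    Z * (2 * b * t - c * s) - a * Y * t - (X - b * T) * w = 0 \<and>
    w^2 + a * t^2 - 2 * b * s * t + c * s^2 = 0)"

text \<open>Requiring \<open>(s, t)\<close> to be nonzero amounts to requiring a nonzero vector,
  because the conic forces \<open>w = 0\<close> when \<open>s = t = 0\<close>.\<close>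

definition small_space :: "(complex vec \<times> complex vec set) set" where
  "small_space = {(y, line (plucker y s t w)) | y s t w.
    y \<in> carrier_vec 7 \<and> (s \<noteq> 0 \<or> t \<noteq> 0) \<and> incidence y s t w}"

text \<open>With columns counted from 0, these three are the minors of \<open>M\<close> in columns 0
  and 1, 0 and 2, 0 and 3.\<close>

definition p1 where "p1 y = (y $ 5)^2 + y $ 0 * (y $ 6)^2" for y :: "complex vec"
definition p2 where "p2 y = y $ 5 * y $ 4 - (y $ 3 - y $ 1 * y $ 6) * y $ 6" for y :: "complex vec"
definition p3 where "p3 y = y $ 5 * (y $ 3 - y $ 1 * y $ 6) + y $ 0 * y $ 4 * y $ 6" for y :: "complex vec"

text \<open>On the blow-up \<open>(s, t, w)\<close> is proportional to \<open>(p1, p2, p3)\<close> and to \<open>(q1, q2, q3)\<close>, so the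
  projection is an isomorphism wherever one of these triples does not vanish.\<close>

definition q1 where "q1 y = y $ 5 * y $ 4 + y $ 6 * (y $ 3 + y $ 1 * y $ 6)" for y :: "complex vec"
definition q2 where "q2 y = y $ 2 * (y $ 6)^2 + (y $ 4)^2" for y :: "complex vec"
definition q3 where "q3 y = y $ 4 * (y $ 3 + y $ 1 * y $ 6) - y $ 2 * y $ 6 * y $ 5" for y :: "complex vec"

lemma dim_plucker [simp]: "plucker y s t w \<in> carrier_vec 6" "dim_vec (plucker y s t w) = 6"
  unfolding plucker_def carrier_vec_def by (simp_all del: vec_of_list_Cons)

lemma plucker_nth [simp]:
  "plucker y s t w $ 0 = s" "plucker y s t w $ Suc 0 = t" "plucker y s t w $ 1 = t" "plucker y s t w $ 2 = w"
  "plucker y s t w $ 3 = - w" "plucker y s t w $ 4 = y $ 0 * t"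
  "plucker y s t w $ 5 = 2 * y $ 1 * t - y $ 2 * s"
  unfolding plucker_def by (simp_all add: vec_of_list_index del: vec_of_list_Cons)

lemma less_6: "(i :: nat) < 6 \<longleftrightarrow> i = 0 \<or> i = 1 \<or> i = 2 \<or> i = 3 \<or> i = 4 \<or> i = 5" by auto

lemma less_7: "(i :: nat) < 7 \<longleftrightarrow> i = 0 \<or> i = 1 \<or> i = 2 \<or> i = 3 \<or> i = 4 \<or> i = 5 \<or> i = 6" by auto

lemma plucker_smult: "plucker y (c * s) (c * t) (c * w) = c \<cdot>\<^sub>v plucker y s t w"
  by (intro eq_vecI) (auto simp: less_6 algebra_simps)

lemma incidence_smult:
  assumes "c \<noteq> 0"
  shows "incidence y (c * s) (c * t) (c * w) \<longleftrightarrow> incidence y s t w"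
proof -
  have *: "incidence y (c * s) (c * t) (c * w)" if "incidence y s t w" for c s t w
  proof -
    note h = that[unfolded incidence_def Let_def]
    show ?thesis
      unfolding incidence_def Let_def
    proof (intro conjI)
      show "y $ 4 * (c * s) - y $ 5 * (c * t) - y $ 6 * (c * w) = 0"
        using arg_cong[OF conjunct1[OF h], of "\<lambda>x. c * x"] by (simp add: algebra_simps)
      show "(y $ 3 - y $ 1 * y $ 6) * (c * s) - y $ 5 * (c * w) + y $ 0 * y $ 6 * (c * t) = 0"
        using arg_cong[OF conjunct1[OF conjunct2[OF h]], of "\<lambda>x. c * x"] by (simp add: algebra_simps)
      show "y $ 6 * (2 * y $ 1 * (c * t) - y $ 2 * (c * s)) - y $ 4 * (c * w) + (y $ 3 - y $ 1 * y $ 6) * (c * t) = 0"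
        using arg_cong[OF conjunct1[OF conjunct2[OF conjunct2[OF h]]], of "\<lambda>x. c * x"] by (simp add: algebra_simps)
      show "y $ 5 * (2 * y $ 1 * (c * t) - y $ 2 * (c * s)) - y $ 0 * y $ 4 * (c * t) - (y $ 3 - y $ 1 * y $ 6) * (c * w) = 0"
        using arg_cong[OF conjunct1[OF conjunct2[OF conjunct2[OF conjunct2[OF h]]]], of "\<lambda>x. c * x"]
        by (simp add: algebra_simps)
      show "(c * w)^2 + y $ 0 * (c * t)^2 - 2 * y $ 1 * (c * s) * (c * t) + y $ 2 * (c * s)^2 = 0"
        using arg_cong[OF conjunct2[OF conjunct2[OF conjunct2[OF conjunct2[OF h]]]], of "\<lambda>x. c^2 * x"]
        by (simp add: algebra_simps power2_eq_square)
    qed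
  qed
  show ?thesis using *[of s t w c] *[of "c * s" "c * t" "c * w" "1 / c"] assms by auto
qed

text \<open>The first, second and last equations are solved for \<open>Y\<close>, \<open>X\<close>
  and \<open>c\<close>; the other two then follow by substitution.\<close>

lemma incidence_1:
  "incidence y 1 t w \<longleftrightarrow> y $ 4 = y $ 6 * w + y $ 5 * t \<and>
    y $ 3 = y $ 1 * y $ 6 + y $ 5 * w - y $ 0 * y $ 6 * t \<and> y $ 2 = 2 * y $ 1 * t - y $ 0 * t^2 - w^2"
  (is "?l \<longleftrightarrow> ?r")
proof
  assume ?l then show ?r unfolding incidence_def Let_def by (auto simp: algebra_simps)
next
  assume ?r
  then have *: "y $ 4 = y $ 6 * w + y $ 5 * t" "y $ 3 = y $ 1 * y $ 6 + y $ 5 * w - y $ 0 * y $ 6 * t"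
    "y $ 2 = 2 * y $ 1 * t - y $ 0 * t^2 - w^2" by auto
  show ?l unfolding incidence_def Let_def * by (simp add: algebra_simps power2_eq_square)
qed

text \<open>Mirror image of \<open>incidence_1\<close>: here the first, third and last equations are
  solved for \<open>Z\<close>, \<open>X\<close> and \<open>a\<close>.\<close>

lemma incidence_t_1:
  "incidence y s 1 w \<longleftrightarrow> y $ 5 = y $ 4 * s - y $ 6 * w \<and>
    y $ 3 = y $ 4 * w + y $ 2 * s * y $ 6 - y $ 1 * y $ 6 \<and> y $ 0 = 2 * y $ 1 * s - y $ 2 * s^2 - w^2"
  (is "?l \<longleftrightarrow> ?r")
proof
  assume l: ?l
  then have "y $ 5 = y $ 4 * s - y $ 6 * w" "y $ 0 = 2 * y $ 1 * s - y $ 2 * s^2 - w^2"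
    unfolding incidence_def Let_def by (auto simp: algebra_simps)
  moreover have "y $ 3 = y $ 4 * w + y $ 2 * s * y $ 6 - y $ 1 * y $ 6"
    using l unfolding incidence_def Let_def by (auto simp: algebra_simps)
  ultimately show ?r by blast
next
  assume ?r
  then have *: "y $ 5 = y $ 4 * s - y $ 6 * w" "y $ 3 = y $ 4 * w + y $ 2 * s * y $ 6 - y $ 1 * y $ 6"
    "y $ 0 = 2 * y $ 1 * s - y $ 2 * s^2 - w^2" by auto
  show ?l unfolding incidence_def Let_def * by (simp add: algebra_simps power2_eq_square)
qed

lemma small_space_cases:
  assumes "p \<in> small_space"
  obtains (s) y t w where "y \<in> carrier_vec 7" "p = (y, line (plucker y 1 t w))" "incidence y 1 t w"
  | (t) y w where "y \<in> carrier_vec 7" "p = (y, line (plucker y 0 1 w))" "incidence y 0 1 w"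
proof -
  obtain y s t w where *: "y \<in> carrier_vec 7" "p = (y, line (plucker y s t w))" "s \<noteq> 0 \<or> t \<noteq> 0"
    "incidence y s t w" using assms by (auto simp: small_space_def)
  show ?thesis
  proof (cases "s = 0")
    case False
    then show ?thesis
      using that(1)[of y "t / s" "w / s"] * incidence_smult[of s y 1 "t / s" "w / s"]
        plucker_smult[of y s 1 "t / s" "w / s"] line_smult[of s "plucker y 1 (t / s) (w / s)"] by auto
  next
    case True
    then show ?thesis
      using that(2)[of y "w / t"] * incidence_smult[of t y 0 1 "w / t"]
        plucker_smult[of y t 0 1 "w / t"] line_smult[of t "plucker y 0 1 (w / t)"] by auto
  qed
qed

lemma F_explicit: "F v = (v$3)^2 + (v$0 * v$2 - (v$1)^2) * (v$6)^2 + v$0 * (v$4)^2 - 2 * v$1 * v$4 * v$5 + v$2 * (v$5)^2"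
  by (simp add: F_def Let_def)

lemma small_space_base:
  assumes "(y, L) \<in> small_space"
  shows "y \<in> hypersurface"
  using assms
proof (cases rule: small_space_cases)
  case (s z t w)
  from s(3) have *: "z $ 4 = z $ 6 * w + z $ 5 * t" "z $ 3 = z $ 1 * z $ 6 + z $ 5 * w - z $ 0 * z $ 6 * t"
    "z $ 2 = 2 * z $ 1 * t - z $ 0 * t^2 - w^2" unfolding incidence_1 by auto
  have "F z = 0" unfolding F_explicit * by (simp add: algebra_simps power2_eq_square)
  then show ?thesis using s by (simp add: hypersurface_def)
next
  case (t z w)
  from t(3) have *: "z $ 5 = z $ 4 * 0 - z $ 6 * w" "z $ 3 = z $ 4 * w + z $ 2 * 0 * z $ 6 - z $ 1 * z $ 6"
    "z $ 0 = 2 * z $ 1 * 0 - z $ 2 * 0^2 - w^2" unfolding incidence_t_1 by auto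
  have "F z = 0" unfolding F_explicit * by (simp add: algebra_simps power2_eq_square)
  then show ?thesis using t by (simp add: hypersurface_def)
qed

text \<open>For the true minors the relations are polynomial identities. The last entry
  \<open>2 b t - c s\<close> agrees with the sixth minor only up to \<open>F\<close>, so three
  residuals are multiples of \<open>F\<close>, with factors \<open>- T\<close>, \<open>- Z\<close>
  and \<open>p1\<close>.\<close>

lemma incidence_p:
  assumes "F y = 0"
  shows "incidence y (p1 y) (p2 y) (p3 y)"
proof -
  have "X^2 + (a * c - b^2) * T^2 + a * Y^2 - 2 * b * Y * Z + c * Z^2 = 0 \<Longrightarrow>
      s = Z^2 + a * T^2 \<Longrightarrow> t = Z * Y - (X - b * T) * T \<Longrightarrow> w = Z * (X - b * T) + a * Y * T \<Longrightarrow>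
      Y * s - Z * t - T * w = 0 \<and> (X - b * T) * s - Z * w + a * T * t = 0 \<and>
      T * (2 * b * t - c * s) - Y * w + (X - b * T) * t = 0 \<and>
      Z * (2 * b * t - c * s) - a * Y * t - (X - b * T) * w = 0 \<and>
      w^2 + a * t^2 - 2 * b * s * t + c * s^2 = 0" for a b c X Y Z T s t w :: complex
  proof (intro conjI)
    assume F: "X^2 + (a * c - b^2) * T^2 + a * Y^2 - 2 * b * Y * Z + c * Z^2 = 0"
      and s: "s = Z^2 + a * T^2" and t: "t = Z * Y - (X - b * T) * T" and w: "w = Z * (X - b * T) + a * Y * T"
    show "Y * s - Z * t - T * w = 0" "(X - b * T) * s - Z * w + a * T * t = 0"
      unfolding s t w by (simp_all add: algebra_simps power2_eq_square)
    have "T * (2 * b * t - c * s) - Y * w + (X - b * T) * t =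
        - T * (X^2 + (a * c - b^2) * T^2 + a * Y^2 - 2 * b * Y * Z + c * Z^2)"
      unfolding s t w by (simp add: algebra_simps power2_eq_square)
    then show "T * (2 * b * t - c * s) - Y * w + (X - b * T) * t = 0" using F by simp
    have "Z * (2 * b * t - c * s) - a * Y * t - (X - b * T) * w =
        - Z * (X^2 + (a * c - b^2) * T^2 + a * Y^2 - 2 * b * Y * Z + c * Z^2)"
      unfolding s t w by (simp add: algebra_simps power2_eq_square)
    then show "Z * (2 * b * t - c * s) - a * Y * t - (X - b * T) * w = 0" using F by simp
    have "w^2 + a * t^2 - 2 * b * s * t + c * s^2 =
        (Z^2 + a * T^2) * (X^2 + (a * c - b^2) * T^2 + a * Y^2 - 2 * b * Y * Z + c * Z^2)"
      unfolding s t w by (simp add: algebra_simps power2_eq_square)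
    then show "w^2 + a * t^2 - 2 * b * s * t + c * s^2 = 0" using F by simp
  qed
  from this[OF assms[unfolded F_explicit] refl refl refl] show ?thesis
    unfolding incidence_def Let_def p1_def p2_def p3_def .
qed

text \<open>Mirror image of \<open>incidence_p\<close>: exchanging \<open>a\<close> with
  \<open>c\<close> and \<open>Y\<close> with \<open>Z\<close> and changing the sign of
  \<open>X\<close> takes the triple \<open>(p1, p2, p3)\<close> to \<open>(q2, q1, - q3)\<close>,
  and the incidence equations keep their solutions when \<open>(s, t, w)\<close> becomes
  \<open>(t, s, - w)\<close>.\<close>

lemma incidence_q:
  assumes "F y = 0"
  shows "incidence y (q1 y) (q2 y) (q3 y)"
proof -
  have "X^2 + (a * c - b^2) * T^2 + a * Y^2 - 2 * b * Y * Z + c * Z^2 = 0 \<Longrightarrow>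
      s = Z * Y + T * (X + b * T) \<Longrightarrow> t = c * T^2 + Y^2 \<Longrightarrow> w = Y * (X + b * T) - c * T * Z \<Longrightarrow>
      Y * s - Z * t - T * w = 0 \<and> (X - b * T) * s - Z * w + a * T * t = 0 \<and>
      T * (2 * b * t - c * s) - Y * w + (X - b * T) * t = 0 \<and>
      Z * (2 * b * t - c * s) - a * Y * t - (X - b * T) * w = 0 \<and>
      w^2 + a * t^2 - 2 * b * s * t + c * s^2 = 0" for a b c X Y Z T s t w :: complex
  proof (intro conjI)
    assume F: "X^2 + (a * c - b^2) * T^2 + a * Y^2 - 2 * b * Y * Z + c * Z^2 = 0"
      and s: "s = Z * Y + T * (X + b * T)" and t: "t = c * T^2 + Y^2" and w: "w = Y * (X + b * T) - c * T * Z"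
    show "Y * s - Z * t - T * w = 0" unfolding s t w by (simp add: algebra_simps power2_eq_square)
    have "(X - b * T) * s - Z * w + a * T * t =
        T * (X^2 + (a * c - b^2) * T^2 + a * Y^2 - 2 * b * Y * Z + c * Z^2)"
      unfolding s t w by (simp add: algebra_simps power2_eq_square)
    then show "(X - b * T) * s - Z * w + a * T * t = 0" using F by simp
    show "T * (2 * b * t - c * s) - Y * w + (X - b * T) * t = 0"
      unfolding s t w by (simp add: algebra_simps power2_eq_square)
    have "Z * (2 * b * t - c * s) - a * Y * t - (X - b * T) * w =
        - Y * (X^2 + (a * c - b^2) * T^2 + a * Y^2 - 2 * b * Y * Z + c * Z^2)"
      unfolding s t w by (simp add: algebra_simps power2_eq_square)
    then show "Z * (2 * b * t - c * s) - a * Y * t - (X - b * T) * w = 0" using F by simp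
    have "w^2 + a * t^2 - 2 * b * s * t + c * s^2 =
        (c * T^2 + Y^2) * (X^2 + (a * c - b^2) * T^2 + a * Y^2 - 2 * b * Y * Z + c * Z^2)"
      unfolding s t w by (simp add: algebra_simps power2_eq_square)
    then show "w^2 + a * t^2 - 2 * b * s * t + c * s^2 = 0" using F by simp
  qed
  from this[OF assms[unfolded F_explicit] refl refl refl] show ?thesis
    unfolding incidence_def Let_def q1_def q2_def q3_def .
qed

lemma p_proportional_1:
  assumes "incidence y 1 t w"
  shows "p2 y = p1 y * t" "p3 y = p1 y * w"
proof -
  from assms have *: "y $ 4 = y $ 6 * w + y $ 5 * t"
    "y $ 3 = y $ 1 * y $ 6 + y $ 5 * w - y $ 0 * y $ 6 * t"
    "y $ 2 = 2 * y $ 1 * t - y $ 0 * t^2 - w^2"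
    unfolding incidence_1 by auto
  show "p2 y = p1 y * t" "p3 y = p1 y * w"
    unfolding p1_def p2_def p3_def * by (simp_all add: power2_eq_square algebra_simps)
qed

lemma p_proportional_t_1:
  assumes "incidence y s 1 w"
  shows "p1 y = p2 y * s" "p3 y = p2 y * w"
proof -
  from assms have *: "y $ 5 = y $ 4 * s - y $ 6 * w"
    "y $ 3 = y $ 4 * w + y $ 2 * s * y $ 6 - y $ 1 * y $ 6"
    "y $ 0 = 2 * y $ 1 * s - y $ 2 * s^2 - w^2"
    unfolding incidence_t_1 by auto
  show "p1 y = p2 y * s" "p3 y = p2 y * w"
    unfolding p1_def p2_def p3_def * by (simp_all add: power2_eq_square algebra_simps)
qed

lemma q_proportional_1:
  assumes "incidence y 1 t w"
  shows "q2 y = q1 y * t" "q3 y = q1 y * w"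
proof -
  from assms have *: "y $ 4 = y $ 6 * w + y $ 5 * t"
    "y $ 3 = y $ 1 * y $ 6 + y $ 5 * w - y $ 0 * y $ 6 * t"
    "y $ 2 = 2 * y $ 1 * t - y $ 0 * t^2 - w^2"
    unfolding incidence_1 by auto
  show "q2 y = q1 y * t" "q3 y = q1 y * w"
    unfolding q1_def q2_def q3_def * by (simp_all add: power2_eq_square algebra_simps)
qed

lemma q_proportional_t_1:
  assumes "incidence y s 1 w"
  shows "q1 y = q2 y * s" "q3 y = q2 y * w"
proof -
  from assms have *: "y $ 5 = y $ 4 * s - y $ 6 * w"
    "y $ 3 = y $ 4 * w + y $ 2 * s * y $ 6 - y $ 1 * y $ 6"
    "y $ 0 = 2 * y $ 1 * s - y $ 2 * s^2 - w^2"
    unfolding incidence_t_1 by auto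
  show "q1 y = q2 y * s" "q3 y = q2 y * w"
    unfolding q1_def q2_def q3_def * by (simp_all add: power2_eq_square algebra_simps)
qed

section \<open>The six minors on the hypersurface\<close>

lemma det_2x2:
  fixes A :: "'a :: comm_ring_1 mat"
  assumes A: "A \<in> carrier_mat 2 2"
  shows "det A = A $$ (0, 0) * A $$ (1, 1) - A $$ (0, 1) * A $$ (1, 0)"
proof -
  have D: "mat_delete A 0 j \<in> carrier_mat 1 1" for j using A by (auto simp: mat_delete_def)
  have "det (mat_delete A 0 j) = mat_delete A 0 j $$ (0, 0)" for j using det_single[OF D] .
  then show ?thesis
    using A unfolding laplace_expansion_row[OF A, of 0, simplified]
    by (simp add: cofactor_def mat_delete_def numeral_2_eq_2)
qed

lemma minor2_eq:
  assumes "i < 4" "j < 4"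
  shows "minor2 i j v = M v $$ (0, i) * M v $$ (1, j) - M v $$ (0, j) * M v $$ (1, i)"
proof -
  have M: "M v \<in> carrier_mat 2 4" by (auto simp: M_def Let_def mat_of_rows_list_def)
  then show ?thesis
    using assms unfolding minor2_def by (subst det_2x2) (auto simp: mat_of_cols_def)
qed

lemma minors_plucker:
  assumes "F y = 0"
  shows "vec_of_list (map (\<lambda>g. g y) minors) = plucker y (p1 y) (p2 y) (p3 y)"
proof -
  have M: "M y $$ (0, 0) = y $ 5" "M y $$ (0, Suc 0) = - y $ 0 * y $ 6" "M y $$ (0, 2) = y $ 3 - y $ 1 * y $ 6"
    "M y $$ (0, 3) = - y $ 0 * y $ 4" "M y $$ (Suc 0, 0) = y $ 6" "M y $$ (Suc 0, Suc 0) = y $ 5"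
    "M y $$ (Suc 0, 2) = y $ 4" "M y $$ (Suc 0, 3) = y $ 3 - y $ 1 * y $ 6"
    by (simp_all add: M_def Let_def mat_of_rows_list_def numeral_2_eq_2 numeral_3_eq_3)
  have minors: "minors = [minor2 0 1, minor2 0 2, minor2 0 3, minor2 1 2, minor2 1 3, minor2 2 3]"
    by (simp add: minors_def upt_rec numeral_2_eq_2 numeral_3_eq_3)
  have eq: "map (\<lambda>g. g y) minors = [p1 y, p2 y, p3 y, - p3 y, y $ 0 * p2 y,
      (y $ 3 - y $ 1 * y $ 6)^2 + y $ 0 * (y $ 4)^2]"
    unfolding minors by (simp add: minor2_eq M p1_def p2_def p3_def power2_eq_square algebra_simps)
  \<comment> \<open>The only place where the equation of the hypersurface enters: the other five
    minors have the required shape identically.\<close>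
  have "(y $ 3 - y $ 1 * y $ 6)^2 + y $ 0 * (y $ 4)^2 = 2 * y $ 1 * p2 y - y $ 2 * p1 y + F y"
    unfolding F_explicit p1_def p2_def p3_def by (simp add: algebra_simps power2_eq_square)
  then have "(y $ 3 - y $ 1 * y $ 6)^2 + y $ 0 * (y $ 4)^2 = 2 * y $ 1 * p2 y - y $ 2 * p1 y"
    using assms by simp
  then show ?thesis unfolding eq plucker_def by simp
qed


section \<open>The incidence equations define a closed set\<close>

abbreviation "proj_gens n r \<equiv>
  {\<lambda>(x, u). x $ i | i. i < n} \<union> {\<lambda>(x, u). u $ j | j. j < r} :: (complex vec \<times> complex vec \<Rightarrow> complex) set"

lemma proj_gens_fst: "i < n \<Longrightarrow> (\<lambda>p. fst p $ i) \<in> algebra_generated (proj_gens n r)"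
  by (intro algebra_generated.gen UnI1 CollectI exI[of _ i]) auto

lemma proj_gens_snd: "j < r \<Longrightarrow> (\<lambda>p. snd p $ j) \<in> algebra_generated (proj_gens n r)"
  by (intro algebra_generated.gen UnI2 CollectI exI[of _ j]) auto

lemmas proj_gens_intros = algebra_generated_diff algebra_generated.add algebra_generated.mult
  algebra_generated_power algebra_generated.const proj_gens_fst proj_gens_snd

lemma proj_formsI:
  assumes "G \<in> algebra_generated (proj_gens n r)"
    and "\<And>x u c. x \<in> carrier_vec n \<Longrightarrow> u \<in> carrier_vec r \<Longrightarrow> G (x, c \<cdot>\<^sub>v u) = c ^ d * G (x, u)"
  shows "(\<lambda>p. G (fst p, rep r (snd p))) \<in> proj_forms n r d"
  unfolding proj_forms_def using assms by (intro CollectI exI[of _ G]) (auto simp: homog_polys_def)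

lemma plucker_neq_0: "s \<noteq> 0 \<or> t \<noteq> 0 \<Longrightarrow> plucker y s t w \<noteq> 0\<^sub>v 6"
  by (metis index_zero_vec(1) plucker_nth(1,2) less_6 One_nat_def)

lemma line_plucker_proj: "s \<noteq> 0 \<or> t \<noteq> 0 \<Longrightarrow> line (plucker y s t w) \<in> proj_space 6"
  unfolding proj_space_def using plucker_neq_0[of s t y w] by (auto intro!: exI[of _ "plucker y s t w"])

interpretation E: proj_subvariety 7 6 small_space
  by unfold_locales (auto simp: small_space_def intro: line_plucker_proj)

lemma small_space_rep:
  assumes "(y, L) \<in> small_space"
  shows "\<exists>s t w. rep 6 L = plucker y s t w \<and> L = line (plucker y s t w) \<and> (s \<noteq> 0 \<or> t \<noteq> 0) \<and>
    incidence y s t w \<and> y \<in> carrier_vec 7"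
proof -
  obtain s t w where *: "L = line (plucker y s t w)" "s \<noteq> 0 \<or> t \<noteq> 0" "incidence y s t w" "y \<in> carrier_vec 7"
    using assms by (auto simp: small_space_def)
  obtain c where c: "c \<noteq> 0" "rep 6 L = c \<cdot>\<^sub>v plucker y s t w"
    using rep_line[OF dim_plucker(1) plucker_neq_0[OF *(2)], of y w] *(1) by auto
  have "rep 6 L = plucker y (c * s) (c * t) (c * w)" "L = line (plucker y (c * s) (c * t) (c * w))"
    using c * plucker_smult line_smult by simp_all
  moreover have "c * s \<noteq> 0 \<or> c * t \<noteq> 0" "incidence y (c * s) (c * t) (c * w)"
    using c(1) *(2,3) incidence_smult by simp_all
  ultimately show ?thesis using *(4) by blast
qed

lemma small_spaceI:
  "y \<in> carrier_vec 7 \<Longrightarrow> s \<noteq> 0 \<or> t \<noteq> 0 \<Longrightarrow> incidence y s t w \<Longrightarrow> (y, line (plucker y s t w)) \<in> small_space"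
  unfolding small_space_def by blast

text \<open>A point that no form separates from \<open>small_space\<close> satisfies every
  homogeneous equation valid there; applied to the defining equations, this puts the point into
  \<open>small_space\<close>.\<close>

lemma closedin_small_space: "closedin (zar (affine_proj_space 7 6)) small_space"
  unfolding graded_variety.closedin_iff[OF graded_variety_proj]
proof (intro conjI ballI, rule E.S, rule ccontr)
  fix p assume p: "p \<in> carrier_vec 7 \<times> proj_space 6 - small_space"
    and none: "\<not> (\<exists>d. \<exists>k\<in>proj_forms 7 6 d. k p \<noteq> 0 \<and> (\<forall>q\<in>small_space. k q = 0))"
  obtain y L where p_eq: "p = (y, L)" by (cases p)
  define u where "u = rep 6 L"
  have L: "L \<in> proj_space 6" and y: "y \<in> carrier_vec 7" using p p_eq by auto
  have u: "u \<in> carrier_vec 6" "u \<noteq> 0\<^sub>v 6" "L = line u" unfolding u_def using rep_proj_space L by auto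
  have *: "G (y, u) = 0" if G: "G \<in> algebra_generated (proj_gens 7 6)"
      "\<And>x u c. x \<in> carrier_vec 7 \<Longrightarrow> u \<in> carrier_vec 6 \<Longrightarrow> G (x, c \<cdot>\<^sub>v u) = c ^ d * G (x, u)"
      "\<And>y s t w. incidence y s t w \<Longrightarrow> G (y, plucker y s t w) = 0" for G d
  proof -
    have form: "(\<lambda>p. G (fst p, rep 6 (snd p))) \<in> proj_forms 7 6 d" using G(1,2) by (rule proj_formsI)
    have zero: "\<forall>q\<in>small_space. G (fst q, rep 6 (snd q)) = 0"
    proof
      fix q assume "q \<in> small_space"
      then obtain s t w where "rep 6 (snd q) = plucker (fst q) s t w" "incidence (fst q) s t w"
        using small_space_rep[of "fst q" "snd q"] by auto
      then show "G (fst q, rep 6 (snd q)) = 0" using G(3) by simp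
    qed
    have "G (fst p, rep 6 (snd p)) = 0"
    proof (rule ccontr)
      assume "G (fst p, rep 6 (snd p)) \<noteq> 0"
      then have "\<exists>d. \<exists>k\<in>proj_forms 7 6 d. k p \<noteq> 0 \<and> (\<forall>q\<in>small_space. k q = 0)"
        by (intro exI[of _ d] bexI[OF _ form] conjI zero)
      then show False using none by contradiction
    qed
    then show ?thesis by (simp add: p_eq u_def)
  qed
  \<comment> \<open>Three forms express that \<open>u\<close> has the shape of a
    \<open>plucker\<close> vector; the five after them are the equations of
    \<open>incidence\<close>.\<close>
  have 1: "snd (y, u) $ 3 + snd (y, u) $ 2 = 0"
    by (rule *[where d = 1]) ((intro proj_gens_intros; simp), simp_all add: algebra_simps)
  have 2: "snd (y, u) $ 4 - fst (y, u) $ 0 * snd (y, u) $ 1 = 0"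
    by (rule *[where d = 1]) ((intro proj_gens_intros; simp), simp_all add: algebra_simps)
  have 3: "snd (y, u) $ 5 - 2 * fst (y, u) $ 1 * snd (y, u) $ 1 + fst (y, u) $ 2 * snd (y, u) $ 0 = 0"
    by (rule *[where d = 1]) ((intro proj_gens_intros; simp), simp_all add: algebra_simps)
  have u_eq: "u = plucker y (u $ 0) (u $ 1) (u $ 2)"
    using u(1) 1 2 3 by (intro eq_vecI) (auto simp: less_6 add_eq_0_iff2 algebra_simps)
  have 4: "fst (y, u) $ 4 * snd (y, u) $ 0 - fst (y, u) $ 5 * snd (y, u) $ 1 - fst (y, u) $ 6 * snd (y, u) $ 2 = 0"
    by (rule *[where d = 1]) ((intro proj_gens_intros; simp), simp_all add: algebra_simps incidence_def Let_def)
  have 5: "(fst (y, u) $ 3 - fst (y, u) $ 1 * fst (y, u) $ 6) * snd (y, u) $ 0 - fst (y, u) $ 5 * snd (y, u) $ 2 +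
      fst (y, u) $ 0 * fst (y, u) $ 6 * snd (y, u) $ 1 = 0"
    by (rule *[where d = 1]) ((intro proj_gens_intros; simp), simp_all add: algebra_simps incidence_def Let_def)
  have 6: "fst (y, u) $ 6 * (2 * fst (y, u) $ 1 * snd (y, u) $ 1 - fst (y, u) $ 2 * snd (y, u) $ 0) -
      fst (y, u) $ 4 * snd (y, u) $ 2 + (fst (y, u) $ 3 - fst (y, u) $ 1 * fst (y, u) $ 6) * snd (y, u) $ 1 = 0"
    by (rule *[where d = 1]) ((intro proj_gens_intros; simp), simp_all add: algebra_simps incidence_def Let_def)
  have 7: "fst (y, u) $ 5 * (2 * fst (y, u) $ 1 * snd (y, u) $ 1 - fst (y, u) $ 2 * snd (y, u) $ 0) -
      fst (y, u) $ 0 * fst (y, u) $ 4 * snd (y, u) $ 1 - (fst (y, u) $ 3 - fst (y, u) $ 1 * fst (y, u) $ 6) * snd (y, u) $ 2 = 0"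
    by (rule *[where d = 1]) ((intro proj_gens_intros; simp), simp_all add: algebra_simps incidence_def Let_def)
  have 8: "(snd (y, u) $ 2)^2 + fst (y, u) $ 0 * (snd (y, u) $ 1)^2 - 2 * fst (y, u) $ 1 * snd (y, u) $ 0 * snd (y, u) $ 1 +
      fst (y, u) $ 2 * (snd (y, u) $ 0)^2 = 0"
    by (rule *[where d = 2]) ((intro proj_gens_intros; simp), simp_all add: algebra_simps incidence_def Let_def power2_eq_square)
  have "incidence y (u $ 0) (u $ 1) (u $ 2)"
    unfolding incidence_def Let_def using 4 5 6 7 8 by simp
  moreover have "u $ 0 \<noteq> 0 \<or> u $ 1 \<noteq> 0"
  proof (rule ccontr)
    assume a: "\<not> ?thesis"
    then have "u $ 2 = 0" using 8 by simp
    then have "u = plucker y 0 0 0" using u_eq a by simp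
    also have "\<dots> = 0\<^sub>v 6" by (intro eq_vecI) (auto simp: less_6)
    finally show False using u(2) by simp
  qed
  ultimately have "(y, line (plucker y (u $ 0) (u $ 1) (u $ 2))) \<in> small_space" using y by (intro small_spaceI)
  then show False using p p_eq u(3) u_eq by simp
qed

section \<open>The two affine charts and smoothness\<close>

definition base_s :: "complex vec \<Rightarrow> complex vec" where
  "base_s x = vec_of_list [x $ 0, x $ 1, 2 * x $ 1 * x $ 4 - x $ 0 * (x $ 4)^2 - (x $ 5)^2,
    x $ 1 * x $ 3 + x $ 2 * x $ 5 - x $ 0 * x $ 3 * x $ 4, x $ 3 * x $ 5 + x $ 2 * x $ 4, x $ 2, x $ 3]"

definition base_t :: "complex vec \<Rightarrow> complex vec" where
  "base_t x = vec_of_list [2 * x $ 0 * x $ 4 - x $ 1 * (x $ 4)^2 - (x $ 5)^2, x $ 0, x $ 1,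
    x $ 2 * x $ 5 + x $ 1 * x $ 4 * x $ 3 - x $ 0 * x $ 3, x $ 2, x $ 2 * x $ 4 - x $ 3 * x $ 5, x $ 3]"

lemma base_dim [simp]: "base_s x \<in> carrier_vec 7" "dim_vec (base_s x) = 7"
  "base_t x \<in> carrier_vec 7" "dim_vec (base_t x) = 7"
  unfolding base_s_def base_t_def carrier_vec_def by (simp_all del: vec_of_list_Cons)

lemma base_s_nth [simp]:
  "base_s x $ 0 = x $ 0" "base_s x $ 1 = x $ 1" "base_s x $ Suc 0 = x $ 1"
  "base_s x $ 2 = 2 * x $ 1 * x $ 4 - x $ 0 * (x $ 4)^2 - (x $ 5)^2"
  "base_s x $ 3 = x $ 1 * x $ 3 + x $ 2 * x $ 5 - x $ 0 * x $ 3 * x $ 4"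
  "base_s x $ 4 = x $ 3 * x $ 5 + x $ 2 * x $ 4" "base_s x $ 5 = x $ 2" "base_s x $ 6 = x $ 3"
  unfolding base_s_def by (simp_all add: vec_of_list_index del: vec_of_list_Cons)

lemma base_t_nth [simp]:
  "base_t x $ 0 = 2 * x $ 0 * x $ 4 - x $ 1 * (x $ 4)^2 - (x $ 5)^2"
  "base_t x $ 1 = x $ 0" "base_t x $ Suc 0 = x $ 0" "base_t x $ 2 = x $ 1"
  "base_t x $ 3 = x $ 2 * x $ 5 + x $ 1 * x $ 4 * x $ 3 - x $ 0 * x $ 3"
  "base_t x $ 4 = x $ 2" "base_t x $ 5 = x $ 2 * x $ 4 - x $ 3 * x $ 5" "base_t x $ 6 = x $ 3"
  unfolding base_t_def by (simp_all add: vec_of_list_index del: vec_of_list_Cons)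

text \<open>The chart coordinates are \<open>(a, b, Z, T, t, w)\<close> with \<open>s = 1\<close>;
  \<open>base_s\<close> fills in \<open>c\<close>, \<open>X\<close> and \<open>Y\<close> as solved
  in \<open>incidence_1\<close>.\<close>

definition chart_s :: "complex vec \<Rightarrow> complex vec \<times> complex vec set" where
  "chart_s x = (base_s x, line (plucker (base_s x) 1 (x $ 4) (x $ 5)))"

text \<open>The chart coordinates are \<open>(b, c, Y, T, s, w)\<close> with \<open>t = 1\<close>;
  \<open>base_t\<close> fills in \<open>a\<close>, \<open>X\<close> and \<open>Z\<close> as solved
  in \<open>incidence_t_1\<close>.\<close>

definition chart_t :: "complex vec \<Rightarrow> complex vec \<times> complex vec set" where
  "chart_t x = (base_t x, line (plucker (base_t x) (x $ 4) 1 (x $ 5)))"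

definition hom_s :: "complex vec \<times> complex vec set \<Rightarrow> complex" where
  "hom_s p = rep 6 (snd p) $ 0"

definition hom_t :: "complex vec \<times> complex vec set \<Rightarrow> complex" where
  "hom_t p = rep 6 (snd p) $ 1"

definition hom_w :: "complex vec \<times> complex vec set \<Rightarrow> complex" where
  "hom_w p = rep 6 (snd p) $ 2"

text \<open>Base coordinates have degree 0, so they are multiplied by \<open>hom_s\<close>; all six
  functions then have the degree 1 of the denominator.\<close>

definition coord_s :: "nat \<Rightarrow> complex vec \<times> complex vec set \<Rightarrow> complex" where
  "coord_s i p = [fst p $ 0 * hom_s p, fst p $ 1 * hom_s p, fst p $ 5 * hom_s p, fst p $ 6 * hom_s p,
    hom_t p, hom_w p] ! i"

definition coord_t :: "nat \<Rightarrow> complex vec \<times> complex vec set \<Rightarrow> complex" where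
  "coord_t i p = [fst p $ 1 * hom_t p, fst p $ 2 * hom_t p, fst p $ 4 * hom_t p, fst p $ 6 * hom_t p,
    hom_s p, hom_w p] ! i"

lemma hom_forms: "hom_s \<in> proj_forms 7 6 1" "hom_t \<in> proj_forms 7 6 1" "hom_w \<in> proj_forms 7 6 1"
  unfolding hom_s_def hom_t_def hom_w_def
  using proj_forms_coord[of 0 6 7] proj_forms_coord[of 1 6 7] proj_forms_coord[of 2 6 7]
  by (simp_all add: split_def)

lemma proj_forms_base_mult:
  assumes "g \<in> polys n" "f \<in> proj_forms n r d"
  shows "(\<lambda>p. g (fst p) * f p) \<in> proj_forms n r d"
  using graded_variety.mult[OF graded_variety_proj proj_forms_base[OF assms(1)] assms(2)]
  by (simp add: split_def)

lemma proj_forms_coord_mult: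
  assumes "i < n" "f \<in> proj_forms n r d"
  shows "(\<lambda>p. fst p $ i * f p) \<in> proj_forms n r d"
  using proj_forms_base_mult[OF polys_coord[OF assms(1)] assms(2)] .

lemma coord_s_forms: "i < 6 \<Longrightarrow> coord_s i \<in> proj_forms 7 6 1"
  unfolding coord_s_def less_6 by (elim disjE) (auto intro!: proj_forms_coord_mult hom_forms[simplified])

lemma coord_t_forms: "i < 6 \<Longrightarrow> coord_t i \<in> proj_forms 7 6 1"
  unfolding coord_t_def less_6 by (elim disjE) (auto intro!: proj_forms_coord_mult hom_forms[simplified])

lemma incidence_base_s: "incidence (base_s x) 1 (x $ 4) (x $ 5)"
  unfolding incidence_1 by simp

lemma incidence_base_t: "incidence (base_t x) (x $ 4) 1 (x $ 5)"
  unfolding incidence_t_1 by simp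

lemma chart_in: "chart_s x \<in> small_space" "chart_t x \<in> small_space"
  unfolding chart_s_def chart_t_def using incidence_base_s incidence_base_t by (auto intro!: small_spaceI)

lemma hom_line_plucker:
  assumes "s \<noteq> 0 \<or> t \<noteq> 0"
  shows "\<exists>c. c \<noteq> 0 \<and> hom_s (y, line (plucker y s t w)) = c * s \<and> hom_t (y, line (plucker y s t w)) = c * t \<and>
    hom_w (y, line (plucker y s t w)) = c * w"
proof -
  obtain c where c: "c \<noteq> 0" "rep 6 (line (plucker y s t w)) = c \<cdot>\<^sub>v plucker y s t w"
    using rep_line[OF dim_plucker(1) plucker_neq_0[OF assms], of y w] by auto
  then show ?thesis by (intro exI[of _ c]) (simp add: hom_s_def hom_t_def hom_w_def)
qed

lemma polys_7_base_s: "i < 7 \<Longrightarrow> (\<lambda>x. base_s x $ i) \<in> polys 6"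
  unfolding less_7 by (elim disjE; simp; intro polys_intros; simp)

lemma polys_7_base_t: "i < 7 \<Longrightarrow> (\<lambda>x. base_t x $ i) \<in> polys 6"
  unfolding less_7 by (elim disjE; simp; intro polys_intros; simp)

lemma polys_6_plucker_s: "j < 6 \<Longrightarrow> (\<lambda>x. plucker (base_s x) 1 (x $ 4) (x $ 5) $ j) \<in> polys 6"
  unfolding less_6 by (elim disjE; simp; intro polys_intros; simp)

lemma polys_6_plucker_t: "j < 6 \<Longrightarrow> (\<lambda>x. plucker (base_t x) (x $ 4) 1 (x $ 5) $ j) \<in> polys 6"
  unfolding less_6 by (elim disjE; simp; intro polys_intros; simp)

interpretation S: affine_chart E.V small_space "proj_forms 7 6" 6 chart_s 1 hom_s coord_s
proof
  show "E.parametrization 6 chart_s"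
    unfolding chart_s_def
    by (rule E.parametrizationI)
      (use chart_in polys_7_base_s polys_6_plucker_s plucker_neq_0 in \<open>auto simp: chart_s_def\<close>)
  show "hom_s \<in> proj_forms 7 6 1" by (fact hom_forms)
  show "coord_s i \<in> proj_forms 7 6 1" if "i < 6" for i using coord_s_forms that .
  show "hom_s (chart_s x) \<noteq> 0" for x
    using hom_line_plucker[of 1 "x $ 4" "base_s x" "x $ 5"] by (auto simp: chart_s_def)
  show "x $ i = coord_s i (chart_s x) / hom_s (chart_s x)" if "i < 6" for x i
  proof -
    obtain c where "c \<noteq> 0" "hom_s (chart_s x) = c" "hom_t (chart_s x) = c * x $ 4" "hom_w (chart_s x) = c * x $ 5"
      "fst (chart_s x) = base_s x"
      using hom_line_plucker[of 1 "x $ 4" "base_s x" "x $ 5"] by (auto simp: chart_s_def)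
    then show ?thesis using that unfolding less_6 by (elim disjE) (simp_all add: coord_s_def)
  qed
  show "\<exists>x\<in>carrier_vec 6. chart_s x = p" if p: "p \<in> small_space" "hom_s p \<noteq> 0" for p
    using p(1)
  proof (cases rule: small_space_cases)
    case (s y t w)
    define x where "x = vec_of_list [y $ 0, y $ 1, y $ 5, y $ 6, t, w]"
    have x: "x \<in> carrier_vec 6" unfolding x_def carrier_vec_def by (simp del: vec_of_list_Cons)
    have nth: "x $ 0 = y $ 0" "x $ 1 = y $ 1" "x $ Suc 0 = y $ 1" "x $ 2 = y $ 5" "x $ 3 = y $ 6" "x $ 4 = t" "x $ 5 = w"
      unfolding x_def by (simp_all add: vec_of_list_index del: vec_of_list_Cons)
    have "base_s x = y"
      using s(1,3) unfolding incidence_1 by (intro eq_vecI) (auto simp: less_7 nth)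
    then have "chart_s x = p" using s(2) by (simp add: chart_s_def nth)
    then show ?thesis using x by blast
  next
    case (t y w)
    then show ?thesis using p hom_line_plucker[of 0 1 y w] by auto
  qed
qed

interpretation T: affine_chart E.V small_space "proj_forms 7 6" 6 chart_t 1 hom_t coord_t
proof
  show "E.parametrization 6 chart_t"
    unfolding chart_t_def
    by (rule E.parametrizationI)
      (use chart_in polys_7_base_t polys_6_plucker_t plucker_neq_0 in \<open>auto simp: chart_t_def\<close>)
  show "hom_t \<in> proj_forms 7 6 1" by (fact hom_forms)
  show "coord_t i \<in> proj_forms 7 6 1" if "i < 6" for i using coord_t_forms that .
  show "hom_t (chart_t x) \<noteq> 0" for x
    using hom_line_plucker[of "x $ 4" 1 "base_t x" "x $ 5"] by (auto simp: chart_t_def)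
  show "x $ i = coord_t i (chart_t x) / hom_t (chart_t x)" if "i < 6" for x i
  proof -
    obtain c where "c \<noteq> 0" "hom_t (chart_t x) = c" "hom_s (chart_t x) = c * x $ 4" "hom_w (chart_t x) = c * x $ 5"
      "fst (chart_t x) = base_t x"
      using hom_line_plucker[of "x $ 4" 1 "base_t x" "x $ 5"] by (auto simp: chart_t_def)
    then show ?thesis using that unfolding less_6 by (elim disjE) (simp_all add: coord_t_def)
  qed
  show "\<exists>x\<in>carrier_vec 6. chart_t x = p" if p: "p \<in> small_space" "hom_t p \<noteq> 0" for p
  proof -
    \<comment> \<open>\<open>small_space_cases\<close> normalizes to \<open>s = 1\<close> whenever
      possible, so the division by \<open>t\<close> is carried out here by hand.\<close>
    obtain y s t w where *: "y \<in> carrier_vec 7" "p = (y, line (plucker y s t w))" "s \<noteq> 0 \<or> t \<noteq> 0"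
      "incidence y s t w" using p by (auto simp: small_space_def)
    have t: "t \<noteq> 0" using hom_line_plucker[OF *(3), of y w] p(2) *(2) by auto
    define x where "x = vec_of_list [y $ 1, y $ 2, y $ 4, y $ 6, s / t, w / t]"
    have x: "x \<in> carrier_vec 6" unfolding x_def carrier_vec_def by (simp del: vec_of_list_Cons)
    have nth: "x $ 0 = y $ 1" "x $ 1 = y $ 2" "x $ Suc 0 = y $ 2" "x $ 2 = y $ 4" "x $ 3 = y $ 6" "x $ 4 = s / t" "x $ 5 = w / t"
      unfolding x_def by (simp_all add: vec_of_list_index del: vec_of_list_Cons)
    have "incidence y (s / t) 1 (w / t)" using incidence_smult[OF t, of y "s / t" 1 "w / t"] * t by simp
    then have "base_t x = y"
      using *(1) unfolding incidence_t_1 by (intro eq_vecI) (auto simp: less_7 nth)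
    moreover have "line (plucker y (s / t) 1 (w / t)) = line (plucker y s t w)"
      using plucker_smult[of y t "s / t" 1 "w / t"] line_smult[OF t, of "plucker y (s / t) 1 (w / t)"] t by simp
    ultimately have "chart_t x = p" using *(2) by (simp add: chart_t_def nth)
    then show ?thesis using x by blast
  qed
qed

lemma hom_s_or_hom_t:
  assumes "p \<in> small_space"
  shows "hom_s p \<noteq> 0 \<or> hom_t p \<noteq> 0"
proof -
  obtain s t w where "rep 6 (snd p) = plucker (fst p) s t w" "s \<noteq> 0 \<or> t \<noteq> 0"
    using small_space_rep[of "fst p" "snd p"] assms by auto
  then show ?thesis by (auto simp: hom_s_def hom_t_def)
qed

lemma smooth_small_space: "smooth E.V"
  unfolding smooth_def E.points
  using S.regular_point T.regular_point hom_s_or_hom_t E.closedin_point by blast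


section \<open>The blow-up as a variety, and the exceptional set\<close>

interpretation Y: graded_variety "subvariety (affine_space 7) hypersurface" hypersurface "\<lambda>_. polys 7"
  by (rule graded_variety_subvariety[OF graded_variety_affine]) (auto simp: hypersurface_def)

lemma polys_7_pq: "p1 \<in> polys 7" "p2 \<in> polys 7" "p3 \<in> polys 7" "q1 \<in> polys 7" "q2 \<in> polys 7" "q3 \<in> polys 7"
  unfolding p1_def[abs_def] p2_def[abs_def] p3_def[abs_def] q1_def[abs_def] q2_def[abs_def] q3_def[abs_def]
  by (intro polys_intros; simp)+

lemma line_plucker_eqI:
  assumes "s \<noteq> 0 \<or> t \<noteq> 0" "s' \<noteq> 0 \<or> t' \<noteq> 0"
    and cross: "s' * t = t' * s" "s' * w = w' * s" "t' * w = w' * t"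
  shows "line (plucker y s' t' w') = line (plucker y s t w)"
proof -
  have "\<exists>c. c \<noteq> 0 \<and> s' = c * s \<and> t' = c * t \<and> w' = c * w"
  proof (cases "s = 0")
    case True
    then have "t \<noteq> 0" "s' = 0" "t' \<noteq> 0" using assms by auto
    then show ?thesis using cross True by (intro exI[of _ "t' / t"]) (auto simp: field_simps)
  next
    case False
    then have "s' \<noteq> 0" using assms by auto
    then show ?thesis using cross False by (intro exI[of _ "s' / s"]) (auto simp: field_simps)
  qed
  then show ?thesis using plucker_smult line_smult by metis
qed

lemma incidence_normalize:
  assumes "incidence y s t w" "s \<noteq> 0 \<or> t \<noteq> 0"
  obtains "s \<noteq> 0" "incidence y 1 (t / s) (w / s)" | "t \<noteq> 0" "incidence y (s / t) 1 (w / t)"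
  using assms incidence_smult[of s y 1 "t / s" "w / s"] incidence_smult[of t y "s / t" 1 "w / t"]
  by (cases "s = 0") auto

lemma p_proportional:
  assumes "incidence y s t w" "s \<noteq> 0 \<or> t \<noteq> 0"
  shows "p1 y * t = p2 y * s" "p1 y * w = p3 y * s" "p2 y * w = p3 y * t"
proof -
  have "p1 y * t = p2 y * s \<and> p1 y * w = p3 y * s \<and> p2 y * w = p3 y * t"
    using assms
  proof (cases rule: incidence_normalize)
    case 1
    then show ?thesis using p_proportional_1[OF 1(2)] by simp
  next
    case 2
    then show ?thesis using p_proportional_t_1[OF 2(2)] by simp
  qed
  then show "p1 y * t = p2 y * s" "p1 y * w = p3 y * s" "p2 y * w = p3 y * t" by auto
qed

lemma q_proportional:
  assumes "incidence y s t w" "s \<noteq> 0 \<or> t \<noteq> 0"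
  shows "q1 y * t = q2 y * s" "q1 y * w = q3 y * s" "q2 y * w = q3 y * t"
proof -
  have "q1 y * t = q2 y * s \<and> q1 y * w = q3 y * s \<and> q2 y * w = q3 y * t"
    using assms
  proof (cases rule: incidence_normalize)
    case 1
    then show ?thesis using q_proportional_1[OF 1(2)] by simp
  next
    case 2
    then show ?thesis using q_proportional_t_1[OF 2(2)] by simp
  qed
  then show "q1 y * t = q2 y * s" "q1 y * w = q3 y * s" "q2 y * w = q3 y * t" by auto
qed

section \<open>Identification of the blow-up with the incidence locus\<close>

definition minors_graph :: "(complex vec \<times> complex vec set) set" where
  "minors_graph = {(x, line (vec_of_list (map (\<lambda>g. g x) minors))) | x.
    x \<in> hypersurface \<and> (\<exists>g\<in>set minors. g x \<noteq> 0)}"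

text \<open>With \<open>s = t = 0\<close> the conic equation reduces to
  \<open>w^2 = 0\<close>.\<close>

lemma p3_eq_0:
  assumes "F y = 0" "p1 y = 0" "p2 y = 0"
  shows "p3 y = 0"
  using incidence_p[OF assms(1)] assms(2,3) unfolding incidence_def Let_def by simp

lemma minors_neq_0_iff:
  assumes "F x = 0"
  shows "(\<exists>g\<in>set minors. g x \<noteq> 0) \<longleftrightarrow> p1 x \<noteq> 0 \<or> p2 x \<noteq> 0"
proof -
  have eq: "map (\<lambda>g. g x) minors = [p1 x, p2 x, p3 x, - p3 x, x $ 0 * p2 x, 2 * x $ 1 * p2 x - x $ 2 * p1 x]"
    using arg_cong[OF minors_plucker[OF assms], of list_of_vec] unfolding plucker_def list_vec .
  have "(\<lambda>g. g x) ` set minors = set [p1 x, p2 x, p3 x, - p3 x, x $ 0 * p2 x, 2 * x $ 1 * p2 x - x $ 2 * p1 x]"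
    using arg_cong[OF eq, of set] by (simp only: set_map)
  moreover have "(\<exists>g\<in>set minors. g x \<noteq> 0) \<longleftrightarrow> (\<exists>z\<in>(\<lambda>g. g x) ` set minors. z \<noteq> 0)" by auto
  ultimately show ?thesis using p3_eq_0[OF assms] by auto
qed

lemma minors_graph_eq:
  "minors_graph = {(x, line (plucker x (p1 x) (p2 x) (p3 x))) | x. x \<in> hypersurface \<and> (p1 x \<noteq> 0 \<or> p2 x \<noteq> 0)}"
proof -
  have "x \<in> hypersurface \<and> (\<exists>g\<in>set minors. g x \<noteq> 0) \<longleftrightarrow> x \<in> hypersurface \<and> (p1 x \<noteq> 0 \<or> p2 x \<noteq> 0)" for x
    using minors_neq_0_iff by (auto simp: hypersurface_def)
  moreover have "line (vec_of_list (map (\<lambda>g. g x) minors)) = line (plucker x (p1 x) (p2 x) (p3 x))"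
    if "x \<in> hypersurface" for x
    using that minors_plucker by (simp add: hypersurface_def)
  ultimately show ?thesis unfolding minors_graph_def by (intro Collect_cong) metis
qed

lemma minors_graph_subset: "minors_graph \<subseteq> small_space"
  unfolding minors_graph_eq using incidence_p by (auto simp: hypersurface_def intro!: small_spaceI)

text \<open>By proportionality, the fibre over a point where \<open>p1\<close> or \<open>p2\<close>
  is nonzero consists of the graph point alone.\<close>

lemma in_minors_graph_iff:
  assumes "(y, L) \<in> small_space"
  shows "(y, L) \<in> minors_graph \<longleftrightarrow> p1 y \<noteq> 0 \<or> p2 y \<noteq> 0"
proof
  assume "p1 y \<noteq> 0 \<or> p2 y \<noteq> 0"
  moreover obtain s t w where "L = line (plucker y s t w)" "s \<noteq> 0 \<or> t \<noteq> 0" "incidence y s t w"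
    using assms by (auto simp: small_space_def)
  ultimately show "(y, L) \<in> minors_graph"
    unfolding minors_graph_eq using small_space_base[OF assms] p_proportional[of y s t w]
      line_plucker_eqI[of s t "p1 y" "p2 y" w "p3 y" y] by auto
qed (auto simp: minors_graph_eq)

lemma base_form: "g \<in> polys 7 \<Longrightarrow> (\<lambda>p. g (fst p)) \<in> proj_forms 7 6 0"
  using proj_forms_base[of g 7 6] by (simp add: split_def)

lemma vec_of_list_6_carrier: "vec_of_list [a, b, c, d, e, f] \<in> carrier_vec 6"
  unfolding carrier_vec_def by (simp del: vec_of_list_Cons)

lemma vec_of_list_6_nth: "vec_of_list [a, b, c, d, e, f] $ 0 = a" "vec_of_list [a, b, c, d, e, f] $ Suc 0 = b"
  "vec_of_list [a, b, c, d, e, f] $ 1 = b"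
  "vec_of_list [a, b, c, d, e, f] $ 2 = c" "vec_of_list [a, b, c, d, e, f] $ 3 = d"
  "vec_of_list [a, b, c, d, e, f] $ 4 = e" "vec_of_list [a, b, c, d, e, f] $ 5 = f"
  by (simp_all add: vec_of_list_index del: vec_of_list_Cons)

lemmas vec6 = vec_of_list_6_carrier vec_of_list_6_nth

text \<open>This is the density of the graph. Within a chart, points off the graph are zeros of
  \<open>p1\<close> and of \<open>p2\<close>; so the product of \<open>k\<close> with one of these
  vanishes on the chart, and primeness applies once that function is known not to vanish identically
  there.\<close>

lemma form_vanishing_on_graph:
  assumes k: "k \<in> proj_forms 7 6 d" and 0: "\<And>q. q \<in> minors_graph \<Longrightarrow> k q = 0" and q: "q \<in> small_space"
  shows "k q = 0"
proof (cases "hom_s q = 0")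
  case False
  have "p1 (fst p) * k p = 0" if "p \<in> chart_s ` carrier_vec 6" for p
    using that chart_in 0 in_minors_graph_iff[of "fst p" "snd p"] by (metis (no_types, lifting) imageE mult_eq_0_iff prod.collapse)
  then have "(\<forall>p\<in>chart_s ` carrier_vec 6. p1 (fst p) = 0) \<or> (\<forall>p\<in>chart_s ` carrier_vec 6. k p = 0)"
    by (rule E.irreducible_setD[OF E.irreducible_set_image[OF S.param] base_form[OF polys_7_pq(1)] k])
  \<comment> \<open>The point with \<open>Z = 1\<close> and the other chart coordinates zero, where
    \<open>p1 = Z^2 = 1\<close>.\<close>
  moreover have "p1 (fst (chart_s (vec_of_list [0, 0, 1, 0, 0, 0]))) \<noteq> 0"
    by (simp add: chart_s_def p1_def vec6 del: vec_of_list_Cons)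
  moreover have "chart_s (vec_of_list [0, 0, 1, 0, 0, 0]) \<in> chart_s ` carrier_vec 6" by (intro imageI vec_of_list_6_carrier)
  ultimately have "\<forall>p\<in>chart_s ` carrier_vec 6. k p = 0" by blast
  then show ?thesis using S.surj[OF q False] by blast
next
  case True
  have "p2 (fst p) * k p = 0" if "p \<in> chart_t ` carrier_vec 6" for p
    using that chart_in 0 in_minors_graph_iff[of "fst p" "snd p"] by (metis (no_types, lifting) imageE mult_eq_0_iff prod.collapse)
  then have "(\<forall>p\<in>chart_t ` carrier_vec 6. p2 (fst p) = 0) \<or> (\<forall>p\<in>chart_t ` carrier_vec 6. k p = 0)"
    by (rule E.irreducible_setD[OF E.irreducible_set_image[OF T.param] base_form[OF polys_7_pq(2)] k])
  \<comment> \<open>The point with \<open>Y = s = 1\<close> and the other chart coordinates zero;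
    then \<open>Z = Y s = 1\<close> and \<open>p2 = Z Y = 1\<close>.\<close>
  moreover have "p2 (fst (chart_t (vec_of_list [0, 0, 1, 0, 1, 0]))) \<noteq> 0"
    by (simp add: chart_t_def p2_def vec6 del: vec_of_list_Cons)
  moreover have "chart_t (vec_of_list [0, 0, 1, 0, 1, 0]) \<in> chart_t ` carrier_vec 6" by (intro imageI vec_of_list_6_carrier)
  ultimately have "\<forall>p\<in>chart_t ` carrier_vec 6. k p = 0" by blast
  then show ?thesis using T.surj[OF q] hom_s_or_hom_t[OF q] True by blast
qed

lemma closure_minors_graph: "zar (affine_proj_space 7 6) closure_of minors_graph = small_space"
proof
  show "zar (affine_proj_space 7 6) closure_of minors_graph \<subseteq> small_space"
    using minors_graph_subset closedin_small_space by (rule closure_of_minimal)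
  show "small_space \<subseteq> zar (affine_proj_space 7 6) closure_of minors_graph"
  proof
    fix q assume q: "q \<in> small_space"
    show "q \<in> zar (affine_proj_space 7 6) closure_of minors_graph"
      unfolding graded_variety.closure_of_iff[OF graded_variety_proj order_trans[OF minors_graph_subset E.S]]
    proof (intro conjI allI ballI impI)
      show "q \<in> carrier_vec 7 \<times> proj_space 6" using q E.S by blast
      show "k q = 0" if "k \<in> proj_forms 7 6 d" "\<forall>q\<in>minors_graph. k q = 0" for k d
        using form_vanishing_on_graph[OF that(1) _ q] that(2) by blast
    qed
  qed
qed

lemma length_minors: "length minors = 6"
  by (simp add: minors_def upt_rec numeral_2_eq_2 numeral_3_eq_3)

lemma blow_up_eq: "blow_up 7 hypersurface minors = E.V"
  unfolding blow_up_def Let_def length_minors minors_graph_def[symmetric] closure_minors_graph ..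

text \<open>Needed to carry density from the blow-up down to the hypersurface. Where one of the two
  triples is nonzero it gives the point of the fibre; elsewhere a point with \<open>t = 0\<close> is
  found.\<close>

lemma base_surjective:
  assumes y: "y \<in> hypersurface"
  shows "\<exists>L. (y, L) \<in> small_space"
proof -
  have y7: "y \<in> carrier_vec 7" and F: "F y = 0" using y by (auto simp: hypersurface_def)
  have "\<exists>s t w. (s \<noteq> 0 \<or> t \<noteq> 0) \<and> incidence y s t w"
  proof (cases "p1 y = 0 \<and> p2 y = 0 \<and> q1 y = 0 \<and> q2 y = 0")
    case False
    then have "(p1 y \<noteq> 0 \<or> p2 y \<noteq> 0) \<or> (q1 y \<noteq> 0 \<or> q2 y \<noteq> 0)" by blast
    then show ?thesis
    proof
      assume "p1 y \<noteq> 0 \<or> p2 y \<noteq> 0"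
      then show ?thesis using incidence_p[OF F] by (intro exI conjI)
    next
      assume "q1 y \<noteq> 0 \<or> q2 y \<noteq> 0"
      then show ?thesis using incidence_q[OF F] by (intro exI conjI)
    qed
  next
    case True
    then have 0: "p1 y = 0" "p2 y = 0" "q1 y = 0" "q2 y = 0" by auto
    have q3: "q3 y = 0" using incidence_q[OF F] 0 unfolding incidence_def Let_def by simp
    show ?thesis
    proof (cases "y $ 6 = 0")
      case True
      then have "y $ 5 = 0" "y $ 4 = 0" using 0 by (auto simp: p1_def q2_def)
      moreover from this True have "y $ 3 = 0" using F by (simp add: F_explicit)
      \<comment> \<open>Here \<open>X = Y = Z = T = 0\<close>, so the linear equations are void and
        the fibre is the whole conic.\<close>
      ultimately have "incidence y 1 0 (csqrt (- y $ 2))" unfolding incidence_1 using True by simp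
      then show ?thesis by (intro exI[of _ 1] exI[of _ 0] exI[of _ "csqrt (- y $ 2)"]) simp
    next
      case False
      have "2 * y $ 6 * y $ 3 = q1 y - p2 y" by (simp add: p2_def q1_def algebra_simps)
      then have X: "y $ 3 = 0" using False 0 by simp
      have *: "y $ 5 * y $ 4 = - y $ 1 * y $ 6 * y $ 6" "y $ 2 * (y $ 6)^2 + (y $ 4)^2 = 0"
        "y $ 4 * (y $ 1 * y $ 6) - y $ 2 * y $ 6 * y $ 5 = 0"
        using 0 q3 X by (simp_all add: p2_def q2_def q3_def algebra_simps add_eq_0_iff2)
      \<comment> \<open>With \<open>t = 0\<close> the first equation gives
        \<open>(s : w) = (T : Y)\<close>; the others hold because \<open>X\<close> and the entries
        of both triples vanish.\<close>
      have "incidence y (y $ 6) 0 (y $ 4)"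
        unfolding incidence_def Let_def X using * by (simp add: algebra_simps power2_eq_square add_eq_0_iff2)
      then show ?thesis using False by blast
    qed
  qed
  then show ?thesis using small_spaceI[OF y7] by blast
qed

text \<open>Stated for any triple of polynomials in order to serve both the minors and the second
  triple. The triple itself defines the inverse map, and \<open>cross\<close> shows that it hits the
  only point of the fibre.\<close>

lemma isomorphism_over:
  assumes f: "f1 \<in> polys 7" "f2 \<in> polys 7" "f3 \<in> polys 7"
    and inc: "\<And>y. F y = 0 \<Longrightarrow> incidence y (f1 y) (f2 y) (f3 y)"
    and cross: "\<And>y s t w. incidence y s t w \<Longrightarrow> s \<noteq> 0 \<or> t \<noteq> 0 \<Longrightarrow>
      f1 y * t = f2 y * s \<and> f1 y * w = f3 y * s \<and> f2 y * w = f3 y * t"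
    and U: "U = {y \<in> hypersurface. f1 y \<noteq> 0 \<or> f2 y \<noteq> 0}" and W: "W = {p \<in> small_space. fst p \<in> U}"
  shows "openin (zar (subvariety (affine_space 7) hypersurface)) U"
    and "isomorphism (subvariety E.V W) (subvariety (subvariety (affine_space 7) hypersurface) U) fst"
proof -
  show "openin (zar (subvariety (affine_space 7) hypersurface)) U"
    unfolding Y.open_iff
  proof (intro conjI ballI)
    fix y assume y: "y \<in> U"
    show "\<exists>d::nat. \<exists>k\<in>polys 7. k y \<noteq> 0 \<and> (\<forall>q\<in>hypersurface. k q \<noteq> 0 \<longrightarrow> q \<in> U)"
    proof (cases "f1 y = 0")
      case True
      then show ?thesis using y f(2) by (intro exI[of _ 0] bexI[of _ f2]) (auto simp: U)
    next
      case False
      then show ?thesis using y f(1) by (intro exI[of _ 0] bexI[of _ f1]) (auto simp: U)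
    qed
  qed (auto simp: U)
  have U_sub: "U \<subseteq> hypersurface" and W_sub: "W \<subseteq> small_space" by (auto simp: U W)
  note grU = graded_variety_subvariety[OF Y.graded_variety_axioms U_sub]
    and grW = graded_variety_subvariety[OF E.graded_variety_axioms W_sub]
  define \<sigma> where "\<sigma> y = (y, line (plucker y (f1 y) (f2 y) (f3 y)))" for y
  have \<sigma>_in: "\<sigma> y \<in> W" if "y \<in> U" for y
    using that inc[of y] by (auto simp: U W \<sigma>_def hypersurface_def intro!: small_spaceI)
  have \<sigma>_fst: "\<sigma> (fst p) = p" if p: "p \<in> W" for p
  proof -
    obtain y s t w where *: "p = (y, line (plucker y s t w))" "s \<noteq> 0 \<or> t \<noteq> 0" "incidence y s t w"
      using p by (auto simp: W small_space_def)
    then have "f1 y \<noteq> 0 \<or> f2 y \<noteq> 0" using p by (auto simp: W U)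
    then show ?thesis
      using line_plucker_eqI[of s t "f1 y" "f2 y" w "f3 y" y] cross[OF *(3,2)] *(1,2) by (simp add: \<sigma>_def)
  qed
  have "morphism (subvariety E.V W) (subvariety (subvariety (affine_space 7) hypersurface) U) fst"
  proof (rule morphism_gradedI[OF grW grU, where c = "\<lambda>_ _. 1" and D = "\<lambda>_. 0"])
    show "\<exists>h\<in>proj_forms 7 6 0. \<forall>q\<in>W. 1 * g (fst q) = h q" if "g \<in> polys 7" for g
      using base_form[OF that] by (intro bexI[of _ "\<lambda>p. g (fst p)"]) auto
  qed (auto simp: W)
  moreover have "morphism (subvariety (subvariety (affine_space 7) hypersurface) U) (subvariety E.V W) \<sigma>"
  proof -
    have "\<exists>c. (\<forall>x. c x \<noteq> 0) \<and> (\<forall>d. \<forall>g\<in>proj_forms 7 6 d. \<exists>G\<in>homog_polys 7 6 d.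
        \<forall>x\<in>U. c x ^ d * g (x, line (plucker x (f1 x) (f2 x) (f3 x))) = G (x, plucker x (f1 x) (f2 x) (f3 x)))"
      by (rule proj_forms_rescale) (auto simp: U hypersurface_def plucker_neq_0)
    then obtain c where c: "(\<forall>x. c x \<noteq> 0) \<and> (\<forall>d. \<forall>g\<in>proj_forms 7 6 d. \<exists>G\<in>homog_polys 7 6 d.
        \<forall>x\<in>U. c x ^ d * g (x, line (plucker x (f1 x) (f2 x) (f3 x))) = G (x, plucker x (f1 x) (f2 x) (f3 x)))"
      by (rule exE)
    show ?thesis
    proof (rule morphism_gradedI[OF grU grW, where c = "\<lambda>d x. c x ^ d"])
      show "c q ^ d \<noteq> 0" for d q using c by auto
      fix d g assume "g \<in> proj_forms 7 6 d"
      with c[THEN conjunct2] obtain G where G: "G \<in> homog_polys 7 6 d"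
        "\<forall>x\<in>U. c x ^ d * g (x, line (plucker x (f1 x) (f2 x) (f3 x))) = G (x, plucker x (f1 x) (f2 x) (f3 x))"
        by blast
      have "(\<lambda>x. G (x, plucker x (f1 x) (f2 x) (f3 x))) \<in> polys 7"
      proof (rule homog_polys_comp[OF G(1)])
        show "(\<lambda>x. plucker x (f1 x) (f2 x) (f3 x) $ j) \<in> polys 7" if "j < 6" for j
          using that unfolding less_6
          by (elim disjE) (auto intro!: f polys_mult polys_diff polys_uminus polys_const polys_coord)
      qed (rule polys_coord)
      then show "\<exists>h\<in>polys 7. \<forall>q\<in>U. c q ^ d * g (\<sigma> q) = h q"
        by (rule bexI[rotated]) (use G(2) in \<open>simp add: \<sigma>_def\<close>)
    qed (fact \<sigma>_in)
  qed
  ultimately show "isomorphism (subvariety E.V W) (subvariety (subvariety (affine_space 7) hypersurface) U) fst"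
    unfolding isomorphism_def graded_variety.points[OF grU] graded_variety.points[OF grW]
    using \<sigma>_fst by (intro conjI exI[of _ \<sigma>]) (auto simp: \<sigma>_def)
qed

lemma morphism_fst: "morphism E.V (subvariety (affine_space 7) hypersurface) fst"
proof (rule morphism_gradedI[OF E.graded_variety_axioms Y.graded_variety_axioms, where c = "\<lambda>_ _. 1" and D = "\<lambda>_. 0"])
  show "\<exists>h\<in>proj_forms 7 6 0. \<forall>q\<in>small_space. 1 * g (fst q) = h q" if "g \<in> polys 7" for g
    using base_form[OF that] by (intro bexI[of _ "\<lambda>p. g (fst p)"]) auto
qed (use small_space_base in auto)

lemma birational_fst: "birational_morphism E.V (subvariety (affine_space 7) hypersurface) fst"
proof -
  define U where "U = {y \<in> hypersurface. p1 y \<noteq> 0 \<or> p2 y \<noteq> 0}"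
  define W where "W = {p \<in> small_space. fst p \<in> U}"
  have W_eq: "W = minors_graph"
    using in_minors_graph_iff minors_graph_subset small_space_base by (force simp: W_def U_def)
  note iso = isomorphism_over[OF polys_7_pq(1-3) incidence_p _ U_def W_def]
  have cross: "p1 y * t = p2 y * s \<and> p1 y * w = p3 y * s \<and> p2 y * w = p3 y * t"
    if "incidence y s t w" "s \<noteq> 0 \<or> t \<noteq> 0" for y s t w
    using p_proportional[OF that] by blast
  have openW: "openin (zar E.V) W"
  proof -
    have "W = {q \<in> small_space. p1 (fst q) \<noteq> 0} \<union> {q \<in> small_space. p2 (fst q) \<noteq> 0}"
      using small_space_base by (auto simp: W_def U_def)
    then show ?thesis
      using openin_Un[OF E.openin_nonvanishing[OF base_form[OF polys_7_pq(1)]]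
        E.openin_nonvanishing[OF base_form[OF polys_7_pq(2)]]] by simp
  qed
  have "zar E.V closure_of W = points E.V"
  proof -
    have "q \<in> zar E.V closure_of W" if q: "q \<in> small_space" for q
      unfolding W_eq E.closure_of_iff[OF minors_graph_subset]
      using form_vanishing_on_graph q by blast
    then show ?thesis using closure_of_subset_topspace[of "zar E.V" W] unfolding E.points by blast
  qed
  moreover have "zar (subvariety (affine_space 7) hypersurface) closure_of U =
      points (subvariety (affine_space 7) hypersurface)"
  proof -
    have "y \<in> zar (subvariety (affine_space 7) hypersurface) closure_of U" if y: "y \<in> hypersurface" for y
    proof -
      have sub: "U \<subseteq> hypersurface" by (auto simp: U_def)
      \<comment> \<open>A function vanishing on \<open>U\<close> pulls back to a form vanishing on
        the graph, hence on the whole blow-up, which maps onto the hypersurface.\<close>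
      have "k y = 0" if k: "k \<in> polys 7" "\<forall>z\<in>U. k z = 0" for k
      proof -
        obtain L where L: "(y, L) \<in> small_space" using base_surjective[OF y] by blast
        have "k (fst q) = 0" if "q \<in> minors_graph" for q using that k(2) unfolding W_eq[symmetric] W_def by blast
        then show ?thesis using form_vanishing_on_graph[OF base_form[OF k(1)] _ L] by simp
      qed
      then show ?thesis unfolding Y.closure_of_iff[OF sub] using y by blast
    qed
    then show ?thesis
      using closure_of_subset_topspace[of "zar (subvariety (affine_space 7) hypersurface)" U]
      unfolding Y.points by blast
  qed
  ultimately show ?thesis
    unfolding birational_morphism_def using morphism_fst iso[OF _ cross] openW by blast
qed

section \<open>The exceptional set and its codimension\<close>

lemma exceptional_subset:
  "exceptional_set E.V (subvariety (affine_space 7) hypersurface) fst \<subseteq>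
    {p \<in> small_space. p1 (fst p) = 0 \<and> fst p $ 3 = 0}"
proof
  fix p assume p: "p \<in> exceptional_set E.V (subvariety (affine_space 7) hypersurface) fst"
  then have p_in: "p \<in> small_space" by (simp add: exceptional_set_def E.points)
  then have base: "fst p \<in> hypersurface" using small_space_base[of "fst p" "snd p"] by simp
  have no: "fst p \<notin> U" if "openin (zar (subvariety (affine_space 7) hypersurface)) U"
    "isomorphism (subvariety E.V {x \<in> small_space. fst x \<in> U})
      (subvariety (subvariety (affine_space 7) hypersurface) U) fst" for U
    using p that by (auto simp: exceptional_set_def E.points)
  have "fst p \<notin> {y \<in> hypersurface. p1 y \<noteq> 0 \<or> p2 y \<noteq> 0}"
    by (intro no isomorphism_over[OF polys_7_pq(1-3) incidence_p _ refl refl]; use p_proportional in blast)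
  then have p0: "p1 (fst p) = 0" "p2 (fst p) = 0" using base by auto
  have "fst p \<notin> {y \<in> hypersurface. q1 y \<noteq> 0 \<or> q2 y \<noteq> 0}"
    by (intro no isomorphism_over[OF polys_7_pq(4-6) incidence_q _ refl refl]; use q_proportional in blast)
  then have q0: "q1 (fst p) = 0" "q2 (fst p) = 0" using base by auto
  \<comment> \<open>If \<open>T = 0\<close>, then \<open>p1\<close> and \<open>q2\<close> are the
    squares of \<open>Z\<close> and \<open>Y\<close>, and \<open>F\<close> reduces to
    \<open>X^2\<close>. Otherwise \<open>X\<close> is isolated by the difference of
    \<open>q1\<close> and \<open>p2\<close>.\<close>
  have "fst p $ 3 = 0"
  proof (cases "fst p $ 6 = 0")
    case True
    then have "fst p $ 5 = 0" "fst p $ 4 = 0" using p0 q0 by (auto simp: p1_def q2_def)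
    then show ?thesis using True base by (simp add: hypersurface_def F_explicit)
  next
    case False
    have "2 * fst p $ 6 * fst p $ 3 = q1 (fst p) - p2 (fst p)" by (simp add: p2_def q1_def algebra_simps)
    then show ?thesis using False p0 q0 by simp
  qed
  then show "p \<in> {p \<in> small_space. p1 (fst p) = 0 \<and> fst p $ 3 = 0}" using p0 p_in by simp
qed

text \<open>A form vanishing on the chart \<open>s = 1\<close> vanishes, after multiplication by
  \<open>hom_s\<close>, on the chart \<open>t = 1\<close>, where \<open>hom_s\<close> is not
  identically zero. Hence primeness on the first chart suffices.\<close>

lemma irreducible_small_space: "E.irreducible_set small_space"
proof -
  have chart: "\<forall>q\<in>small_space. k q = 0" if k: "k \<in> proj_forms 7 6 d" "\<forall>q\<in>chart_s ` carrier_vec 6. k q = 0" for k d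
  proof -
    have "hom_s q * k q = 0" if q: "q \<in> chart_t ` carrier_vec 6" for q
      using k(2) S.surj[of q] chart_in(2) q by (metis (no_types, lifting) imageE imageI mult_eq_0_iff)
    then have "(\<forall>q\<in>chart_t ` carrier_vec 6. hom_s q = 0) \<or> (\<forall>q\<in>chart_t ` carrier_vec 6. k q = 0)"
      by (rule E.irreducible_setD[OF E.irreducible_set_image[OF T.param] hom_forms(1) k(1)])
    moreover have "hom_s (chart_t (vec_of_list [0, 0, 0, 0, 1, 0])) \<noteq> 0"
      using hom_line_plucker[of 1 1 "base_t (vec_of_list [0, 0, 0, 0, 1, 0])" 0]
      by (auto simp: chart_t_def vec6 simp del: vec_of_list_Cons)
    moreover have "chart_t (vec_of_list [0, 0, 0, 0, 1, 0]) \<in> chart_t ` carrier_vec 6"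
      by (intro imageI vec_of_list_6_carrier)
    ultimately have "\<forall>q\<in>chart_t ` carrier_vec 6. k q = 0" by blast
    then show ?thesis using k(2) S.surj T.surj hom_s_or_hom_t by (metis image_eqI)
  qed
  show ?thesis
    unfolding E.irreducible_set_def
  proof (intro conjI allI ballI impI)
    show "small_space \<noteq> {}" using chart_in by blast
    fix d e f g assume fg: "f \<in> proj_forms 7 6 d" "g \<in> proj_forms 7 6 e" and "\<forall>q\<in>small_space. f q * g q = 0"
    then have "f q * g q = 0" if "q \<in> chart_s ` carrier_vec 6" for q using that chart_in by blast
    then show "(\<forall>q\<in>small_space. f q = 0) \<or> (\<forall>q\<in>small_space. g q = 0)"
      using E.irreducible_setD[OF E.irreducible_set_image[OF S.param] fg] chart fg by blast
  qed simp
qed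

lemma codim_exceptional:
  assumes sub: "A \<subseteq> {p \<in> small_space. p1 (fst p) = 0 \<and> fst p $ 3 = 0}"
  shows "codim E.V A \<ge> 2"
  unfolding codim_def
proof (rule INF_greatest)
  fix W assume W: "W \<in> {W. irreducible_closed (zar E.V) W \<and> W \<subseteq> A}"
  then have W_irr: "irreducible_closed (zar E.V) W" and W_A: "W \<subseteq> A" by auto
  have W_sub: "W \<subseteq> small_space" using W_A sub by blast
  have top: "irreducible_closed (zar E.V) small_space"
  proof -
    have "zar E.V closure_of small_space = small_space"
      using closure_of_topspace[of "zar E.V"] by (simp add: E.points)
    then show ?thesis using E.irreducible_closed_closure[OF irreducible_small_space] by simp
  qed
  have "\<exists>D. irreducible_closed (zar E.V) D \<and> W \<subset> D \<and> D \<subset> small_space"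
  proof (cases "\<forall>q\<in>W. hom_s q = 0")
    case False
    \<comment> \<open>With \<open>l\<close> the entry 0 of the parameter, the substitution
      \<open>a = - l^2\<close>, \<open>Z = l T\<close> solves \<open>p1 = Z^2 + a T^2 = 0\<close>.
      The locus is thus an image of affine space and so irreducible.\<close>
    define \<psi> where "\<psi> x = vec_of_list [- ((x $ 0)^2), x $ 1, x $ 0 * x $ 3, x $ 3, x $ 4, x $ 5]" for x :: "complex vec"
    define B where "B = (\<lambda>x. chart_s (\<psi> x)) ` carrier_vec 6"
    have "E.parametrization 6 (\<lambda>x. chart_s (\<psi> x))"
    proof (rule E.parametrization_comp[OF S.param])
      show "\<psi> x \<in> carrier_vec 6" for x unfolding \<psi>_def by (rule vec_of_list_6_carrier)
      show "(\<lambda>x. \<psi> x $ i) \<in> polys 6" if "i < 6" for i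
        using that unfolding less_6 \<psi>_def
        by (elim disjE) (simp_all add: vec6 polys_intros del: vec_of_list_Cons)
    qed
    then have irrB: "E.irreducible_set B" unfolding B_def by (rule E.irreducible_set_image)
    have B_sub: "B \<subseteq> small_space" using chart_in by (auto simp: B_def)
    have in_B: "q \<in> B" if q: "q \<in> W" "hom_s q \<noteq> 0" for q
    proof -
      obtain x where x: "x \<in> carrier_vec 6" "chart_s x = q" using S.surj q W_sub by blast
      have "p1 (base_s x) = 0" using q W_A sub x(2) by (auto simp: chart_s_def)
      then have 0: "(x $ 2)^2 + x $ 0 * (x $ 3)^2 = 0" by (simp add: p1_def)
      \<comment> \<open>If \<open>T = 0\<close>, then \<open>Z = 0\<close> too, and any square root
        of \<open>- a\<close> serves.\<close>
      define l where "l = (if x $ 3 = 0 then csqrt (- x $ 0) else x $ 2 / x $ 3)"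
      have l: "- (l^2) = x $ 0" "l * x $ 3 = x $ 2"
        using 0 by (auto simp: l_def field_simps power_divide add_eq_0_iff2)
      define z where "z = vec_of_list [l, x $ 1, 0, x $ 3, x $ 4, x $ 5]"
      have "\<psi> z = x"
        using x(1) l by (intro eq_vecI) (auto simp: less_6 \<psi>_def z_def vec6 simp del: vec_of_list_Cons)
      moreover have "z \<in> carrier_vec 6" unfolding z_def by (rule vec_of_list_6_carrier)
      ultimately show ?thesis using x(2) unfolding B_def by (intro image_eqI[of _ _ z]) auto
    qed
    define D where "D = zar E.V closure_of B"
    have cl: "q \<in> D \<longleftrightarrow> q \<in> small_space \<and> (\<forall>d. \<forall>k\<in>proj_forms 7 6 d. (\<forall>q\<in>B. k q = 0) \<longrightarrow> k q = 0)" for q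
      unfolding D_def by (rule E.closure_of_iff[OF B_sub])
    have "W \<subseteq> D"
    proof
      fix q assume q: "q \<in> W"
      have "k q = 0" if k: "k \<in> proj_forms 7 6 d" "\<forall>q\<in>B. k q = 0" for k d
      proof -
        have "hom_s q * k q = 0" if "q \<in> W" for q using in_B[OF that] k(2) by auto
        from E.irreducible_setD[OF E.irreducible_closed_imp_irreducible_set[OF W_irr] hom_forms(1) k(1) this]
        show ?thesis using False q by blast
      qed
      then show "q \<in> D" unfolding cl using q W_sub by blast
    qed
    moreover have "W \<noteq> D"
    proof
      assume eq: "W = D"
      \<comment> \<open>The point with \<open>b = T = 1\<close> and \<open>a = Z = 0\<close>, where
        \<open>X = b T = 1\<close>, whereas \<open>X\<close> vanishes on \<open>W\<close>.\<close>
      have "chart_s (\<psi> (vec_of_list [0, 1, 0, 1, 0, 0])) \<in> B" unfolding B_def by (intro imageI vec_of_list_6_carrier)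
      then have "chart_s (\<psi> (vec_of_list [0, 1, 0, 1, 0, 0])) \<in> W" unfolding eq cl using B_sub by blast
      then have "fst (chart_s (\<psi> (vec_of_list [0, 1, 0, 1, 0, 0]))) $ 3 = 0" using W_A sub by blast
      then show False by (simp add: chart_s_def \<psi>_def vec6 del: vec_of_list_Cons)
    qed
    moreover have "D \<noteq> small_space"
    proof
      assume eq: "D = small_space"
      have B0: "p1 (fst q) = 0" if "q \<in> B" for q
        using that by (auto simp: B_def chart_s_def \<psi>_def vec6 p1_def power_mult_distrib simp del: vec_of_list_Cons)
      have "chart_s (vec_of_list [0, 0, 1, 0, 0, 0]) \<in> D" using chart_in(1) eq by simp
      from iffD1[OF cl this, THEN conjunct2, rule_format, OF base_form[OF polys_7_pq(1)] B0]
      have "p1 (fst (chart_s (vec_of_list [0, 0, 1, 0, 0, 0]))) = 0" .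
      then show False by (simp add: chart_s_def p1_def vec6 del: vec_of_list_Cons)
    qed
    moreover have "D \<subseteq> small_space" using cl by blast
    moreover have "irreducible_closed (zar E.V) D" unfolding D_def using irrB by (rule E.irreducible_closed_closure)
    ultimately show ?thesis by blast
  next
    case True
    define \<psi> where "\<psi> x = vec_of_list [x $ 0, x $ 1, x $ 2, x $ 3, 0, x $ 5]" for x :: "complex vec"
    define B where "B = {q \<in> small_space. hom_s q = 0}"
    have param: "E.parametrization 6 (\<lambda>x. chart_t (\<psi> x))"
    proof (rule E.parametrization_comp[OF T.param])
      show "\<psi> x \<in> carrier_vec 6" for x unfolding \<psi>_def by (rule vec_of_list_6_carrier)
      show "(\<lambda>x. \<psi> x $ i) \<in> polys 6" if "i < 6" for i
        using that unfolding less_6 \<psi>_def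
        by (elim disjE) (simp_all add: vec6 polys_intros del: vec_of_list_Cons)
    qed
    have B_eq: "B = (\<lambda>x. chart_t (\<psi> x)) ` carrier_vec 6"
    proof (intro equalityI subsetI)
      fix q assume q: "q \<in> B"
      then have "hom_t q \<noteq> 0" using hom_s_or_hom_t by (auto simp: B_def)
      moreover have "q \<in> small_space" using q by (simp add: B_def)
      ultimately obtain x where x: "x \<in> carrier_vec 6" "chart_t x = q" using T.surj by blast
      have "x $ 4 = 0"
        using T.coords(2)[OF x(1), of 4] x(2) q by (simp add: coord_t_def B_def)
      then have "\<psi> x = x"
        using x(1) by (intro eq_vecI) (auto simp: less_6 \<psi>_def vec6 simp del: vec_of_list_Cons)
      then show "q \<in> (\<lambda>x. chart_t (\<psi> x)) ` carrier_vec 6" using x by (intro image_eqI[of _ _ x]) auto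
    next
      fix q assume "q \<in> (\<lambda>x. chart_t (\<psi> x)) ` carrier_vec 6"
      then obtain x where "q = chart_t (\<psi> x)" by blast
      moreover have "\<psi> x \<in> carrier_vec 6" "\<psi> x $ 4 = 0"
        unfolding \<psi>_def by (rule vec_of_list_6_carrier, simp add: vec6 del: vec_of_list_Cons)
      ultimately show "q \<in> B"
        using T.coords(2)[of "\<psi> x" 4] T.k(2)[of "\<psi> x"] chart_in(2)[of "\<psi> x"] by (simp add: B_def coord_t_def)
    qed
    have closedB: "closedin (zar E.V) B" unfolding B_def by (rule E.closedin_zeros[OF hom_forms(1)])
    have "E.irreducible_set B" unfolding B_eq using param by (rule E.irreducible_set_image)
    then have "irreducible_closed (zar E.V) (zar E.V closure_of B)" by (rule E.irreducible_closed_closure)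
    then have "irreducible_closed (zar E.V) B" by (simp only: closure_of_closedin[OF closedB])
    moreover have "W \<subseteq> B" using True W_sub by (auto simp: B_def)
    moreover have "W \<noteq> B"
    proof
      assume eq: "W = B"
      \<comment> \<open>The point of the divisor with \<open>Y = w = 1\<close> and the other
        coordinates zero, where \<open>X = Y w = 1\<close>.\<close>
      have "chart_t (\<psi> (vec_of_list [0, 0, 1, 0, 0, 1])) \<in> W"
        unfolding eq B_eq by (intro imageI vec_of_list_6_carrier)
      then have "fst (chart_t (\<psi> (vec_of_list [0, 0, 1, 0, 0, 1]))) $ 3 = 0" using W_A sub by blast
      then show False by (simp add: chart_t_def \<psi>_def vec6 del: vec_of_list_Cons)
    qed
    moreover have "B \<noteq> small_space"
      using chart_in(1)[of "0\<^sub>v 6"] S.k(2)[of "0\<^sub>v 6"] by (auto simp: B_def)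
    moreover have "B \<subseteq> small_space" by (auto simp: B_def)
    ultimately show ?thesis by blast
  qed
  then obtain D where D: "irreducible_closed (zar E.V) D" "W \<subset> D" "D \<subset> small_space" by blast
  define c where "c i = (if i = 0 then W else if i = 1 then D else small_space)" for i :: nat
  have "c 0 = W \<and> (\<forall>i\<le>2. irreducible_closed (zar E.V) (c i)) \<and> (\<forall>i<2. c i \<subset> c (Suc i))"
    using D W_irr top by (auto simp: c_def less_2_cases_iff)
  then have "enat 2 \<le> (SUP n\<in>{n. \<exists>c. c 0 = W \<and> (\<forall>i\<le>n. irreducible_closed (zar E.V) (c i)) \<and>
      (\<forall>i<n. c i \<subset> c (Suc i))}. enat n)"
    by (intro SUP_upper) blast
  then show "2 \<le> (SUP n\<in>{n. \<exists>c. c 0 = W \<and> (\<forall>i\<le>n. irreducible_closed (zar E.V) (c i)) \<and>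
      (\<forall>i<n. c i \<subset> c (Suc i))}. enat n)"
    by (simp add: numeral_eq_enat)
qed


section \<open>Elimination for binary forms\<close>

text \<open>The coefficients are total functions. Later \<open>R\<close> consists of the functions
  that are quotients of polynomials near a fixed point \<open>z0\<close>, which models the local
  ring at \<open>z0\<close> without germs.\<close>

locale function_ring =
  fixes R :: "('z \<Rightarrow> complex) set"
  assumes const: "(\<lambda>_. c) \<in> R"
    and add: "f \<in> R \<Longrightarrow> g \<in> R \<Longrightarrow> (\<lambda>z. f z + g z) \<in> R"
    and mult: "f \<in> R \<Longrightarrow> g \<in> R \<Longrightarrow> (\<lambda>z. f z * g z) \<in> R"
begin

lemma uminus: "f \<in> R \<Longrightarrow> (\<lambda>z. - f z) \<in> R"
  using mult[OF const[of "-1"], of f] by simp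

lemma sum: "(\<And>i. i \<in> I \<Longrightarrow> f i \<in> R) \<Longrightarrow> (\<lambda>z. \<Sum>i\<in>I. f i z) \<in> R"
  by (induction I rule: infinite_finite_induct) (auto intro: const add)

lemma prod: "(\<And>i. i \<in> I \<Longrightarrow> f i \<in> R) \<Longrightarrow> (\<lambda>z. \<Prod>i\<in>I. f i z) \<in> R"
  by (induction I rule: infinite_finite_induct) (auto intro: const mult)

lemma det:
  assumes "\<And>i j. i < n \<Longrightarrow> j < n \<Longrightarrow> f i j \<in> R"
  shows "(\<lambda>z. det (mat n n (\<lambda>(i, j). f i j z))) \<in> R"
proof -
  have "det (mat n n (\<lambda>(i, j). f i j z)) =
      (\<Sum>p\<in>{p. p permutes {0..<n}}. signof p * (\<Prod>i = 0..<n. f i (p i) z))" for z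
  proof -
    have "p i < n" if "p permutes {0..<n}" "i < n" for p i using permutes_in_image[OF that(1), of i] that(2) by simp
    then show ?thesis by (subst det_def'[of _ n]) (auto intro!: sum.cong)
  qed
  moreover have "(\<lambda>z. \<Sum>p\<in>{p. p permutes {0..<n}}. signof p * (\<Prod>i = 0..<n. f i (p i) z)) \<in> R"
  proof (intro sum mult prod)
    show "(\<lambda>z. signof p) \<in> R" for p :: "nat \<Rightarrow> nat" by (rule const)
    show "f i (p i) \<in> R" if "p \<in> {p. p permutes {0..<n}}" "i \<in> {0..<n}" for p i
      using permutes_in_image[of p "{0..<n}" i] that assms by auto
  qed
  ultimately show ?thesis by simp
qed

text \<open>Built up degree by degree rather than characterized by homogeneity, so that coefficients
  in \<open>R\<close> can be extracted by induction.\<close>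

inductive binary_form :: "nat \<Rightarrow> ('z \<Rightarrow> complex \<Rightarrow> complex \<Rightarrow> complex) \<Rightarrow> bool" where
  coeff: "r \<in> R \<Longrightarrow> binary_form 0 (\<lambda>z s t. r z)"
| s_mult: "binary_form d f \<Longrightarrow> binary_form (Suc d) (\<lambda>z s t. s * f z s t)"
| t_mult: "binary_form d f \<Longrightarrow> binary_form (Suc d) (\<lambda>z s t. t * f z s t)"
| sum: "binary_form d f \<Longrightarrow> binary_form d g \<Longrightarrow> binary_form d (\<lambda>z s t. f z s t + g z s t)"

lemma binary_form_scale:
  assumes "binary_form d f" "r \<in> R"
  shows "binary_form d (\<lambda>z s t. r z * f z s t)"
  using assms
proof (induction rule: binary_form.induct)
  case (coeff q)
  then show ?case using binary_form.coeff[OF mult[of r q]] by simp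
next
  case (s_mult d f)
  then show ?case using binary_form.s_mult[of d "\<lambda>z s t. r z * f z s t"] by (simp add: mult.left_commute)
next
  case (t_mult d f)
  then show ?case using binary_form.t_mult[of d "\<lambda>z s t. r z * f z s t"] by (simp add: mult.left_commute)
next
  case (sum d f g)
  then show ?case using binary_form.sum[of d "\<lambda>z s t. r z * f z s t"] by (simp add: distrib_left)
qed

lemma binary_form_mult:
  assumes "binary_form d f" "binary_form e g"
  shows "binary_form (d + e) (\<lambda>z s t. f z s t * g z s t)"
  using assms
proof (induction rule: binary_form.induct)
  case (coeff r)
  then show ?case using binary_form_scale[of e g r] by simp
next
  case (s_mult d f)
  then show ?case using binary_form.s_mult[of "d + e" "\<lambda>z s t. f z s t * g z s t"] by (simp add: mult.assoc)
next
  case (t_mult d f)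
  then show ?case using binary_form.t_mult[of "d + e" "\<lambda>z s t. f z s t * g z s t"] by (simp add: mult.assoc)
next
  case (sum d f h)
  then show ?case
    using binary_form.sum[of "d + e" "\<lambda>z s t. f z s t * g z s t" "\<lambda>z s t. h z s t * g z s t"]
    by (simp add: distrib_right)
qed

lemma binary_form_power: "binary_form d f \<Longrightarrow> binary_form (n * d) (\<lambda>z s t. f z s t ^ n)"
proof (induction n)
  case 0
  then show ?case using binary_form.coeff[OF const[of 1]] by simp
next
  case (Suc n)
  then show ?case using binary_form_mult[of d f "n * d" "\<lambda>z s t. f z s t ^ n"] by simp
qed

lemma binary_form_s: "binary_form 1 (\<lambda>z s t. s)"
  using binary_form.s_mult[OF binary_form.coeff[OF const[of 1]]] by simp

lemma binary_form_t: "binary_form 1 (\<lambda>z s t. t)"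
  using binary_form.t_mult[OF binary_form.coeff[OF const[of 1]]] by simp

lemma binary_form_monomial: "binary_form (i + j) (\<lambda>z s t. s ^ i * t ^ j)"
  using binary_form_mult[OF binary_form_power[OF binary_form_s, of i] binary_form_power[OF binary_form_t, of j]] by simp

lemma binary_form_zero: "binary_form d (\<lambda>z s t. 0)"
  using binary_form_scale[OF binary_form_monomial[of d 0] const[of 0]] by simp

lemma binary_form_swap: "binary_form d f \<Longrightarrow> binary_form d (\<lambda>z s t. f z t s)"
  by (induction rule: binary_form.induct) (auto intro: binary_form.intros)

lemma binary_form_expand:
  assumes "binary_form d f"
  shows "\<exists>c. (\<forall>j. c j \<in> R) \<and> (\<forall>z s t. f z s t = (\<Sum>j\<le>d. c j z * (s ^ j * t ^ (d - j))))"
  using assms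
proof induction
  case (coeff r)
  then show ?case by (intro exI[of _ "\<lambda>_. r"]) simp
next
  case (s_mult d f)
  then obtain c where c: "\<forall>j. c j \<in> R" "\<forall>z s t. f z s t = (\<Sum>j\<le>d. c j z * (s ^ j * t ^ (d - j)))" by blast
  show ?case
  proof (intro exI[of _ "\<lambda>j. case j of 0 \<Rightarrow> (\<lambda>_. 0) | Suc i \<Rightarrow> c i"] conjI allI)
    show "s * f z s t = (\<Sum>j\<le>Suc d. (case j of 0 \<Rightarrow> (\<lambda>_. 0) | Suc i \<Rightarrow> c i) z * (s ^ j * t ^ (Suc d - j)))" for z s t
      unfolding sum.atMost_Suc_shift c(2)[rule_format] by (simp add: sum_distrib_left mult_ac)
  qed (use c const in \<open>auto split: nat.split\<close>)
next
  case (t_mult d f)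
  then obtain c where c: "\<forall>j. c j \<in> R" "\<forall>z s t. f z s t = (\<Sum>j\<le>d. c j z * (s ^ j * t ^ (d - j)))" by blast
  show ?case
  proof (intro exI[of _ "\<lambda>j. if j \<le> d then c j else (\<lambda>_. 0)"] conjI allI)
    fix z s t
    have "(\<Sum>j\<le>Suc d. (if j \<le> d then c j else (\<lambda>_. 0)) z * (s ^ j * t ^ (Suc d - j))) =
        (\<Sum>j\<le>d. c j z * (s ^ j * (t * t ^ (d - j))))"
      by (simp add: Suc_diff_le)
    then show "t * f z s t = (\<Sum>j\<le>Suc d. (if j \<le> d then c j else (\<lambda>_. 0)) z * (s ^ j * t ^ (Suc d - j)))"
      unfolding c(2)[rule_format] by (simp add: sum_distrib_left mult.left_commute)
  qed (use c const in auto)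
next
  case (sum d f g)
  then obtain c c' where "\<forall>j. c j \<in> R" "\<forall>z s t. f z s t = (\<Sum>j\<le>d. c j z * (s ^ j * t ^ (d - j)))"
    "\<forall>j. c' j \<in> R" "\<forall>z s t. g z s t = (\<Sum>j\<le>d. c' j z * (s ^ j * t ^ (d - j)))" by blast
  then show ?case
    by (intro exI[of _ "\<lambda>j z. c j z + c' j z"]) (auto intro: add simp: distrib_right sum.distrib)
qed

definition vanishing_form ::
    "('z \<times> complex \<times> complex) set \<Rightarrow> nat \<Rightarrow> ('z \<Rightarrow> complex \<Rightarrow> complex \<Rightarrow> complex) \<Rightarrow> bool" where
  "vanishing_form K d f \<longleftrightarrow> binary_form d f \<and> (\<forall>(z, s, t)\<in>K. f z s t = 0)"

lemma vanishing_form_add: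
  assumes "vanishing_form K d f" "vanishing_form K d g"
  shows "vanishing_form K d (\<lambda>z s t. f z s t + g z s t)"
  using assms binary_form.sum by (auto simp: vanishing_form_def split_beta)

lemma vanishing_form_mult:
  assumes "vanishing_form K d f" "binary_form e g"
  shows "vanishing_form K (d + e) (\<lambda>z s t. f z s t * g z s t)"
  using assms binary_form_mult by (auto simp: vanishing_form_def)

end

text \<open>The weak Nullstellensatz in one variable: a nonzero element of least degree divides all
  others, and any root of it would be a common zero.\<close>

lemma complex_poly_ideal_contains_1:
  fixes J :: "complex poly set"
  assumes add: "\<And>p q. p \<in> J \<Longrightarrow> q \<in> J \<Longrightarrow> p + q \<in> J" and mult: "\<And>p q. p \<in> J \<Longrightarrow> q * p \<in> J"
    and no_zero: "\<And>x. \<exists>p\<in>J. poly p x \<noteq> 0"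
  shows "1 \<in> J"
proof -
  obtain p0 where p0: "p0 \<in> J" "p0 \<noteq> 0" using no_zero[of 0] by force
  define p where "p = (ARG_MIN degree p. p \<in> J \<and> p \<noteq> 0)"
  have p: "p \<in> J" "p \<noteq> 0" "\<And>q. q \<in> J \<Longrightarrow> q \<noteq> 0 \<Longrightarrow> degree p \<le> degree q"
    using arg_min_nat_lemma[of "\<lambda>p. p \<in> J \<and> p \<noteq> 0" p0 degree] p0 unfolding p_def by auto
  have dvd: "p dvd q" if "q \<in> J" for q
  proof (rule ccontr)
    assume "\<not> p dvd q"
    then have "q mod p \<noteq> 0" by (simp add: mod_eq_0_iff_dvd)
    moreover have "q mod p = q + (- (q div p)) * p" by (simp add: minus_div_mult_eq_mod[symmetric])
    then have "q mod p \<in> J" using add[OF that mult[OF p(1)]] by metis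
    ultimately show False using p(3)[of "q mod p"] degree_mod_less[OF p(2), of q] by auto
  qed
  have "degree p = 0"
  proof (rule ccontr)
    assume "degree p \<noteq> 0"
    then have "\<not> constant (poly p)" by (simp add: constant_degree)
    then obtain x where x: "poly p x = 0" using fundamental_theorem_of_algebra by blast
    obtain q where "q \<in> J" "poly q x \<noteq> 0" using no_zero by blast
    with dvd[of q] x show False by (auto elim: dvdE)
  qed
  then obtain c where c: "p = [:c:]" by (rule degree_eq_zeroE)
  then have "[:1 / c:] * p = 1" using p(2) by (simp add: one_pCons)
  then show ?thesis using mult[OF p(1), of "[:1 / c:]"] by simp
qed

lemma coeffs_eq_if_sums_eq:
  fixes c :: "nat \<Rightarrow> complex"
  assumes "\<And>s. (\<Sum>j\<le>d. c j * s ^ j) = s ^ i" "j \<le> d" "i \<le> d"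
  shows "c j = (if j = i then 1 else 0)"
proof -
  have "poly (\<Sum>j\<le>d. monom (c j) j) s = poly (monom 1 i) s" for s
    using assms(1)[of s] by (simp add: poly_sum poly_monom)
  then have "(\<Sum>j\<le>d. monom (c j) j) = monom 1 i" using poly_eq_poly_eq_iff by blast
  then have "coeff (\<Sum>j\<le>d. monom (c j) j) j = coeff (monom 1 i) j" by simp
  moreover have "coeff (\<Sum>j\<le>d. monom (c j) j) j = c j"
    using assms(2) by (simp add: coeff_sum coeff_monom if_distrib cong: if_cong)
  ultimately show ?thesis by (auto simp: coeff_monom)
qed

context function_ring
begin

text \<open>Setting \<open>z = z0\<close> and \<open>t = 1\<close> turns the vanishing forms into an
  ideal of univariate polynomials without common zero. It contains 1, and a form of degree
  \<open>d\<close> that becomes 1 is \<open>t ^ d\<close> over \<open>z0\<close>.\<close>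

lemma vanishing_power:
  assumes no_zero: "\<And>s. \<exists>d f. vanishing_form K d f \<and> f z0 s 1 \<noteq> 0"
  shows "\<exists>d f. vanishing_form K d f \<and> (\<forall>s t. f z0 s t = t ^ d)"
proof -
  define J where "J = {p :: complex poly. \<exists>d f. vanishing_form K d f \<and> (\<forall>s. poly p s = f z0 s 1)}"
  have "1 \<in> J"
  proof (rule complex_poly_ideal_contains_1)
    fix p q :: "complex poly" assume p: "p \<in> J"
    obtain d f where f: "vanishing_form K d f" "\<forall>s. poly p s = f z0 s 1" using p by (auto simp: J_def)
    {
      assume "q \<in> J"
      then obtain e g where g: "vanishing_form K e g" "\<forall>s. poly q s = g z0 s 1" by (auto simp: J_def)
      \<comment> \<open>Powers of \<open>t\<close> equalize the degrees and disappear at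
        \<open>t = 1\<close>.\<close>
      have "vanishing_form K (d + e) (\<lambda>z s t. f z s t * t ^ e)" "vanishing_form K (e + d) (\<lambda>z s t. g z s t * t ^ d)"
        using vanishing_form_mult[OF f(1) binary_form_monomial[of 0 e]]
          vanishing_form_mult[OF g(1) binary_form_monomial[of 0 d]] by simp_all
      then have "vanishing_form K (d + e) (\<lambda>z s t. f z s t * t ^ e + g z s t * t ^ d)"
        by (intro vanishing_form_add) (simp_all only: add.commute[of e d])
      then show "p + q \<in> J" unfolding J_def using f g by force
    }
    define g where "g z s t = (\<Sum>i\<le>degree q. coeff q i * (s ^ i * t ^ (degree q - i)))" for z :: 'z and s t
    have "binary_form n (\<lambda>z s t. \<Sum>i\<in>I. coeff q i * (s ^ i * t ^ (n - i)))" if "I \<subseteq> {..n}" for I n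
      using that
    proof (induction I rule: infinite_finite_induct)
      case (insert i I)
      have "binary_form n (\<lambda>z s t. coeff q i * (s ^ i * t ^ (n - i)))"
        using binary_form_scale[OF binary_form_monomial[of i "n - i"] const[of "coeff q i"]] insert.prems by simp
      then show ?case using insert by (auto intro: binary_form.sum)
    qed (auto intro: binary_form_zero)
    then have "binary_form (degree q) g" unfolding g_def by blast
    from vanishing_form_mult[OF f(1) this]
    have "vanishing_form K (d + degree q) (\<lambda>z s t. f z s t * g z s t)" .
    moreover have "poly (q * p) s = f z0 s 1 * g z0 s 1" for s
      using f(2) by (simp add: g_def poly_altdef[of q])
    ultimately show "q * p \<in> J" unfolding J_def by blast
  next
    fix x
    obtain d f where f: "vanishing_form K d f" "f z0 x 1 \<noteq> 0" using no_zero by blast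
    obtain c where c: "\<forall>z s t. f z s t = (\<Sum>j\<le>d. c j z * (s ^ j * t ^ (d - j)))"
      using binary_form_expand f(1) unfolding vanishing_form_def by blast
    define p where "p = (\<Sum>j\<le>d. monom (c j z0) j)"
    have "poly p s = f z0 s 1" for s using c by (simp add: p_def poly_sum poly_monom)
    then show "\<exists>p\<in>J. poly p x \<noteq> 0" using f by (intro bexI[of _ p]) (auto simp: J_def)
  qed
  then obtain d f where f: "vanishing_form K d f" "\<forall>s. poly 1 s = f z0 s 1" by (auto simp: J_def)
  obtain c where c: "\<forall>z s t. f z s t = (\<Sum>j\<le>d. c j z * (s ^ j * t ^ (d - j)))"
    using binary_form_expand f(1) unfolding vanishing_form_def by blast
  have "c j z0 = (if j = 0 then 1 else 0)" if "j \<le> d" for j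
    by (rule coeffs_eq_if_sums_eq[where d = d and i = 0]) (use c f(2) that in auto)
  then have "f z0 s t = t ^ d" for s t
    unfolding c[rule_format] by (subst sum.cong[OF refl, of _ _ "\<lambda>j. if j = 0 then t ^ d else 0"]) auto
  then show ?thesis using f(1) by blast
qed

text \<open>If the forms vanishing on \<open>K\<close> have no common zero over \<open>z0\<close>, they specialise there to all
  monomials of some degree, and the determinant of their coefficients does not vanish at \<open>z0\<close>.\<close>

lemma elimination:
  assumes no_zero: "\<And>s t. s \<noteq> 0 \<or> t \<noteq> 0 \<Longrightarrow> \<exists>d f. vanishing_form K d f \<and> f z0 s t \<noteq> 0"
  shows "\<exists>\<delta>\<in>R. \<delta> z0 \<noteq> 0 \<and> (\<forall>(z, s, t)\<in>K. s \<noteq> 0 \<or> t \<noteq> 0 \<longrightarrow> \<delta> z = 0)"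
proof -
  obtain d f where f: "vanishing_form K d f" "\<forall>s t. f z0 s t = t ^ d"
    using vanishing_power[of K z0] no_zero[of _ 1] by auto
  define K' where "K' = {(z, t, s) | z s t. (z, s, t) \<in> K}"
  have swap: "vanishing_form K' n (\<lambda>z s t. g z t s)" if "vanishing_form K n g" for n g
    using that binary_form_swap by (auto simp: vanishing_form_def K'_def)
  have swap': "vanishing_form K n (\<lambda>z s t. g z t s)" if "vanishing_form K' n g" for n g
    using that binary_form_swap by (fastforce simp: vanishing_form_def K'_def)
  have "\<exists>d f. vanishing_form K' d f \<and> f z0 t 1 \<noteq> 0" for t
    using no_zero[of 1 t] swap by force
  then obtain e g where "vanishing_form K' e g" "\<forall>s t. g z0 s t = t ^ e"
    using vanishing_power[of K' z0] by blast
  then obtain g where g: "vanishing_form K e g" "\<forall>s t. g z0 s t = s ^ e" using swap' by fastforce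
  \<comment> \<open>In degree \<open>d + e\<close> every monomial is divisible by
    \<open>t ^ d\<close> or by \<open>s ^ e\<close>.\<close>
  define D where "D = d + e"
  have "\<exists>h. vanishing_form K D h \<and> (\<forall>s t. h z0 s t = s ^ j * t ^ (D - j))" if "j \<le> D" for j
  proof (cases "j \<le> e")
    case True
    then have "vanishing_form K D (\<lambda>z s t. f z s t * (s ^ j * t ^ (e - j)))"
      using vanishing_form_mult[OF f(1) binary_form_monomial[of j "e - j"]] by (simp add: D_def)
    moreover have "f z0 s t * (s ^ j * t ^ (e - j)) = s ^ j * t ^ (D - j)" for s t
      using True by (simp add: f(2) D_def power_add[symmetric])
    ultimately show ?thesis by blast
  next
    case False
    then have "vanishing_form K D (\<lambda>z s t. g z s t * (s ^ (j - e) * t ^ (D - j)))"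
      using vanishing_form_mult[OF g(1) binary_form_monomial[of "j - e" "D - j"]] that by (simp add: D_def)
    moreover have "g z0 s t * (s ^ (j - e) * t ^ (D - j)) = s ^ j * t ^ (D - j)" for s t
      using False by (simp add: g(2) mult.assoc[symmetric] power_add[symmetric])
    ultimately show ?thesis by blast
  qed
  then obtain h where h: "\<And>j. j \<le> D \<Longrightarrow> vanishing_form K D (h j)"
    "\<And>j s t. j \<le> D \<Longrightarrow> h j z0 s t = s ^ j * t ^ (D - j)" by metis
  have "\<exists>c. (\<forall>j. c j \<in> R) \<and> (\<forall>z s t. h i z s t = (\<Sum>j\<le>D. c j z * (s ^ j * t ^ (D - j))))" if "i \<le> D" for i
    using binary_form_expand h(1)[OF that] unfolding vanishing_form_def by blast
  then obtain c where c: "\<And>i j. i \<le> D \<Longrightarrow> c i j \<in> R"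
    "\<And>i z s t. i \<le> D \<Longrightarrow> h i z s t = (\<Sum>j\<le>D. c i j z * (s ^ j * t ^ (D - j)))" by metis
  define A where "A z = mat (Suc D) (Suc D) (\<lambda>(i, j). c i j z)" for z
  have A: "A z \<in> carrier_mat (Suc D) (Suc D)" for z by (simp add: A_def)
  have "c i j z0 = (if j = i then 1 else 0)" if "i \<le> D" "j \<le> D" for i j
    by (rule coeffs_eq_if_sums_eq[where d = D and i = i]) (use c(2)[OF that(1), of z0 _ 1] h(2)[OF that(1), of _ 1] that in auto)
  then have "A z0 = 1\<^sub>m (Suc D)" by (intro eq_matI) (auto simp: A_def)
  then have "det (A z0) \<noteq> 0" by simp
  moreover have "det (A z) = 0" if z: "(z, s, t) \<in> K" "s \<noteq> 0 \<or> t \<noteq> 0" for z s t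
  proof -
    \<comment> \<open>Over a point of \<open>K\<close> the monomials in \<open>(s, t)\<close> form a
      nonzero kernel vector of the coefficient matrix, because each row is a form vanishing on
      \<open>K\<close>.\<close>
    define v where "v = vec (Suc D) (\<lambda>j. s ^ j * t ^ (D - j))"
    have "v $ 0 = t ^ D" "v $ D = s ^ D" by (simp_all add: v_def)
    then have "v \<noteq> 0\<^sub>v (Suc D)" using z(2) by (metis index_zero_vec(1) lessI power_not_zero zero_less_Suc)
    moreover have "A z *\<^sub>v v = 0\<^sub>v (Suc D)"
    proof (rule eq_vecI)
      fix i assume "i < dim_vec (0\<^sub>v (Suc D))"
      then have i: "i \<le> D" by simp
      have "(A z *\<^sub>v v) $ i = (\<Sum>j = 0..<Suc D. c i j z * (s ^ j * t ^ (D - j)))"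
        using i by (simp add: A_def v_def scalar_prod_def)
      also have "\<dots> = h i z s t" using c(2)[OF i] by (simp add: atLeast0LessThan lessThan_Suc_atMost)
      also have "\<dots> = 0" using h(1)[OF i] z(1) by (auto simp: vanishing_form_def)
      finally show "(A z *\<^sub>v v) $ i = 0\<^sub>v (Suc D) $ i" using i by simp
    qed (simp add: A_def)
    moreover have "v \<in> carrier_vec (Suc D)" by (simp add: v_def)
    ultimately show ?thesis using det_0_iff_vec_prod_zero_field[OF A] by blast
  qed
  moreover have "(\<lambda>z. det (A z)) \<in> R" unfolding A_def by (rule det) (use c(1) in auto)
  ultimately show ?thesis by (intro bexI[of _ "\<lambda>z. det (A z)"]) auto
qed

end


section \<open>Elimination on a bundle of conics\<close>

locale conic_bundle = function_ring +
  fixes \<kappa> :: "'a \<Rightarrow> complex \<Rightarrow> complex \<Rightarrow> complex"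
  assumes \<kappa>: "binary_form 2 \<kappa>"
begin

text \<open>Forms of degree \<open>d - 1\<close>; for \<open>d = 0\<close> only the zero form.\<close>

definition pred_form :: "nat \<Rightarrow> ('a \<Rightarrow> complex \<Rightarrow> complex \<Rightarrow> complex) \<Rightarrow> bool" where
  "pred_form d f \<longleftrightarrow> f = (\<lambda>z s t. 0) \<or> (\<exists>e. d = Suc e \<and> binary_form e f)"

text \<open>The forms of degree \<open>d\<close> in \<open>(s, t, w)\<close>, reduced by \<open>w\<^sup>2 = \<kappa> z s t\<close>.\<close>

definition conic_form :: "nat \<Rightarrow> ('a \<Rightarrow> complex \<Rightarrow> complex \<Rightarrow> complex \<Rightarrow> complex) \<Rightarrow> bool" where
  "conic_form d f \<longleftrightarrow> (\<exists>a b. binary_form d a \<and> pred_form d b \<and>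
    (\<forall>z s t w. w^2 = \<kappa> z s t \<longrightarrow> f z s t w = a z s t + w * b z s t))"

lemma pred_form_add: "pred_form d f \<Longrightarrow> pred_form d g \<Longrightarrow> pred_form d (\<lambda>z s t. f z s t + g z s t)"
  unfolding pred_form_def using binary_form.sum by auto

lemma pred_form_mult:
  "binary_form d f \<Longrightarrow> pred_form e g \<Longrightarrow> pred_form (d + e) (\<lambda>z s t. f z s t * g z s t)"
  unfolding pred_form_def using binary_form_mult by auto

lemma pred_form_mult_\<kappa>:
  assumes "pred_form d f" "pred_form e g"
  shows "binary_form (d + e) (\<lambda>z s t. \<kappa> z s t * (f z s t * g z s t))"
  using assms unfolding pred_form_def
proof (elim disjE exE conjE)
  fix d' e' assume "d = Suc d'" "binary_form d' f" "e = Suc e'" "binary_form e' g"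
  then show ?thesis using binary_form_mult[OF \<kappa> binary_form_mult[of d' f e' g]] by simp
qed (auto intro: binary_form_zero)

lemma conic_form_add:
  assumes "conic_form d f" "conic_form d g"
  shows "conic_form d (\<lambda>z s t w. f z s t w + g z s t w)"
proof -
  obtain a b a' b' where "binary_form d a" "pred_form d b" "binary_form d a'" "pred_form d b'"
    "\<forall>z s t w. w^2 = \<kappa> z s t \<longrightarrow> f z s t w = a z s t + w * b z s t"
    "\<forall>z s t w. w^2 = \<kappa> z s t \<longrightarrow> g z s t w = a' z s t + w * b' z s t"
    using assms unfolding conic_form_def by blast
  then show ?thesis
    unfolding conic_form_def
    by (intro exI[of _ "\<lambda>z s t. a z s t + a' z s t"] exI[of _ "\<lambda>z s t. b z s t + b' z s t"])
      (auto intro: binary_form.sum pred_form_add simp: algebra_simps)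
qed

lemma conic_form_mult:
  assumes "conic_form d f" "conic_form e g"
  shows "conic_form (d + e) (\<lambda>z s t w. f z s t w * g z s t w)"
proof -
  obtain a b a' b' where ab: "binary_form d a" "pred_form d b" "binary_form e a'" "pred_form e b'"
    and eq: "\<forall>z s t w. w^2 = \<kappa> z s t \<longrightarrow> f z s t w = a z s t + w * b z s t"
    "\<forall>z s t w. w^2 = \<kappa> z s t \<longrightarrow> g z s t w = a' z s t + w * b' z s t"
    using assms unfolding conic_form_def by blast
  have "binary_form (d + e) (\<lambda>z s t. a z s t * a' z s t + \<kappa> z s t * (b z s t * b' z s t))"
    using ab by (intro binary_form.sum binary_form_mult pred_form_mult_\<kappa>)
  moreover have "pred_form (d + e) (\<lambda>z s t. a z s t * b' z s t + a' z s t * b z s t)"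
    using pred_form_mult[OF ab(1,4)] pred_form_mult[OF ab(3,2)]
    by (intro pred_form_add) (simp_all add: add.commute)
  moreover have "f z s t w * g z s t w = a z s t * a' z s t + \<kappa> z s t * (b z s t * b' z s t) +
      w * (a z s t * b' z s t + a' z s t * b z s t)" if "w^2 = \<kappa> z s t" for z s t w
    using eq that by (simp add: algebra_simps power2_eq_square flip: that)
  ultimately show ?thesis unfolding conic_form_def by blast
qed

lemma conic_form_binary: "binary_form d f \<Longrightarrow> conic_form d (\<lambda>z s t w. f z s t)"
  unfolding conic_form_def pred_form_def by (intro exI[of _ f] exI[of _ "\<lambda>z s t. 0"]) auto

lemma conic_form_coeff: "r \<in> R \<Longrightarrow> conic_form 0 (\<lambda>z s t w. r z)"
  using conic_form_binary[OF binary_form.coeff] .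

lemma conic_form_scale: "conic_form d f \<Longrightarrow> r \<in> R \<Longrightarrow> conic_form d (\<lambda>z s t w. r z * f z s t w)"
  using conic_form_mult[OF conic_form_coeff, of r d f] by simp

lemma conic_form_uminus: "conic_form d f \<Longrightarrow> conic_form d (\<lambda>z s t w. - f z s t w)"
  using conic_form_scale[of d f "\<lambda>_. -1"] const[of "-1"] by simp

lemma conic_form_diff:
  "conic_form d f \<Longrightarrow> conic_form d g \<Longrightarrow> conic_form d (\<lambda>z s t w. f z s t w - g z s t w)"
  using conic_form_add[of d f "\<lambda>z s t w. - g z s t w"] conic_form_uminus[of d g] by simp

lemma conic_form_s: "conic_form 1 (\<lambda>z s t w. s)"
  using conic_form_binary[OF binary_form_s] .

lemma conic_form_t: "conic_form 1 (\<lambda>z s t w. t)"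
  using conic_form_binary[OF binary_form_t] .

lemma conic_form_w: "conic_form 1 (\<lambda>z s t w. w)"
  unfolding conic_form_def pred_form_def
  by (intro exI[of _ "\<lambda>z s t. 0"] exI[of _ "\<lambda>z s t. 1"])
    (use binary_form_zero binary_form.coeff[OF const[of 1]] in auto)

lemma conic_form_zero: "conic_form d (\<lambda>z s t w. 0)"
  using conic_form_binary[OF binary_form_zero] .

lemma conic_form_power:
  assumes "conic_form d f"
  shows "conic_form (n * d) (\<lambda>z s t w. f z s t w ^ n)"
proof (induction n)
  case 0
  then show ?case using conic_form_coeff[OF const[of 1]] by simp
next
  case (Suc n)
  then show ?case using conic_form_mult[OF assms Suc] by simp
qed

text \<open>For \<open>f = a + w b\<close> this is the norm \<open>a^2 - \<kappa> b^2\<close>, from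
  which \<open>w\<close> has disappeared.\<close>

lemma conic_form_norm:
  assumes "conic_form d f"
  shows "\<exists>g. binary_form (d + d) g \<and> (\<forall>z s t w. w^2 = \<kappa> z s t \<longrightarrow> g z s t = f z s t w * f z s t (- w))"
proof -
  obtain a b where ab: "binary_form d a" "pred_form d b"
    and eq: "\<forall>z s t w. w^2 = \<kappa> z s t \<longrightarrow> f z s t w = a z s t + w * b z s t"
    using assms unfolding conic_form_def by blast
  have "binary_form (d + d) (\<lambda>z s t. a z s t * a z s t + (- 1) * (\<kappa> z s t * (b z s t * b z s t)))"
    using ab by (intro binary_form.sum binary_form_mult pred_form_mult_\<kappa> binary_form_scale[OF _ const])
  moreover have "a z s t * a z s t + (- 1) * (\<kappa> z s t * (b z s t * b z s t)) = f z s t w * f z s t (- w)"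
    if "w^2 = \<kappa> z s t" for z s t w
  proof -
    have "f z s t w = a z s t + w * b z s t" "f z s t (- w) = a z s t + (- w) * b z s t"
      using eq that by auto
    moreover have "a z s t * a z s t + (- 1) * (\<kappa> z s t * (b z s t * b z s t)) =
        (a z s t + w * b z s t) * (a z s t + (- w) * b z s t)"
      by (simp add: algebra_simps power2_eq_square flip: that)
    ultimately show ?thesis by simp
  qed
  ultimately show ?thesis by blast
qed

text \<open>The norm of a form is the product of its values at the conjugate points \<open>w\<close>
  and \<open>- w\<close>. To keep it nonzero over \<open>z0\<close>, one form vanishing on
  \<open>K\<close> is needed that vanishes at neither of the two points.\<close>

lemma conic_elimination:
  assumes K: "\<And>z s t w. (z, s, t, w) \<in> K \<Longrightarrow> w^2 = \<kappa> z s t \<and> (s \<noteq> 0 \<or> t \<noteq> 0)"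
    and no_zero: "\<And>s t w. s \<noteq> 0 \<or> t \<noteq> 0 \<Longrightarrow> w^2 = \<kappa> z0 s t \<Longrightarrow>
      \<exists>d f. conic_form d f \<and> (\<forall>(z, s, t, w)\<in>K. f z s t w = 0) \<and> f z0 s t w \<noteq> 0"
  shows "\<exists>\<delta>\<in>R. \<delta> z0 \<noteq> 0 \<and> (\<forall>(z, s, t, w)\<in>K. \<delta> z = 0)"
proof -
  define K' where "K' = {(z, s, t) | z s t w. (z, s, t, w) \<in> K}"
  have "\<exists>d f. vanishing_form K' d f \<and> f z0 s t \<noteq> 0" if st: "s \<noteq> 0 \<or> t \<noteq> 0" for s t
  proof -
    obtain w where w: "w^2 = \<kappa> z0 s t" using power2_csqrt by blast
    then have w': "(- w)^2 = \<kappa> z0 s t" by simp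
    obtain d f where f: "conic_form d f" "\<forall>(z, s, t, w)\<in>K. f z s t w = 0" "f z0 s t w \<noteq> 0"
      using no_zero[OF st w] by blast
    obtain e g where g: "conic_form e g" "\<forall>(z, s, t, w)\<in>K. g z s t w = 0" "g z0 s t (- w) \<noteq> 0"
      using no_zero[OF st w'] by blast
    \<comment> \<open>Either \<open>s\<close> or \<open>t\<close>: it takes the same nonzero value
      at both points, and its powers bring \<open>f\<close> and \<open>g\<close> to a common
      degree.\<close>
    obtain l where l: "conic_form 1 l" "l z0 s t w \<noteq> 0" "l z0 s t (- w) \<noteq> 0"
      using st conic_form_s conic_form_t by (metis (mono_tags, lifting))
    define f' where "f' z s t w = l z s t w ^ e * f z s t w" for z s t w
    define g' where "g' z s t w = l z s t w ^ d * g z s t w" for z s t w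
    have f': "conic_form (d + e) f'" "\<forall>(z, s, t, w)\<in>K. f' z s t w = 0" "f' z0 s t w \<noteq> 0"
      using conic_form_mult[OF conic_form_power[OF l(1)] f(1), of e] f l
      by (auto simp: f'_def[abs_def] add.commute)
    have g': "conic_form (d + e) g'" "\<forall>(z, s, t, w)\<in>K. g' z s t w = 0" "g' z0 s t (- w) \<noteq> 0"
      using conic_form_mult[OF conic_form_power[OF l(1)] g(1), of d] g l by (auto simp: g'_def[abs_def])
    have "\<exists>h. conic_form (d + e) h \<and> (\<forall>(z, s, t, w)\<in>K. h z s t w = 0) \<and> h z0 s t w \<noteq> 0 \<and> h z0 s t (- w) \<noteq> 0"
    \<comment> \<open>If each form vanishes at the point assigned to the other, their sum vanishes
      at neither; otherwise one of them already works.\<close>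
    proof (cases "f' z0 s t (- w) = 0 \<and> g' z0 s t w = 0")
      case True
      then show ?thesis
        using f' g' by (intro exI[of _ "\<lambda>z s t w. f' z s t w + g' z s t w"]) (auto intro: conic_form_add simp: split_beta)
    next
      case False
      then show ?thesis using f' g' by blast
    qed
    then obtain h where h: "conic_form (d + e) h" "\<forall>(z, s, t, w)\<in>K. h z s t w = 0"
      "h z0 s t w \<noteq> 0" "h z0 s t (- w) \<noteq> 0" by blast
    obtain n where n: "binary_form (d + e + (d + e)) n"
      "\<forall>z s t w. w^2 = \<kappa> z s t \<longrightarrow> n z s t = h z s t w * h z s t (- w)"
      using conic_form_norm[OF h(1)] by blast
    have "n z s t = 0" if in_K': "(z, s, t) \<in> K'" for z s t
    proof -
      obtain w where "(z, s, t, w) \<in> K" using in_K' by (auto simp: K'_def)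
      then show ?thesis using n(2) K h(2) by fastforce
    qed
    then have "vanishing_form K' (d + e + (d + e)) n" using n(1) by (auto simp: vanishing_form_def)
    moreover have "n z0 s t \<noteq> 0" using n(2) w h(3,4) by simp
    ultimately show ?thesis by blast
  qed
  from elimination[OF this] obtain \<delta> where \<delta>: "\<delta> \<in> R" "\<delta> z0 \<noteq> 0"
    "\<forall>(z, s, t)\<in>K'. s \<noteq> 0 \<or> t \<noteq> 0 \<longrightarrow> \<delta> z = 0" by blast
  have "\<delta> z = 0" if "(z, s, t, w) \<in> K" for z s t w
  proof -
    have "(z, s, t) \<in> K'" using that by (auto simp: K'_def)
    then show ?thesis using \<delta>(3) K[OF that] by blast
  qed
  then show ?thesis using \<delta>(1,2) by (intro bexI[of _ \<delta>]) auto
qed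

end


section \<open>Universal closedness\<close>

text \<open>With \<open>P\<close> the forms of one degree, these are functions on a product that are
  homogeneous of that degree in the first factor.\<close>

inductive_set tensor :: "('p \<Rightarrow> complex) set \<Rightarrow> ('q \<Rightarrow> complex) set \<Rightarrow> ('p \<times> 'q \<Rightarrow> complex) set"
  for P :: "('p \<Rightarrow> complex) set" and Q :: "('q \<Rightarrow> complex) set" where
  pure: "g \<in> P \<Longrightarrow> h \<in> Q \<Longrightarrow> (\<lambda>q. g (fst q) * h (snd q)) \<in> tensor P Q"
| add: "f \<in> tensor P Q \<Longrightarrow> g \<in> tensor P Q \<Longrightarrow> (\<lambda>q. f q + g q) \<in> tensor P Q"

lemma tensor_mult:
  assumes "f \<in> tensor P Q" "g \<in> tensor P' Q'"
    and P: "\<And>f g. f \<in> P \<Longrightarrow> g \<in> P' \<Longrightarrow> (\<lambda>p. f p * g p) \<in> P''"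
    and Q: "\<And>f g. f \<in> Q \<Longrightarrow> g \<in> Q' \<Longrightarrow> (\<lambda>p. f p * g p) \<in> Q''"
  shows "(\<lambda>q. f q * g q) \<in> tensor P'' Q''"
  using assms(1)
proof induction
  case (pure a b)
  from assms(2) show ?case
  proof induction
    case (pure a' b')
    from tensor.pure[OF P[OF \<open>a \<in> P\<close> pure(1)] Q[OF \<open>b \<in> Q\<close> pure(2)]]
    show ?case by (simp add: mult_ac)
  next
    case (add f g)
    then show ?case using tensor.add by (fastforce simp: distrib_left)
  qed
next
  case (add f f')
  from tensor.add[OF add.IH] show ?case by (simp add: distrib_right)
qed

context graded_variety
begin

text \<open>The product topology is defined through regular functions on boxes. Clearing
  denominators and multiplying by functions that cut out the box yields a neighbourhood given by a
  single homogeneous function on the whole product.\<close>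

lemma zar_product_affine_basis:
  assumes Z: "graded_variety Z S (\<lambda>_. Q)" and "openin (zar_product X Z) W" "p \<in> W"
  shows "\<exists>d. \<exists>g\<in>tensor (P d) Q. g p \<noteq> 0 \<and> (\<forall>q\<in>C \<times> S. g q \<noteq> 0 \<longrightarrow> q \<in> W)"
proof -
  interpret Z: graded_variety Z S "\<lambda>_. Q" by fact
  have tmult: "(\<lambda>q. f q * g q) \<in> tensor (P (d + e)) Q" if "f \<in> tensor (P d) Q" "g \<in> tensor (P e) Q" for f g d e
    using that by (rule tensor_mult) (auto intro: mult Z.mult)
  have tmult': "(\<lambda>q. f q * g q) \<in> tensor (P (e + d)) Q" if "f \<in> tensor (P d) Q" "g \<in> tensor (P e) Q" for f g d e
    using tmult[OF that] by (simp add: add.commute)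
  have one: "(\<lambda>_. c) \<in> tensor (P 0) Q" for c
    using tensor.pure[OF const[of c] Z.const[of 1]] by simp
  have fraction: "\<exists>d. \<exists>g\<in>tensor (P d) Q. \<exists>k\<in>tensor (P d) Q. k p \<noteq> 0 \<and>
      (\<forall>q\<in>C \<times> S. k q \<noteq> 0 \<longrightarrow> q \<in> U \<times> V \<longrightarrow> h q = g q / k q)"
    if h: "h \<in> algebra_generated ({f \<circ> fst | f. f \<in> reg X U} \<union> {g \<circ> snd | g. g \<in> reg Z V})"
      and U: "openin (zar X) U" and V: "openin (zar Z) V" and p: "p \<in> U \<times> V" for h U V p
    using h
  proof induction
    case (const c)
    show ?case
      by (rule exI[of _ 0], rule bexI[OF _ one[of c]], rule bexI[OF _ one[of 1]]) simp
  next
    case (gen h)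
    then consider f where "h = f \<circ> fst" "f \<in> reg X U" | f where "h = f \<circ> snd" "f \<in> reg Z V" by blast
    then show ?case
    proof cases
      case 1
      have "fst p \<in> U" using p by auto
      then obtain d g k where k: "g \<in> P d" "k \<in> P d" "k (fst p) \<noteq> 0"
        "\<And>q. q \<in> C \<Longrightarrow> k q \<noteq> 0 \<Longrightarrow> q \<in> U \<and> f q = g q / k q"
        using 1(2) unfolding reg_iff[OF U] by blast
      show ?thesis
        by (rule exI[of _ d], rule bexI[OF _ tensor.pure[OF k(1) Z.const[of 1]]],
          rule bexI[OF _ tensor.pure[OF k(2) Z.const[of 1]]]) (use k(3,4) 1(1) in auto)
    next
      case 2
      have "snd p \<in> V" using p by auto
      then obtain g k where k: "g \<in> Q" "k \<in> Q" "k (snd p) \<noteq> 0"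
        "\<And>q. q \<in> S \<Longrightarrow> k q \<noteq> 0 \<Longrightarrow> q \<in> V \<and> f q = g q / k q"
        using 2(2) unfolding Z.reg_iff[OF V] by blast
      show ?thesis
        by (rule exI[of _ 0], rule bexI[OF _ tensor.pure[OF graded_variety.const[OF graded_variety_axioms, of 1] k(1)]],
          rule bexI[OF _ tensor.pure[OF graded_variety.const[OF graded_variety_axioms, of 1] k(2)]])
          (use k(3,4) 2(1) in auto)
    qed
  next
    case (add f f')
    obtain d g k where k: "g \<in> tensor (P d) Q" "k \<in> tensor (P d) Q" "k p \<noteq> 0"
      "\<forall>q\<in>C \<times> S. k q \<noteq> 0 \<longrightarrow> q \<in> U \<times> V \<longrightarrow> f q = g q / k q" using add.IH(1) by blast
    obtain e g' k' where k': "g' \<in> tensor (P e) Q" "k' \<in> tensor (P e) Q" "k' p \<noteq> 0"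
      "\<forall>q\<in>C \<times> S. k' q \<noteq> 0 \<longrightarrow> q \<in> U \<times> V \<longrightarrow> f' q = g' q / k' q" using add.IH(2) by blast
    have "f q + f' q = (g q * k' q + g' q * k q) / (k q * k' q)"
      if "q \<in> C \<times> S" "q \<in> U \<times> V" "k q \<noteq> 0" "k' q \<noteq> 0" for q
    proof -
      have "f q = g q / k q" "f' q = g' q / k' q" using k(4) k'(4) that by blast+
      then show ?thesis using that(3,4) by (simp add: add_frac_eq)
    qed
    then show ?case
      by (intro exI[of _ "d + e"] bexI[OF _ tensor.add[OF tmult[OF k(1) k'(2)] tmult'[OF k'(1) k(2)]]]
        bexI[OF _ tmult[OF k(2) k'(2)]]) (use k(3) k'(3) in simp)
  next
    case (mult f f')
    obtain d g k where k: "g \<in> tensor (P d) Q" "k \<in> tensor (P d) Q" "k p \<noteq> 0"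
      "\<forall>q\<in>C \<times> S. k q \<noteq> 0 \<longrightarrow> q \<in> U \<times> V \<longrightarrow> f q = g q / k q" using mult.IH(1) by blast
    obtain e g' k' where k': "g' \<in> tensor (P e) Q" "k' \<in> tensor (P e) Q" "k' p \<noteq> 0"
      "\<forall>q\<in>C \<times> S. k' q \<noteq> 0 \<longrightarrow> q \<in> U \<times> V \<longrightarrow> f' q = g' q / k' q" using mult.IH(2) by blast
    have "f q * f' q = (g q * g' q) / (k q * k' q)"
      if "q \<in> C \<times> S" "q \<in> U \<times> V" "k q \<noteq> 0" "k' q \<noteq> 0" for q
    proof -
      have "f q = g q / k q" "f' q = g' q / k' q" using k(4) k'(4) that by blast+
      then show ?thesis by simp
    qed
    then show ?case
      by (intro exI[of _ "d + e"] bexI[OF _ tmult[OF k(1) k'(1)]]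
        bexI[OF _ tmult[OF k(2) k'(2)]]) (use k(3) k'(3) in simp)
  qed
  have "generate_topology_on {{p \<in> U \<times> V. h p \<noteq> 0} | U V h. openin (zar X) U \<and> openin (zar Z) V \<and>
      h \<in> algebra_generated ({f \<circ> fst | f. f \<in> reg X U} \<union> {g \<circ> snd | g. g \<in> reg Z V})} W"
    using assms(2) unfolding zar_product_def by (simp add: openin_topology_generated_by_iff)
  then show ?thesis using assms(3)
  proof (induction arbitrary: p)
    case Empty
    then show ?case by simp
  next
    case (Int A B)
    then have "p \<in> A" "p \<in> B" by auto
    obtain d f where f: "f \<in> tensor (P d) Q" "f p \<noteq> 0" "\<forall>q\<in>C \<times> S. f q \<noteq> 0 \<longrightarrow> q \<in> A"
      using Int.IH(1)[OF \<open>p \<in> A\<close>] by blast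
    obtain e g where g: "g \<in> tensor (P e) Q" "g p \<noteq> 0" "\<forall>q\<in>C \<times> S. g q \<noteq> 0 \<longrightarrow> q \<in> B"
      using Int.IH(2)[OF \<open>p \<in> B\<close>] by blast
    have "f p * g p \<noteq> 0 \<and> (\<forall>q\<in>C \<times> S. f q * g q \<noteq> 0 \<longrightarrow> q \<in> A \<inter> B)"
      using f(2,3) g(2,3) by simp
    then show ?case by (intro exI[of _ "d + e"] bexI[OF _ tmult[OF f(1) g(1)]])
  next
    case (UN K)
    then obtain A where A: "A \<in> K" "p \<in> A" by blast
    from UN.IH[OF this] show ?case using A(1) by (meson UnionI)
  next
    case (Basis A)
    then obtain U V h where U: "openin (zar X) U" and V: "openin (zar Z) V"
      and h: "h \<in> algebra_generated ({f \<circ> fst | f. f \<in> reg X U} \<union> {g \<circ> snd | g. g \<in> reg Z V})"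
      and A: "A = {p \<in> U \<times> V. h p \<noteq> 0}" by blast
    have p: "p \<in> U \<times> V" "h p \<noteq> 0" using Basis A by auto
    obtain d g k where k: "g \<in> tensor (P d) Q" "k \<in> tensor (P d) Q" "k p \<noteq> 0"
      "\<forall>q\<in>C \<times> S. k q \<noteq> 0 \<longrightarrow> q \<in> U \<times> V \<longrightarrow> h q = g q / k q" using fraction[OF h U V p(1)] by blast
    obtain e a where a: "a \<in> P e" "a (fst p) \<noteq> 0" "\<forall>q\<in>C. a q \<noteq> 0 \<longrightarrow> q \<in> U"
      using U p(1) unfolding open_iff by (metis mem_Times_iff)
    obtain b where b: "b \<in> Q" "b (snd p) \<noteq> 0" "\<forall>q\<in>S. b q \<noteq> 0 \<longrightarrow> q \<in> V"
      using V p(1) unfolding Z.open_iff by (metis mem_Times_iff)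
    have in_C: "p \<in> C \<times> S" using p(1) U V unfolding open_iff Z.open_iff by auto
    have gp: "g p \<noteq> 0" using k(3,4) p in_C by fastforce
    show ?case
    \<comment> \<open>Where \<open>g\<close> and \<open>k\<close> are nonzero, so is
      \<open>h = g / k\<close>; the factors \<open>a\<close> and \<open>b\<close> confine the point
      to the box on which this fraction is valid.\<close>
    proof (rule exI[of _ "d + d + e"], rule bexI[OF _ tmult[OF tmult[OF k(1,2)] tensor.pure[OF a(1) b(1)]]])
      show "g p * k p * (a (fst p) * b (snd p)) \<noteq> 0 \<and>
          (\<forall>q\<in>C \<times> S. g q * k q * (a (fst q) * b (snd q)) \<noteq> 0 \<longrightarrow> q \<in> A)"
        using gp k(3,4) a b unfolding A by auto
    qed
  qed
qed

end

text \<open>\<^const>\<open>homog_polys\<close> asks only for homogeneity as a function; elimination needs forms built up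
  degree by degree, which are obtained by splitting a polynomial into homogeneous components.\<close>

inductive graded_poly :: "nat \<Rightarrow> nat \<Rightarrow> nat \<Rightarrow> (complex vec \<times> complex vec \<Rightarrow> complex) \<Rightarrow> bool"
  for n r :: nat where
  const: "graded_poly n r 0 (\<lambda>_. c)"
| base: "i < n \<Longrightarrow> graded_poly n r 0 (\<lambda>p. fst p $ i)"
| fibre: "j < r \<Longrightarrow> graded_poly n r 1 (\<lambda>p. snd p $ j)"
| zero: "graded_poly n r d (\<lambda>_. 0)"
| add: "graded_poly n r d f \<Longrightarrow> graded_poly n r d g \<Longrightarrow> graded_poly n r d (\<lambda>p. f p + g p)"
| mult: "graded_poly n r d f \<Longrightarrow> graded_poly n r e g \<Longrightarrow> graded_poly n r (d + e) (\<lambda>p. f p * g p)"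

lemma graded_poly_smult:
  assumes "graded_poly n r d f" "u \<in> carrier_vec r"
  shows "f (x, c \<cdot>\<^sub>v u) = c ^ d * f (x, u)"
  using assms by (induction rule: graded_poly.induct) (auto simp: power_add algebra_simps)

inductive_set graded_sums :: "nat \<Rightarrow> nat \<Rightarrow> (complex vec \<times> complex vec \<Rightarrow> complex) set"
  for n r :: nat where
  graded: "graded_poly n r d f \<Longrightarrow> f \<in> graded_sums n r"
| add: "f \<in> graded_sums n r \<Longrightarrow> g \<in> graded_sums n r \<Longrightarrow> (\<lambda>p. f p + g p) \<in> graded_sums n r"

lemma graded_sums_mult:
  assumes "f \<in> graded_sums n r" "g \<in> graded_sums n r"
  shows "(\<lambda>p. f p * g p) \<in> graded_sums n r"
  using assms(1)
proof induction
  case (graded d f)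
  from assms(2) show ?case
  proof induction
    case (graded e g)
    from graded_sums.graded[OF graded_poly.mult[OF \<open>graded_poly n r d f\<close> graded]] show ?case .
  next
    case (add g h)
    from graded_sums.add[OF add.IH] show ?case by (simp add: distrib_left)
  qed
next
  case (add f h)
  from graded_sums.add[OF add.IH] show ?case by (simp add: distrib_right)
qed

lemma algebra_generated_subset_graded_sums: "algebra_generated (proj_gens n r) \<subseteq> graded_sums n r"
proof
  fix f assume "f \<in> algebra_generated (proj_gens n r)"
  then show "f \<in> graded_sums n r"
  proof induction
    case (const c)
    show ?case by (rule graded_sums.graded[OF graded_poly.const])
  next
    case (gen f)
    then consider i where "i < n" "f = (\<lambda>p. fst p $ i)" | j where "j < r" "f = (\<lambda>p. snd p $ j)"
      by (auto simp: split_def)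
    then show ?case
      by cases (auto intro: graded_sums.graded[OF graded_poly.base] graded_sums.graded[OF graded_poly.fibre])
  qed (auto intro: graded_sums.add graded_sums_mult)
qed

lemma graded_sums_decompose:
  assumes "f \<in> graded_sums n r"
  shows "\<exists>G N. (\<forall>e. graded_poly n r e (G e)) \<and> (\<forall>e>N. G e = (\<lambda>_. 0)) \<and> (\<forall>p. f p = (\<Sum>e\<le>N. G e p))"
  using assms
proof induction
  case (graded d f)
  have "(\<Sum>e\<le>d. (if e = d then f else (\<lambda>_. 0)) p) = (\<Sum>e\<le>d. if e = d then f p else 0)" for p
    by (intro sum.cong) auto
  then show ?case
    by (intro exI[of _ "\<lambda>e. if e = d then f else (\<lambda>_. 0)"] exI[of _ d])
      (use graded graded_poly.zero in simp)
next
  case (add f g)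
  then obtain G N G' N' where G: "\<forall>e. graded_poly n r e (G e)" "\<forall>e>N. G e = (\<lambda>_. 0)" "\<forall>p. f p = (\<Sum>e\<le>N. G e p)"
    and G': "\<forall>e. graded_poly n r e (G' e)" "\<forall>e>N'. G' e = (\<lambda>_. 0)" "\<forall>p. g p = (\<Sum>e\<le>N'. G' e p)" by blast
  show ?case
  proof (intro exI[of _ "\<lambda>e p. G e p + G' e p"] exI[of _ "N + N'"] conjI allI impI)
    fix p
    have "(\<Sum>e\<le>N + N'. G e p) = (\<Sum>e\<le>N. G e p)" by (rule sum.mono_neutral_right) (use G(2) in auto)
    moreover have "(\<Sum>e\<le>N + N'. G' e p) = (\<Sum>e\<le>N'. G' e p)" by (rule sum.mono_neutral_right) (use G'(2) in auto)
    ultimately show "f p + g p = (\<Sum>e\<le>N + N'. G e p + G' e p)" 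
      using G(3)[rule_format, of p] G'(3)[rule_format, of p] by (simp add: sum.distrib)
  qed (use G G' graded_poly.add in auto)
qed

lemma homog_polys_graded:
  assumes "G \<in> homog_polys n r d"
  shows "\<exists>H. graded_poly n r d H \<and> (\<forall>x\<in>carrier_vec n. \<forall>u\<in>carrier_vec r. G (x, u) = H (x, u))"
proof -
  have "G \<in> graded_sums n r"
    using assms algebra_generated_subset_graded_sums by (auto simp: homog_polys_def)
  then obtain H N where H: "\<forall>e. graded_poly n r e (H e)" "\<forall>e>N. H e = (\<lambda>_. 0)" "\<forall>p. G p = (\<Sum>e\<le>N. H e p)"
    using graded_sums_decompose by blast
  have "G (x, u) = H d (x, u)" if x: "x \<in> carrier_vec n" and u: "u \<in> carrier_vec r" for x u
  proof -
    \<comment> \<open>Both sides are polynomials in the scaling factor \<open>c\<close>; the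
      coefficient of degree \<open>d\<close> singles out the component \<open>H d\<close>.\<close>
    have "poly (monom (G (x, u)) d) c = poly (\<Sum>e\<le>N. monom (H e (x, u)) e) c" for c
    proof -
      have "c ^ d * G (x, u) = (\<Sum>e\<le>N. H e (x, c \<cdot>\<^sub>v u))"
        using homog_polys_smult[OF assms x u, of c] H(3) by simp
      also have "\<dots> = (\<Sum>e\<le>N. c ^ e * H e (x, u))" 
        by (intro sum.cong refl graded_poly_smult[OF H(1)[rule_format] u])
      finally show ?thesis by (simp add: poly_monom poly_sum mult.commute)
    qed
    then have "monom (G (x, u)) d = (\<Sum>e\<le>N. monom (H e (x, u)) e)" using poly_eq_poly_eq_iff by blast
    then have "coeff (monom (G (x, u)) d) d = coeff (\<Sum>e\<le>N. monom (H e (x, u)) e) d" by simp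
    moreover have "coeff (\<Sum>e\<le>N. monom (H e (x, u)) e) d = (if d \<le> N then H d (x, u) else 0)"
      by (simp add: coeff_sum coeff_monom if_distrib cong: if_cong)
    ultimately show ?thesis using H(2) by (auto simp: coeff_monom split: if_splits)
  qed
  then show ?thesis using H(1) by blast
qed

lemma universally_closed_fst: "universally_closed E.V (subvariety (affine_space 7) hypersurface) fst"
  unfolding universally_closed_def Let_def
proof (intro allI impI)
  fix k :: nat and S h
  let ?Y = "subvariety (affine_space 7) hypersurface" and ?Z = "subvariety (affine_space k) S"
  assume "closedin (zar (affine_space k)) S \<and> morphism ?Z ?Y h"
  then have S: "S \<subseteq> carrier_vec k" and h: "morphism ?Z ?Y h"
    using graded_variety.closedin_iff[OF graded_variety_affine] by auto
  have grZ: "graded_variety ?Z S (\<lambda>_. polys k)" by (rule graded_variety_subvariety[OF graded_variety_affine S])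
  interpret Z: graded_variety ?Z S "\<lambda>_. polys k" by fact
  have h_in: "h z \<in> hypersurface" if "z \<in> S" for z
    using h that unfolding morphism_def continuous_map Y.points Z.points by auto
  let ?T = "zar_product E.V ?Z" and ?R = "{(x, z). fst x = h z}"
  show "closed_map (subtopology ?T ?R) (zar ?Z) snd"
    unfolding closed_map_def
  proof (intro allI impI)
    fix K assume "closedin (subtopology ?T ?R) K"
    then obtain K' where K': "closedin ?T K'" "K = K' \<inter> ?R" unfolding closedin_subtopology by blast
    have K'_sub: "K' \<subseteq> small_space \<times> S"
      using closedin_subset[OF K'(1)] by (simp add: topspace_zar_product E.points Z.points)
    show "closedin (zar ?Z) (snd ` K)"
      unfolding Z.closedin_iff
    proof (intro conjI ballI)
      show "snd ` K \<subseteq> S" using K' K'_sub by auto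
      fix z0 assume z0: "z0 \<in> S - snd ` K"
      \<comment> \<open>Quotients of polynomials on a neighbourhood of \<open>z0\<close> in
        \<open>S\<close>, with arbitrary values elsewhere.\<close>
      define R where "R = {f. \<exists>g\<in>polys k. \<exists>l\<in>polys k. l z0 \<noteq> 0 \<and> (\<forall>z\<in>S. l z \<noteq> 0 \<longrightarrow> f z = g z / l z)}"
      have RI: "f \<in> R" if "g \<in> polys k" "l \<in> polys k" "l z0 \<noteq> 0" "\<And>z. z \<in> S \<Longrightarrow> l z \<noteq> 0 \<Longrightarrow> f z = g z / l z" for f g l
        unfolding R_def using that by blast
      have polys_R: "g \<in> R" if "g \<in> polys k" for g
        by (rule RI[OF that polys_const[of 1]]) auto
      interpret function_ring R
      proof
        show "(\<lambda>_. c) \<in> R" for c by (rule polys_R[OF polys_const])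
        fix f g assume "f \<in> R" "g \<in> R"
        then obtain a l b l' where a: "a \<in> polys k" "l \<in> polys k" "l z0 \<noteq> 0" "\<forall>z\<in>S. l z \<noteq> 0 \<longrightarrow> f z = a z / l z"
          and b: "b \<in> polys k" "l' \<in> polys k" "l' z0 \<noteq> 0" "\<forall>z\<in>S. l' z \<noteq> 0 \<longrightarrow> g z = b z / l' z"
          unfolding R_def by blast
        show "(\<lambda>z. f z + g z) \<in> R"
          by (rule RI[of "\<lambda>z. a z * l' z + b z * l z" "\<lambda>z. l z * l' z"])
            (use a b in \<open>auto intro: polys_add polys_mult simp: field_simps\<close>)
        show "(\<lambda>z. f z * g z) \<in> R"
          by (rule RI[of "\<lambda>z. a z * b z" "\<lambda>z. l z * l' z"]) (use a b in \<open>auto intro: polys_mult\<close>)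
      qed
      have h_R: "(\<lambda>z. h z $ i) \<in> R" if i: "i < 7" for i
      proof -
        have Y_open: "openin (zar ?Y) hypersurface" using openin_topspace[of "zar ?Y"] by (simp add: Y.points)
        have Z_open: "openin (zar ?Z) S" using openin_topspace[of "zar ?Z"] by (simp add: Z.points)
        have "(\<lambda>y. y $ i) \<in> reg ?Y hypersurface"
          by (rule Y.quotient_reg[OF Y_open polys_coord[OF i] polys_const[of 1]]) simp
        then have "(\<lambda>y. y $ i) \<circ> h \<in> reg ?Z {x \<in> S. h x \<in> hypersurface}"
          using h Y_open unfolding morphism_def Z.points by blast
        moreover have "{x \<in> S. h x \<in> hypersurface} = S" using h_in by blast
        ultimately have "(\<lambda>y. y $ i) \<circ> h \<in> reg ?Z S" by simp
        then obtain g l where "g \<in> polys k" "l \<in> polys k" "l z0 \<noteq> 0"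
          "\<forall>z\<in>S. l z \<noteq> 0 \<longrightarrow> z \<in> S \<and> ((\<lambda>y. y $ i) \<circ> h) z = g z / l z"
          unfolding Z.reg_iff[OF Z_open] using z0 by blast
        then show ?thesis by (intro RI[of g l]) auto
      qed
      \<comment> \<open>The conic equation of \<open>incidence\<close>, solved for
        \<open>w^2\<close> and pulled back along \<open>h\<close>.\<close>
      define \<kappa> where "\<kappa> z s t = - (h z $ 0 * (t * t)) + (2 * h z $ 1 * (s * t) + - (h z $ 2 * (s * s)))" for z s t
      interpret conic_bundle R \<kappa>
      proof
        have "binary_form 2 (\<lambda>z s t. t * t)" "binary_form 2 (\<lambda>z s t. s * t)" "binary_form 2 (\<lambda>z s t. s * s)"
          using binary_form_mult[OF binary_form_t binary_form_t] binary_form_mult[OF binary_form_s binary_form_t]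
            binary_form_mult[OF binary_form_s binary_form_s] by (simp_all add: numeral_2_eq_2)
        then have "binary_form 2 (\<lambda>z s t. - h z $ 0 * (t * t))" "binary_form 2 (\<lambda>z s t. (2 * h z $ 1) * (s * t))"
          "binary_form 2 (\<lambda>z s t. - h z $ 2 * (s * s))"
          by (intro binary_form_scale uminus mult const h_R; simp)+
        then show "binary_form 2 \<kappa>" unfolding \<kappa>_def[abs_def] by (intro binary_form.sum) simp_all
      qed
      have plucker_form: "conic_form 1 (\<lambda>z s t w. plucker (h z) s t w $ j)" if "j < 6" for j
        using that conic_form_s conic_form_t conic_form_w unfolding less_6
        by (elim disjE) (auto intro!: conic_form_uminus conic_form_diff conic_form_scale mult const h_R)
      have poly_form: "conic_form d (\<lambda>z s t w. G (h z, plucker (h z) s t w))" if "graded_poly 7 6 d G" for d G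
        using that
      proof induction
        case (const c)
        show ?case by (rule conic_form_coeff[OF function_ring.const[OF function_ring_axioms]])
      next
        case (base i)
        then show ?case using conic_form_coeff[OF h_R] by simp
      next
        case (fibre j)
        then show ?case using plucker_form by simp
      next
        case (zero d)
        show ?case by (rule conic_form_zero)
      qed (auto intro: conic_form_add conic_form_mult)
      \<comment> \<open>The factor \<open>c\<close> between the chosen representative and the
        \<open>plucker\<close> vector enters only as \<open>c ^ d\<close>; being nonzero for actual
        points, it does not affect vanishing.\<close>
      have tensor_form: "\<exists>f. conic_form d f \<and> (\<forall>z\<in>S. \<forall>s t w c. s \<noteq> 0 \<or> t \<noteq> 0 \<longrightarrow>
          rep 6 (line (plucker (h z) s t w)) = c \<cdot>\<^sub>v plucker (h z) s t w \<longrightarrow>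
          \<Gamma> ((h z, line (plucker (h z) s t w)), z) = c ^ d * f z s t w)"
        if "\<Gamma> \<in> tensor (proj_forms 7 6 d) (polys k)" for \<Gamma> d
        using that
      proof induction
        case (pure g q)
        obtain G where G: "G \<in> homog_polys 7 6 d" "g = (\<lambda>(x, L). G (x, rep 6 L))"
          using pure(1) by (auto simp: proj_forms_def)
        obtain H where H: "graded_poly 7 6 d H"
          "\<forall>x\<in>carrier_vec 7. \<forall>u\<in>carrier_vec 6. G (x, u) = H (x, u)" using homog_polys_graded[OF G(1)] by blast
        show ?case
        proof (intro exI conjI ballI allI impI)
          show "conic_form d (\<lambda>z s t w. q z * H (h z, plucker (h z) s t w))"
            using poly_form[OF H(1)] polys_R[OF pure(2)] by (rule conic_form_scale)
          fix z s t w c assume z: "z \<in> S"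
            and c: "rep 6 (line (plucker (h z) s t w)) = c \<cdot>\<^sub>v plucker (h z) s t w"
          have "h z \<in> carrier_vec 7" using h_in[OF z] by (simp add: hypersurface_def)
          then show "g (fst ((h z, line (plucker (h z) s t w)), z)) * q (snd ((h z, line (plucker (h z) s t w)), z)) =
              c ^ d * (q z * H (h z, plucker (h z) s t w))"
            using H(2) graded_poly_smult[OF H(1) dim_plucker(1), of "h z" c "h z" s t w] by (simp add: G(2) c)
        qed
      next
        case (add f g)
        then obtain f' g' where "conic_form d f'" "conic_form d g'"
          "\<forall>z\<in>S. \<forall>s t w c. s \<noteq> 0 \<or> t \<noteq> 0 \<longrightarrow> rep 6 (line (plucker (h z) s t w)) = c \<cdot>\<^sub>v plucker (h z) s t w \<longrightarrow>
            f ((h z, line (plucker (h z) s t w)), z) = c ^ d * f' z s t w"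
          "\<forall>z\<in>S. \<forall>s t w c. s \<noteq> 0 \<or> t \<noteq> 0 \<longrightarrow> rep 6 (line (plucker (h z) s t w)) = c \<cdot>\<^sub>v plucker (h z) s t w \<longrightarrow>
            g ((h z, line (plucker (h z) s t w)), z) = c ^ d * g' z s t w" by blast
        then show ?case
          by (intro exI[of _ "\<lambda>z s t w. f' z s t w + g' z s t w"]) (auto intro: conic_form_add simp: distrib_left)
      qed
      \<comment> \<open>All homogeneous coordinates of the points of \<open>K\<close>.\<close>
      define K3 where "K3 = {(z, s, t, w) | z s t w. z \<in> S \<and> (s \<noteq> 0 \<or> t \<noteq> 0) \<and> incidence (h z) s t w \<and>
        ((h z, line (plucker (h z) s t w)), z) \<in> K'}"
      have conic: "w^2 = \<kappa> z s t" if "incidence (h z) s t w" for z s t w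
        using that unfolding incidence_def Let_def \<kappa>_def by (simp add: power2_eq_square algebra_simps)
      have "\<exists>\<delta>\<in>R. \<delta> z0 \<noteq> 0 \<and> (\<forall>(z, s, t, w)\<in>K3. \<delta> z = 0)"
      proof (rule conic_elimination)
        show "w^2 = \<kappa> z s t \<and> (s \<noteq> 0 \<or> t \<noteq> 0)" if "(z, s, t, w) \<in> K3" for z s t w
          using that conic by (auto simp: K3_def)
        fix s t w assume st: "s \<noteq> 0 \<or> t \<noteq> 0" and w: "w^2 = \<kappa> z0 s t"
        let ?L = "\<lambda>z s t w. line (plucker (h z) s t w)"
        show "\<exists>d f. conic_form d f \<and> (\<forall>(z, s, t, w)\<in>K3. f z s t w = 0) \<and> f z0 s t w \<noteq> 0"
        \<comment> \<open>A point of the conic over \<open>z0\<close> either lies on the blow-up,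
          and then outside \<open>K'\<close> because \<open>z0\<close> is not in the image, or
          violates one of the four linear equations, which is then itself the required form.\<close>
        proof (cases "incidence (h z0) s t w")
          case True
          have "h z0 \<in> carrier_vec 7" using h_in z0 by (auto simp: hypersurface_def)
          then have in_small: "(h z0, ?L z0 s t w) \<in> small_space" using st True by (intro small_spaceI)
          have "((h z0, ?L z0 s t w), z0) \<notin> K'" using z0 K'(2) by force
          then have "((h z0, ?L z0 s t w), z0) \<in> topspace ?T - K'"
            using in_small z0 by (simp add: topspace_zar_product E.points Z.points)
          moreover have "openin ?T (topspace ?T - K')" using K'(1) by blast
          ultimately obtain d \<Gamma> where \<Gamma>: "\<Gamma> \<in> tensor (proj_forms 7 6 d) (polys k)"
            "\<Gamma> ((h z0, ?L z0 s t w), z0) \<noteq> 0" "\<forall>q\<in>small_space \<times> S. \<Gamma> q \<noteq> 0 \<longrightarrow> q \<in> topspace ?T - K'"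
            using E.zar_product_affine_basis[OF grZ] by blast
          obtain f where f: "conic_form d f" "\<And>z s t w c. z \<in> S \<Longrightarrow> s \<noteq> 0 \<or> t \<noteq> 0 \<Longrightarrow>
              rep 6 (?L z s t w) = c \<cdot>\<^sub>v plucker (h z) s t w \<Longrightarrow> \<Gamma> ((h z, ?L z s t w), z) = c ^ d * f z s t w"
            using tensor_form[OF \<Gamma>(1)] by blast
          have c: "\<exists>c. c \<noteq> 0 \<and> rep 6 (?L z s t w) = c \<cdot>\<^sub>v plucker (h z) s t w" if "s \<noteq> 0 \<or> t \<noteq> 0" for z s t w
            by (rule rep_line[OF dim_plucker(1) plucker_neq_0[OF that]])
          have "f z s t w = 0" if in_K3: "(z, s, t, w) \<in> K3" for z s t w
          proof -
            have z: "z \<in> S" "s \<noteq> 0 \<or> t \<noteq> 0" "((h z, ?L z s t w), z) \<in> K'" using in_K3 by (auto simp: K3_def)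
            then have "\<Gamma> ((h z, ?L z s t w), z) = 0" using \<Gamma>(3) K'_sub by blast
            then show ?thesis using c[OF z(2), of z w] f(2)[OF z(1,2)] by auto
          qed
          moreover have "f z0 s t w \<noteq> 0"
          proof -
            obtain c0 where "rep 6 (?L z0 s t w) = c0 \<cdot>\<^sub>v plucker (h z0) s t w" using c[OF st] by blast
            from f(2)[OF _ st this] show ?thesis using \<Gamma>(2) z0 by auto
          qed
          ultimately show ?thesis using f(1) by blast
        next
          case False
          have lin: "conic_form 1 (\<lambda>z s t w. h z $ 4 * s - h z $ 5 * t - h z $ 6 * w)"
            "conic_form 1 (\<lambda>z s t w. (h z $ 3 + - (h z $ 1 * h z $ 6)) * s - h z $ 5 * w + (h z $ 0 * h z $ 6) * t)"
            "conic_form 1 (\<lambda>z s t w. h z $ 6 * (2 * h z $ 1 * t - h z $ 2 * s) - h z $ 4 * w +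
              (h z $ 3 + - (h z $ 1 * h z $ 6)) * t)"
            "conic_form 1 (\<lambda>z s t w. h z $ 5 * (2 * h z $ 1 * t - h z $ 2 * s) - (h z $ 0 * h z $ 4) * t -
              (h z $ 3 + - (h z $ 1 * h z $ 6)) * w)"
            by (intro conic_form_add conic_form_diff conic_form_scale conic_form_s conic_form_t conic_form_w
              h_R mult add uminus const; simp)+
          have "w^2 + h z0 $ 0 * t^2 - 2 * h z0 $ 1 * s * t + h z0 $ 2 * s^2 = 0"
            using w by (simp add: \<kappa>_def power2_eq_square algebra_simps)
          then consider "h z0 $ 4 * s - h z0 $ 5 * t - h z0 $ 6 * w \<noteq> 0"
            | "(h z0 $ 3 + - (h z0 $ 1 * h z0 $ 6)) * s - h z0 $ 5 * w + (h z0 $ 0 * h z0 $ 6) * t \<noteq> 0"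
            | "h z0 $ 6 * (2 * h z0 $ 1 * t - h z0 $ 2 * s) - h z0 $ 4 * w +
              (h z0 $ 3 + - (h z0 $ 1 * h z0 $ 6)) * t \<noteq> 0"
            | "h z0 $ 5 * (2 * h z0 $ 1 * t - h z0 $ 2 * s) - (h z0 $ 0 * h z0 $ 4) * t -
              (h z0 $ 3 + - (h z0 $ 1 * h z0 $ 6)) * w \<noteq> 0"
            using False unfolding incidence_def Let_def by auto
          moreover have "\<forall>(z, s, t, w)\<in>K3. h z $ 4 * s - h z $ 5 * t - h z $ 6 * w = 0"
            "\<forall>(z, s, t, w)\<in>K3. (h z $ 3 + - (h z $ 1 * h z $ 6)) * s - h z $ 5 * w + (h z $ 0 * h z $ 6) * t = 0"
            "\<forall>(z, s, t, w)\<in>K3. h z $ 6 * (2 * h z $ 1 * t - h z $ 2 * s) - h z $ 4 * w +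
              (h z $ 3 + - (h z $ 1 * h z $ 6)) * t = 0"
            "\<forall>(z, s, t, w)\<in>K3. h z $ 5 * (2 * h z $ 1 * t - h z $ 2 * s) - (h z $ 0 * h z $ 4) * t -
              (h z $ 3 + - (h z $ 1 * h z $ 6)) * w = 0"
            unfolding K3_def incidence_def Let_def by auto
          ultimately show ?thesis using lin by cases blast+
        qed
      qed
      then obtain \<delta> where \<delta>: "\<delta> \<in> R" "\<delta> z0 \<noteq> 0" "\<forall>(z, s, t, w)\<in>K3. \<delta> z = 0" by blast
      have \<delta>_0: "\<delta> z = 0" if z: "z \<in> snd ` K" for z
      proof -
        obtain y L where yL: "((y, L), z) \<in> K'" "y = h z" using z K'(2) by auto
        then have "(h z, L) \<in> small_space" "z \<in> S" using K'_sub by auto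
        then obtain s t w where "L = line (plucker (h z) s t w)" "s \<noteq> 0 \<or> t \<noteq> 0" "incidence (h z) s t w"
          by (auto simp: small_space_def)
        then have "(z, s, t, w) \<in> K3" using yL \<open>z \<in> S\<close> by (auto simp: K3_def)
        then show ?thesis using \<delta>(3) by blast
      qed
      obtain g l where g: "g \<in> polys k" "l \<in> polys k" "l z0 \<noteq> 0" "\<forall>z\<in>S. l z \<noteq> 0 \<longrightarrow> \<delta> z = g z / l z"
        using \<delta>(1) unfolding R_def by blast
      show "\<exists>d::nat. \<exists>f\<in>polys k. f z0 \<noteq> 0 \<and> (\<forall>q\<in>snd ` K. f q = 0)"
      \<comment> \<open>\<open>\<delta>\<close> equals \<open>g / l\<close> only where
        \<open>l\<close> is nonzero; the additional factor \<open>l\<close> covers the points of the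
        image where it is zero.\<close>
      proof (rule exI[of _ 0], rule bexI[OF _ polys_mult[OF g(1,2)]], intro conjI ballI)
        show "g z0 * l z0 \<noteq> 0" using g(3,4) \<delta>(2) z0 by auto
        fix z assume z: "z \<in> snd ` K"
        then have "z \<in> S" using K'(2) K'_sub by auto
        then show "g z * l z = 0" using g(4) \<delta>_0[OF z] by auto
      qed
    qed
  qed
qed

theorem lemma2p3:
  shows "small_resolution (blow_up 7 hypersurface minors)
           (subvariety (affine_space 7) hypersurface) fst"
  unfolding blow_up_eq small_resolution_def proper_morphism_def
  using morphism_fst E.separated_fst universally_closed_fst birational_fst smooth_small_space
    codim_exceptional[OF exceptional_subset] by blast

end
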